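(* Let $d\geq 1$ and $p\in\big(1,1+\frac{4}{d}\big)$, and let $V:\mathbb{R}^d\to[0,\infty)$ satisfy $V\in L^\infty_{loc}(\mathbb{R}^d)\cap C^\alpha(\mathbb{R}^d)$ for some $\alpha\in(0,1)$, $\inf_{x\in\mathbb{R}^d}V(x)=0$ and $\lim_{|x|\to\infty}V(x)=\infty$. Then: (i) for a.e. $\rho\in(0,\infty)$ there is a number $\mu_\rho\in\mathbb{R}$ such that every minimizer of $e(\rho)$ is a weak solution of $$-\Delta u+V(x)u=\mu_\rho u+\rho^{p-1}u^p\quad\text{in }\mathbb{R}^d,$$ i.e. all minimizers of $e(\rho)$ satisfy this equation with the same Lagrange multiplier $\mu=\mu_\rho$; (ii) for a.e. $\rho\in(0,\infty)$, $G_{\mu_\rho,\rho}=M_\rho$.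
   Context: Let $\mathcal{H}:=\{u\in H^1(\mathbb{R}^d):\int_{\mathbb{R}^d}V|u|^2\,dx<\infty\}$ with norm $\|u\|_{\mathcal H}=\big(\int_{\mathbb{R}^d}(|\nabla u|^2+(1+V)|u|^2)dx\big)^{1/2}$. For $\rho>0$ let $$E_\rho(u):=\frac12\int_{\mathbb{R}^d}|\nabla u|^2dx+\frac12\int_{\mathbb{R}^d}V|u|^2dx-\frac{\rho^{p-1}}{p+1}\int_{\mathbb{R}^d}|u|^{p+1}dx,\qquad e(\rho):=\inf\{E_\rho(u):u\in\mathcal H,\ \|u\|_2^2=1\},$$ and $M_\rho$ the set of minimizers of $e(\rho)$. For $\mu\in\mathbb{R}$ let $$F_{\mu,\rho}(u):=\frac12\int_{\mathbb{R}^d}|\nabla u|^2dx+\frac12\int_{\mathbb{R}^d}(V-\mu)|u|^2dx-\frac{\rho^{p-1}}{p+1}\int_{\mathbb{R}^d}|u|^{p+1}dx,$$ $S_{\mu,\rho}:=\{u\in\mathcal H\setminus\{0\}:\langle F_{\mu,\rho}'(u),\varphi\rangle=0\ \forall\varphi\in\mathcal H\}$ (the nontrivial weak solutions of $-\Delta u+Vu=\mu u+\rho^{p-1}u^p$), and $G_{\mu,\rho}:=\{u\in S_{\mu,\rho}:F_{\mu,\rho}(u)\le F_{\mu,\rho}(v)\ \forall v\in S_{\mu,\rho}\}$ (the set of ground states). *)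

theory Defs
  imports "HOL-Analysis.Analysis"
begin

fun iter_partial :: "'a::euclidean_space list \<Rightarrow> ('a \<Rightarrow> real) \<Rightarrow> ('a \<Rightarrow> real)" where
  "iter_partial [] f = f"
| "iter_partial (b # bs) f = (\<lambda>x. frechet_derivative (iter_partial bs f) (at x) b)"

definition test_fun :: "('a::euclidean_space \<Rightarrow> real) \<Rightarrow> bool" where
  "test_fun \<phi> \<longleftrightarrow>
     (\<forall>bs. set bs \<subseteq> Basis \<longrightarrow>
        (iter_partial bs \<phi>) differentiable_on UNIV \<and> continuous_on UNIV (iter_partial bs \<phi>))
     \<and> bounded {x. \<phi> x \<noteq> 0}"

definition weak_grad :: "('a::euclidean_space \<Rightarrow> real) \<Rightarrow> ('a \<Rightarrow> 'a) \<Rightarrow> bool" where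
  "weak_grad u g \<longleftrightarrow> g \<in> borel_measurable lebesgue \<and>
     (\<forall>\<phi>. test_fun \<phi> \<longrightarrow> (\<forall>b\<in>Basis.
        integrable lebesgue (\<lambda>x. u x * iter_partial [b] \<phi> x) \<and>
        integrable lebesgue (\<lambda>x. (g x \<bullet> b) * \<phi> x) \<and>
        (\<integral>x. u x * iter_partial [b] \<phi> x \<partial>lebesgue) = - (\<integral>x. (g x \<bullet> b) * \<phi> x \<partial>lebesgue)))"

definition H1 :: "('a::euclidean_space \<Rightarrow> real) \<Rightarrow> bool" where
  "H1 u \<longleftrightarrow> u \<in> borel_measurable lebesgue \<and> integrable lebesgue (\<lambda>x. (u x)\<^sup>2) \<and>
     (\<exists>g. weak_grad u g \<and> integrable lebesgue (\<lambda>x. (norm (g x))\<^sup>2))"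

definition grad :: "('a::euclidean_space \<Rightarrow> real) \<Rightarrow> ('a \<Rightarrow> 'a)" where
  "grad u = (SOME g. weak_grad u g \<and> integrable lebesgue (\<lambda>x. (norm (g x))\<^sup>2))"

definition calH :: "('a::euclidean_space \<Rightarrow> real) \<Rightarrow> ('a \<Rightarrow> real) \<Rightarrow> bool" where
  "calH V u \<longleftrightarrow> H1 u \<and> integrable lebesgue (\<lambda>x. V x * (u x)\<^sup>2)"

definition L2sq :: "('a::euclidean_space \<Rightarrow> real) \<Rightarrow> real" where
  "L2sq u = (\<integral>x. (u x)\<^sup>2 \<partial>lebesgue)"

definition E_fun :: "('a::euclidean_space \<Rightarrow> real) \<Rightarrow> real \<Rightarrow> real \<Rightarrow> ('a \<Rightarrow> real) \<Rightarrow> real" where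
  "E_fun V p \<rho> u =
     1/2 * (\<integral>x. (norm (grad u x))\<^sup>2 \<partial>lebesgue) + 1/2 * (\<integral>x. V x * (u x)\<^sup>2 \<partial>lebesgue)
     - \<rho> powr (p - 1) / (p + 1) * (\<integral>x. \<bar>u x\<bar> powr (p + 1) \<partial>lebesgue)"

definition e_val :: "('a::euclidean_space \<Rightarrow> real) \<Rightarrow> real \<Rightarrow> real \<Rightarrow> real" where
  "e_val V p \<rho> = Inf {E_fun V p \<rho> u | u. calH V u \<and> L2sq u = 1}"

definition M_set :: "('a::euclidean_space \<Rightarrow> real) \<Rightarrow> real \<Rightarrow> real \<Rightarrow> ('a \<Rightarrow> real) set" where
  "M_set V p \<rho> = {u. calH V u \<and> L2sq u = 1 \<and>
       (\<forall>v. calH V v \<and> L2sq v = 1 \<longrightarrow> E_fun V p \<rho> u \<le> E_fun V p \<rho> v)}"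

definition F_fun :: "('a::euclidean_space \<Rightarrow> real) \<Rightarrow> real \<Rightarrow> real \<Rightarrow> real \<Rightarrow> ('a \<Rightarrow> real) \<Rightarrow> real" where
  "F_fun V p \<mu> \<rho> u =
     1/2 * (\<integral>x. (norm (grad u x))\<^sup>2 \<partial>lebesgue) + 1/2 * (\<integral>x. (V x - \<mu>) * (u x)\<^sup>2 \<partial>lebesgue)
     - \<rho> powr (p - 1) / (p + 1) * (\<integral>x. \<bar>u x\<bar> powr (p + 1) \<partial>lebesgue)"

text \<open>\<langle>F'(u), \<phi>\<rangle>; the nonlinearity u^p is read as |u|^(p-1) u.\<close>
definition dF :: "('a::euclidean_space \<Rightarrow> real) \<Rightarrow> real \<Rightarrow> real \<Rightarrow> real \<Rightarrow> ('a \<Rightarrow> real) \<Rightarrow> ('a \<Rightarrow> real) \<Rightarrow> real" where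
  "dF V p \<mu> \<rho> u \<phi> =
     (\<integral>x. grad u x \<bullet> grad \<phi> x \<partial>lebesgue) + (\<integral>x. (V x - \<mu>) * u x * \<phi> x \<partial>lebesgue)
     - \<rho> powr (p - 1) * (\<integral>x. \<bar>u x\<bar> powr (p - 1) * u x * \<phi> x \<partial>lebesgue)"

definition S_set :: "('a::euclidean_space \<Rightarrow> real) \<Rightarrow> real \<Rightarrow> real \<Rightarrow> real \<Rightarrow> ('a \<Rightarrow> real) set" where
  "S_set V p \<mu> \<rho> = {u. calH V u \<and> \<not> (AE x in lebesgue. u x = 0) \<and>
       (\<forall>\<phi>. calH V \<phi> \<longrightarrow> dF V p \<mu> \<rho> u \<phi> = 0)}"

definition G_set :: "('a::euclidean_space \<Rightarrow> real) \<Rightarrow> real \<Rightarrow> real \<Rightarrow> real \<Rightarrow> ('a \<Rightarrow> real) set" where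
  "G_set V p \<mu> \<rho> = {u \<in> S_set V p \<mu> \<rho>. \<forall>v\<in>S_set V p \<mu> \<rho>. F_fun V p \<mu> \<rho> u \<le> F_fun V p \<mu> \<rho> v}"

end

theory Submission
  imports Defs "HOL-Complex_Analysis.Great_Picard"
begin

text \<open>
  Put \<open>t = \<rho>\<^sup>p\<^sup>-\<^sup>1\<close> and \<open>B u = \<integral>\<bar>u\<bar>\<^sup>p\<^sup>+\<^sup>1\<close>. Since \<open>E\<^sub>\<rho>\<close> is affine and decreasing in \<open>t\<close>, comparing the minimizers for two
  parameters shows that \<open>B\<close> is monotone in \<open>\<rho>\<close> along minimizers; hence \<open>B\<close> takes a single value on \<open>M\<^sub>\<rho>\<close> for all but
  countably many \<open>\<rho>\<close>, and so does the Lagrange multiplier, which is an affine function of \<open>e \<rho>\<close> and \<open>B\<close>.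
  A nontrivial weak solution \<open>v\<close> is the strict maximum point of \<open>F\<close> on the ray through \<open>v\<close>, so
  \<open>F v \<ge> F (v / \<parallel>v\<parallel>) \<ge> e \<rho> - \<mu> / 2\<close>, with equality exactly for minimizers.

  Minimizers exist by the direct method. Everything rests on the translation estimate
  \<open>\<parallel>u (\<cdot> + h) - u\<parallel> \<le> \<bar>h\<bar> \<parallel>\<nabla>u\<parallel>\<close>, which bounds the \<open>L\<^sup>2\<close>-distance of \<open>u\<close> to its averages over cubes of side \<open>l\<close> by
  a multiple of \<open>l \<parallel>\<nabla>u\<parallel>\<close>. Because the averages are at most \<open>l\<^sup>-\<^sup>d\<^sup>/\<^sup>2 \<parallel>u\<parallel>\<close>, this controls \<open>u\<close> on \<open>{\<bar>u\<bar> > \<lambda>}\<close>, and summing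
  over dyadic \<open>\<lambda>\<close> gives the mass-subcritical Gagliardo--Nirenberg inequality; because only countably many averages
  occur on a grid, it also gives compactness in \<open>L\<^sup>2\<close>.
\<close>

subsection \<open>Square-integrable functions\<close>

text \<open>Weak gradients are known only through integrals against test functions. So u is never
  mollified: bounds on L2 functions are obtained by duality, which works because test functions are
  dense. That density is the purpose of the explicit bumps.

  Testing the Euler-Lagrange equation with the minimizer u itself gives \<mu> = A - t B, where A is
  the quadratic form at u. Since e = A/2 - t B/q with q = p + 1, this is \<mu> = 2 e - (1 - 2/q) t
  B, so a common B is exactly what a common multiplier requires.

  The subcritical range enters through the dyadic sum: its levels form a geometric series of ratio
  2^(q - 2 - 4/d) < 1. A high lowest level makes the gradient coefficient as small as desired, which
  yields both the lower bound of the energy and the passage to the limit in B.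

  The comparison of ground states with minimizers starts from a given minimizer. Existence settles
  the other case: a weak solution rescaled to unit mass is an admissible competitor, so where there
  is no minimizer there is no weak solution either.\<close>

definition sq_int :: "'a measure \<Rightarrow> ('a \<Rightarrow> 'b::euclidean_space) \<Rightarrow> bool" where
  "sq_int M f \<longleftrightarrow> f \<in> borel_measurable M \<and> integrable M (\<lambda>x. (norm (f x))\<^sup>2)"

text \<open>Kept squared, so that expansions of linear combinations are polynomial identities. The
  general codomain serves functions and gradients alike. Without \<open>sq_int\<close> the integral
  may be the default 0, so most estimates carry that hypothesis.\<close>

definition sqnorm :: "'a measure \<Rightarrow> ('a \<Rightarrow> 'b::euclidean_space) \<Rightarrow> real" where
  "sqnorm M f = (\<integral>x. (norm (f x))\<^sup>2 \<partial>M)"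

abbreviation "L2 \<equiv> sq_int lebesgue"
abbreviation "nrm2 \<equiv> sqnorm lebesgue"
abbreviation "L2_tendsto M F f \<equiv> (\<lambda>n. sqnorm M (\<lambda>x. F n x - f x)) \<longlonglongrightarrow> 0"
abbreviation "lmeas f \<equiv> f \<in> borel_measurable lebesgue"

lemma sq_int_meas: "sq_int M f \<Longrightarrow> f \<in> borel_measurable M"
  by (simp add: sq_int_def)

lemma sq_int_norm: "sq_int M f \<Longrightarrow> integrable M (\<lambda>x. (norm (f x))\<^sup>2)"
  by (simp add: sq_int_def)

lemma sqnorm_nonneg: "0 \<le> sqnorm M f"
  by (simp add: sqnorm_def)

lemma sq_int_inner:
  assumes "sq_int M f" "sq_int M g"
  shows "integrable M (\<lambda>x. f x \<bullet> g x)"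
proof (rule Bochner_Integration.integrable_bound)
  show "integrable M (\<lambda>x. (norm (f x))\<^sup>2 + (norm (g x))\<^sup>2)"
    using assms by (simp add: sq_int_def)
  show "(\<lambda>x. f x \<bullet> g x) \<in> borel_measurable M"
    using assms by (auto simp: sq_int_def intro: borel_measurable_inner)
  have "\<bar>a \<bullet> b\<bar> \<le> (norm a)\<^sup>2 + (norm b)\<^sup>2" for a b :: 'b
    using Cauchy_Schwarz_ineq2[of a b] sum_squares_bound[of "norm a" "norm b"]
      zero_le_power2[of "norm a"] zero_le_power2[of "norm b"]
      mult_nonneg_nonneg[OF norm_ge_zero[of a] norm_ge_zero[of b]] by linarith
  then show "AE x in M. norm (f x \<bullet> g x) \<le> norm ((norm (f x))\<^sup>2 + (norm (g x))\<^sup>2)"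
    by simp
qed

lemma norm_lincomb_sq:
  fixes a b :: "'b::real_inner"
  shows "(norm (s *\<^sub>R a + t *\<^sub>R b))\<^sup>2 = s\<^sup>2 * (norm a)\<^sup>2 + 2 * s * t * (a \<bullet> b) + t\<^sup>2 * (norm b)\<^sup>2"
  unfolding power2_norm_eq_inner
  by (simp add: inner_add_left inner_add_right inner_commute power2_eq_square algebra_simps)

lemma sq_int_lincomb:
  assumes "sq_int M f" "sq_int M g"
  shows "sq_int M (\<lambda>x. s *\<^sub>R f x + t *\<^sub>R g x)"
  unfolding sq_int_def norm_lincomb_sq
  using assms sq_int_inner[OF assms] by (auto simp: sq_int_def)

lemma sqnorm_lincomb:
  assumes "sq_int M f" "sq_int M g"
  shows "sqnorm M (\<lambda>x. s *\<^sub>R f x + t *\<^sub>R g x)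
    = s\<^sup>2 * sqnorm M f + 2 * s * t * (\<integral>x. f x \<bullet> g x \<partial>M) + t\<^sup>2 * sqnorm M g"
  unfolding sqnorm_def norm_lincomb_sq
  using assms sq_int_inner[OF assms] by (simp add: sq_int_def)

lemma sq_int_add: "sq_int M f \<Longrightarrow> sq_int M g \<Longrightarrow> sq_int M (\<lambda>x. f x + g x)"
  using sq_int_lincomb[of M f g 1 1] by simp

lemma sq_int_diff: "sq_int M f \<Longrightarrow> sq_int M g \<Longrightarrow> sq_int M (\<lambda>x. f x - g x)"
  using sq_int_lincomb[of M f g 1 "-1"] by simp

lemma sq_int_scaleR: "sq_int M f \<Longrightarrow> sq_int M (\<lambda>x. c *\<^sub>R f x)"
  using sq_int_lincomb[of M f f c 0] by simp

lemma sqnorm_scaleR: "sqnorm M (\<lambda>x. c *\<^sub>R f x) = c\<^sup>2 * sqnorm M f"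
  by (simp add: sqnorm_def power_mult_distrib)

lemma sqnorm_minus_commute: "sqnorm M (\<lambda>x. f x - g x) = sqnorm M (\<lambda>x. g x - f x)"
  by (simp add: sqnorm_def norm_minus_commute)

lemma sqnorm_eq_0_iff:
  assumes "sq_int M f"
  shows "sqnorm M f = 0 \<longleftrightarrow> (AE x in M. f x = 0)"
  unfolding sqnorm_def using assms
  by (subst integral_nonneg_eq_0_iff_AE) (auto simp: sq_int_def)

lemma sqnorm_mono_AE:
  assumes "sq_int M g" "f \<in> borel_measurable M" "AE x in M. norm (f x) \<le> norm (g x)"
  shows "sq_int M f" "sqnorm M f \<le> sqnorm M g"
proof -
  have le: "AE x in M. (norm (f x))\<^sup>2 \<le> (norm (g x))\<^sup>2"
    using assms(3) by eventually_elim (simp add: power_mono)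
  have m: "(\<lambda>x. (norm (f x))\<^sup>2) \<in> borel_measurable M" using assms(2) by simp
  have "integrable M (\<lambda>x. (norm (f x))\<^sup>2)"
    by (rule Bochner_Integration.integrable_bound[OF sq_int_norm[OF assms(1)] m])
       (use le in auto)
  then show "sq_int M f" using assms(2) by (simp add: sq_int_def)
  then show "sqnorm M f \<le> sqnorm M g"
    unfolding sqnorm_def by (intro integral_mono_AE sq_int_norm assms(1) le)
qed

lemma sq_Cauchy_Schwarz:
  assumes "sq_int M f" "sq_int M g"
  shows "(\<integral>x. f x \<bullet> g x \<partial>M)\<^sup>2 \<le> sqnorm M f * sqnorm M g"
proof -
  let ?I = "\<integral>x. f x \<bullet> g x \<partial>M"
  have q: "0 \<le> s\<^sup>2 * sqnorm M f + 2 * s * t * ?I + t\<^sup>2 * sqnorm M g" for s t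
    using sqnorm_nonneg[of M "\<lambda>x. s *\<^sub>R f x + t *\<^sub>R g x"] sqnorm_lincomb[OF assms, of s t] by simp
  show ?thesis
  proof (cases "sqnorm M g = 0")
    case True
    have "?I = 0"
    proof (rule ccontr)
      assume "?I \<noteq> 0"
      \<comment> \<open>If g has norm 0, the quadratic polynomial is affine in t, and this t makes
        it equal to -1.\<close>
      with q[of 1 "- (sqnorm M f + 1) / (2 * ?I)"] True show False by (simp add: field_simps)
    qed
    with True show ?thesis by simp
  next
    case False
    then have g: "sqnorm M g > 0" using sqnorm_nonneg[of M g] by simp
    have "0 \<le> sqnorm M g * (sqnorm M f * sqnorm M g - ?I\<^sup>2)"
      using q[of "sqnorm M g" "- ?I"] by (simp add: power2_eq_square algebra_simps)
    then show ?thesis using g by (simp add: zero_le_mult_iff)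
  qed
qed

lemma sq_Cauchy_Schwarz_abs:
  assumes "sq_int M f" "sq_int M g"
  shows "\<bar>\<integral>x. f x \<bullet> g x \<partial>M\<bar> \<le> sqrt (sqnorm M f) * sqrt (sqnorm M g)"
  using sq_Cauchy_Schwarz[OF assms] by (metis real_sqrt_abs real_sqrt_le_iff real_sqrt_mult)

text \<open>The parallelogram law with the squared norm of the difference dropped.\<close>

lemma sqnorm_add_le:
  assumes "sq_int M f" "sq_int M g"
  shows "sqnorm M (\<lambda>x. f x + g x) \<le> 2 * sqnorm M f + 2 * sqnorm M g"
  using sqnorm_lincomb[OF assms, of 1 1] sqnorm_lincomb[OF assms, of 1 "-1"]
    sqnorm_nonneg[of M "\<lambda>x. 1 *\<^sub>R f x + -1 *\<^sub>R g x"] by simp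

lemma sqnorm_diff_le:
  assumes "sq_int M f" "sq_int M g"
  shows "sqnorm M (\<lambda>x. f x - g x) \<le> 2 * sqnorm M f + 2 * sqnorm M g"
  using sqnorm_lincomb[OF assms, of 1 1] sqnorm_lincomb[OF assms, of 1 "-1"]
    sqnorm_nonneg[of M "\<lambda>x. 1 *\<^sub>R f x + 1 *\<^sub>R g x"] by simp

lemma sqnorm_triangle:
  assumes "sq_int M f" "sq_int M g"
  shows "sqrt (sqnorm M (\<lambda>x. f x + g x)) \<le> sqrt (sqnorm M f) + sqrt (sqnorm M g)"
proof (rule real_le_lsqrt)
  show "sqnorm M (\<lambda>x. f x + g x) \<le> (sqrt (sqnorm M f) + sqrt (sqnorm M g))\<^sup>2"
    using sqnorm_lincomb[OF assms, of 1 1] sq_Cauchy_Schwarz_abs[OF assms]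
    by (simp add: power2_sum sqnorm_nonneg)
qed (simp add: sqnorm_nonneg)

lemma sqnorm_limit_le:
  assumes F: "\<And>n. sq_int M (F n)" and f: "sq_int M f"
    and lim: "L2_tendsto M F f" and K: "\<And>n. sqnorm M (F n) \<le> K"
  shows "sqnorm M f \<le> K"
proof -
  have K0: "0 \<le> K" using sqnorm_nonneg[of M "F 0"] K[of 0] by linarith
  have "sqrt (sqnorm M f) \<le> sqrt K + sqrt (sqnorm M (\<lambda>x. F n x - f x))" for n
  proof -
    have "sqrt (sqnorm M (\<lambda>x. F n x + (f x - F n x)))
        \<le> sqrt (sqnorm M (F n)) + sqrt (sqnorm M (\<lambda>x. f x - F n x))"
      by (intro sqnorm_triangle F sq_int_diff f)
    also have "\<dots> \<le> sqrt K + sqrt (sqnorm M (\<lambda>x. F n x - f x))"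
      using K[of n] sqnorm_minus_commute[of M f "F n"] by simp
    finally show ?thesis by simp
  qed
  moreover have "(\<lambda>n. sqrt K + sqrt (sqnorm M (\<lambda>x. F n x - f x))) \<longlonglongrightarrow> sqrt K + sqrt 0"
    by (intro tendsto_intros lim)
  ultimately have "sqrt (sqnorm M f) \<le> sqrt K + sqrt 0"
    by (intro LIMSEQ_le_const[of _ "sqrt K + sqrt 0"]) auto
  then show ?thesis by simp
qed

lemma inner_integral_tendsto:
  assumes F: "\<And>n. sq_int M (F n)" and f: "sq_int M f" and g: "sq_int M g"
    and lim: "L2_tendsto M F f"
  shows "(\<lambda>n. \<integral>x. F n x \<bullet> g x \<partial>M) \<longlonglongrightarrow> (\<integral>x. f x \<bullet> g x \<partial>M)"
proof (rule LIM_zero_cancel, rule tendsto_rabs_zero_cancel,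
    rule tendsto_sandwich[where f = "\<lambda>_. 0" and h = "\<lambda>n. sqrt (sqnorm M (\<lambda>x. F n x - f x)) * sqrt (sqnorm M g)"])
  have "\<bar>(\<integral>x. F n x \<bullet> g x \<partial>M) - (\<integral>x. f x \<bullet> g x \<partial>M)\<bar>
      \<le> sqrt (sqnorm M (\<lambda>x. F n x - f x)) * sqrt (sqnorm M g)" for n
    using sq_Cauchy_Schwarz_abs[OF sq_int_diff[OF F[of n] f] g]
    by (simp add: inner_diff_left sq_int_inner F f g)
  then show "\<forall>\<^sub>F n in sequentially. \<bar>(\<integral>x. F n x \<bullet> g x \<partial>M) - (\<integral>x. f x \<bullet> g x \<partial>M)\<bar>
      \<le> sqrt (sqnorm M (\<lambda>x. F n x - f x)) * sqrt (sqnorm M g)" by simp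
  have "(\<lambda>n. sqrt (sqnorm M (\<lambda>x. F n x - f x)) * sqrt (sqnorm M g)) \<longlonglongrightarrow> sqrt 0 * sqrt (sqnorm M g)"
    by (intro tendsto_intros lim)
  then show "(\<lambda>n. sqrt (sqnorm M (\<lambda>x. F n x - f x)) * sqrt (sqnorm M g)) \<longlonglongrightarrow> 0" by simp
qed auto

lemma sq_limit_AE_subseq:
  fixes F :: "nat \<Rightarrow> 'a \<Rightarrow> 'b::euclidean_space"
  assumes F: "\<And>n. sq_int M (F n)" and f: "sq_int M f"
    and lim: "L2_tendsto M F f"
  shows "\<exists>r::nat\<Rightarrow>nat. strict_mono r \<and> (AE x in M. (\<lambda>n. F (r n) x) \<longlonglongrightarrow> f x)"
proof -
  have "\<exists>r::nat\<Rightarrow>nat. strict_mono r \<and> (AE x in M. (\<lambda>n. (norm (F (r n) x - f x))\<^sup>2) \<longlonglongrightarrow> 0)"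
    using lim unfolding sqnorm_def
    by (intro tendsto_L1_AE_subseq)
       (use sq_int_norm[OF sq_int_diff[OF F f]] in auto)
  then obtain r where r: "strict_mono r" "AE x in M. (\<lambda>n. (norm (F (r n) x - f x))\<^sup>2) \<longlonglongrightarrow> 0" by auto
  from r(2) have "AE x in M. (\<lambda>n. F (r n) x) \<longlonglongrightarrow> f x"
  proof eventually_elim
    case (elim x)
    from tendsto_real_sqrt[OF elim] have "(\<lambda>n. norm (F (r n) x - f x)) \<longlonglongrightarrow> 0" by simp
    then show ?case by (simp add: LIM_zero_cancel tendsto_norm_zero_iff)
  qed
  with r(1) show ?thesis by auto
qed

lemma ennreal_sqnorm: "sq_int M f \<Longrightarrow> ennreal (sqnorm M f) = (\<integral>\<^sup>+x. ennreal ((norm (f x))\<^sup>2) \<partial>M)"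
  unfolding sqnorm_def by (subst nn_integral_eq_integral) (auto simp: sq_int_def)

text \<open>Fatou's lemma for squared norms. The bound is asked only eventually, so that it applies
  with K slightly above a limit of the norms.\<close>

lemma sq_Fatou:
  assumes F: "\<And>n. sq_int M (F n)" and f: "f \<in> borel_measurable M"
    and lim: "AE x in M. (\<lambda>n. F n x) \<longlonglongrightarrow> f x" and K: "\<forall>\<^sub>F n in sequentially. sqnorm M (F n) \<le> K"
  shows "sq_int M f" "sqnorm M f \<le> K"
proof -
  obtain N where N: "sqnorm M (F N) \<le> K" using K by (auto simp: eventually_sequentially)
  then have K0: "0 \<le> K" using sqnorm_nonneg[of M "F N"] by linarith
  have "(\<integral>\<^sup>+x. ennreal ((norm (f x))\<^sup>2) \<partial>M) = (\<integral>\<^sup>+x. liminf (\<lambda>n. ennreal ((norm (F n x))\<^sup>2)) \<partial>M)"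
  proof (rule nn_integral_cong_AE)
    from lim show "AE x in M. ennreal ((norm (f x))\<^sup>2) = liminf (\<lambda>n. ennreal ((norm (F n x))\<^sup>2))"
    proof eventually_elim
      case (elim x)
      have "(\<lambda>n. ennreal ((norm (F n x))\<^sup>2)) \<longlonglongrightarrow> ennreal ((norm (f x))\<^sup>2)"
        by (intro tendsto_ennrealI tendsto_intros elim)
      then show ?case by (metis lim_imp_Liminf trivial_limit_sequentially)
    qed
  qed
  also have "\<dots> \<le> liminf (\<lambda>n. \<integral>\<^sup>+x. ennreal ((norm (F n x))\<^sup>2) \<partial>M)"
    by (rule nn_integral_liminf) (use sq_int_meas[OF F] in measurable)
  also have "\<dots> = liminf (\<lambda>n. ennreal (sqnorm M (F n)))"
    by (simp add: ennreal_sqnorm F)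
  also have "\<dots> \<le> ennreal K"
    by (rule Liminf_le) (use K in \<open>auto elim!: eventually_mono intro: ennreal_leI\<close>)
  finally have le: "(\<integral>\<^sup>+x. ennreal ((norm (f x))\<^sup>2) \<partial>M) \<le> ennreal K" .
  then have "(\<integral>\<^sup>+x. ennreal ((norm (f x))\<^sup>2) \<partial>M) < \<infinity>"
    by (metis ennreal_less_top infinity_ennreal_def le_less_trans)
  then show s: "sq_int M f"
    using f by (auto simp: sq_int_def integrable_iff_bounded)
  show "sqnorm M f \<le> K" using le K0 by (simp add: ennreal_sqnorm[OF s, symmetric])
qed

text \<open>Riesz-Fischer. Along a subsequence the squared increments have integral below 4^-k.
  Weighting them by 2^k keeps the integrated series finite, so a.e. the increments are O(2^(-k/2))
  and summable. Fatou then turns the pointwise limit into an L2 limit of the whole sequence.\<close>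

lemma sq_complete:
  fixes F :: "nat \<Rightarrow> 'a \<Rightarrow> 'b::euclidean_space"
  assumes F: "\<And>n. sq_int M (F n)"
    and Cauchy: "\<And>e. 0 < e \<Longrightarrow> \<exists>N. \<forall>m\<ge>N. \<forall>n\<ge>N. sqnorm M (\<lambda>x. F m x - F n x) < e"
  shows "\<exists>f. sq_int M f \<and> L2_tendsto M F f"
proof -
  note [measurable] = sq_int_meas[OF F]
  have "\<exists>r. \<forall>k. (\<forall>m\<ge>r k. \<forall>n\<ge>r k. sqnorm M (\<lambda>x. F m x - F n x) < (1/4)^k) \<and> r k < r (Suc k)"
  proof (rule dependent_nat_choice)
    show "\<exists>a. \<forall>m\<ge>a. \<forall>n\<ge>a. sqnorm M (\<lambda>x. F m x - F n x) < (1/4)^0"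
      by (rule Cauchy) simp
  next
    fix a :: nat and k :: nat
    obtain N where N: "\<forall>m\<ge>N. \<forall>n\<ge>N. sqnorm M (\<lambda>x. F m x - F n x) < (1/4)^(Suc k)"
      using Cauchy[of "(1/4)^(Suc k)"] by auto
    show "\<exists>b. (\<forall>m\<ge>b. \<forall>n\<ge>b. sqnorm M (\<lambda>x. F m x - F n x) < (1/4)^(Suc k)) \<and> a < b"
      by (rule exI[of _ "max N (Suc a)"]) (use N in auto)
  qed
  then obtain r where r: "\<And>k m n. m \<ge> r k \<Longrightarrow> n \<ge> r k \<Longrightarrow> sqnorm M (\<lambda>x. F m x - F n x) < (1/4)^k"
    and mono: "\<And>k. r k < r (Suc k)" by blast
  have smono: "strict_mono r" using mono by (simp add: strict_mono_Suc_iff)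
  define d where "d k x = F (r (Suc k)) x - F (r k) x" for k x
  have d: "sq_int M (d k)" for k unfolding d_def by (intro sq_int_diff F)
  note [measurable] = sq_int_meas[OF d]
  have dn: "(\<integral>\<^sup>+x. ennreal ((norm (d k x))\<^sup>2) \<partial>M) \<le> ennreal ((1/4)^k)" for k
  proof -
    have "sqnorm M (d k) \<le> (1/4)^k"
      using r[of k "r (Suc k)" "r k"] mono[of k] by (simp add: d_def[abs_def])
    then show ?thesis by (simp only: ennreal_sqnorm[OF d, symmetric] ennreal_leI)
  qed
  have "(\<integral>\<^sup>+x. (\<Sum>k. ennreal (2^k * (norm (d k x))\<^sup>2)) \<partial>M)
      = (\<Sum>k. \<integral>\<^sup>+x. ennreal (2^k) * ennreal ((norm (d k x))\<^sup>2) \<partial>M)"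
    by (subst nn_integral_suminf) (auto simp: ennreal_mult)
  also have "\<dots> = (\<Sum>k. ennreal (2^k) * (\<integral>\<^sup>+x. ennreal ((norm (d k x))\<^sup>2) \<partial>M))"
    by (subst nn_integral_cmult) auto
  also have "\<dots> \<le> (\<Sum>k. ennreal (2^k) * ennreal ((1/4)^k))"
    by (intro suminf_le mult_left_mono dn) auto
  also have "\<dots> = (\<Sum>k. ennreal ((1/2)^k))"
    by (simp add: ennreal_mult[symmetric] power_mult_distrib[symmetric])
  also have "\<dots> = ennreal (\<Sum>k. (1/2)^k)"
    by (intro suminf_ennreal2) (auto intro: summable_geometric)
  finally have "(\<integral>\<^sup>+x. (\<Sum>k. ennreal (2^k * (norm (d k x))\<^sup>2)) \<partial>M) \<noteq> \<infinity>"
    by (auto simp: top_unique)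
  then have "AE x in M. (\<Sum>k. ennreal (2^k * (norm (d k x))\<^sup>2)) \<noteq> \<infinity>"
    by (intro nn_integral_noteq_infinite) auto
  then have conv: "AE x in M. convergent (\<lambda>k. F (r k) x)"
  proof eventually_elim
    case (elim x)
    then have "summable (\<lambda>k. 2^k * (norm (d k x))\<^sup>2)"
      by (intro summable_suminf_not_top) auto
    then have "(\<lambda>k. 2^k * (norm (d k x))\<^sup>2) \<longlonglongrightarrow> 0" by (rule summable_LIMSEQ_zero)
    then have "Bseq (\<lambda>k. 2^k * (norm (d k x))\<^sup>2)" by (intro convergent_imp_Bseq convergentI)
    then obtain B where B: "B > 0" "\<And>k. norm (2^k * (norm (d k x))\<^sup>2) \<le> B" by (auto elim: BseqE)
    have db: "norm (d k x) \<le> sqrt B * (1 / sqrt 2)^k" for k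
    proof -
      have "(norm (d k x))\<^sup>2 \<le> B * (1/2)^k" using B(2)[of k] by (simp add: field_simps)
      then have "sqrt ((norm (d k x))\<^sup>2) \<le> sqrt (B * (1/2)^k)" by (rule real_sqrt_le_mono)
      then show ?thesis by (simp add: real_sqrt_mult real_sqrt_power real_sqrt_divide)
    qed
    have "summable (\<lambda>k. sqrt B * (1 / sqrt 2)^k)"
      by (intro summable_mult summable_geometric) simp
    then have "summable (\<lambda>k. d k x)"
      by (rule summable_comparison_test[rotated]) (use db in auto)
    then have "convergent (\<lambda>n. \<Sum>k<n. d k x)" by (simp add: summable_iff_convergent)
    then have "convergent (\<lambda>n. F (r n) x - F (r 0) x)"
      unfolding d_def by (simp add: sum_lessThan_telescope[of "\<lambda>n. F (r n) x"])
    from convergent_add[OF this convergent_const[of "F (r 0) x"]] show ?case by simp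
  qed
  define f where "f x = lim (\<lambda>k. F (r k) x)" for x
  have [measurable]: "f \<in> borel_measurable M" unfolding f_def by measurable
  have lim: "AE x in M. (\<lambda>k. F (r k) x) \<longlonglongrightarrow> f x"
    using conv by eventually_elim (simp add: f_def convergent_LIMSEQ_iff)
  have near: "sq_int M (\<lambda>x. F n x - f x) \<and> sqnorm M (\<lambda>x. F n x - f x) \<le> (1/4)^j" if "n \<ge> r j" for n j
  proof (intro conjI)
    have *: "AE x in M. (\<lambda>k. F n x - F (r k) x) \<longlonglongrightarrow> F n x - f x"
      using lim by eventually_elim (intro tendsto_intros)
    have **: "\<forall>\<^sub>F k in sequentially. sqnorm M (\<lambda>x. F n x - F (r k) x) \<le> (1/4)^j"
      using eventually_ge_at_top[of j]
      by eventually_elim (use r[of j n] that smono in \<open>auto simp: strict_mono_less_eq intro!: less_imp_le\<close>)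
    show "sq_int M (\<lambda>x. F n x - f x)" "sqnorm M (\<lambda>x. F n x - f x) \<le> (1/4)^j"
      using sq_Fatou[OF _ _ * **] sq_int_diff[OF F F] by auto
  qed
  have "sq_int M f"
    using sq_int_diff[OF F[of "r 0"], of "\<lambda>x. F (r 0) x - f x"] near[of 0 "r 0"] by simp
  moreover have "L2_tendsto M F f"
  proof (rule LIMSEQ_I)
    fix e :: real assume "0 < e"
    then obtain j where j: "(1/4)^j < e" using real_arch_pow_inv[of e "1/4"] by auto
    show "\<exists>no. \<forall>n\<ge>no. norm (sqnorm M (\<lambda>x. F n x - f x) - 0) < e"
      using near j by (intro exI[of _ "r j"]) (auto simp: sqnorm_nonneg intro: le_less_trans)
  qed
  ultimately show ?thesis by auto
qed

subsection \<open>Smooth bump functions\<close>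

text \<open>With y = 1/x, differentiating P(y) exp(-y) in x gives y^2 (P(y) - P'(y)) exp(-y);
  \<open>[:0, 0, 1:]\<close> is y^2.\<close>

primrec flat_poly :: "nat \<Rightarrow> real poly" where
  "flat_poly 0 = 1"
| "flat_poly (Suc n) = [:0, 0, 1:] * (flat_poly n - pderiv (flat_poly n))"

text \<open>The \<open>n\<close>-th derivative of the function that is \<open>exp (-1/x)\<close> for \<open>x > 0\<close> and \<open>0\<close> elsewhere.\<close>

definition flat :: "nat \<Rightarrow> real \<Rightarrow> real" where
  "flat n x = (if x > 0 then poly (flat_poly n) (1 / x) * exp (- (1 / x)) else 0)"

lemma poly_div_exp_tendsto_0:
  fixes q :: "real poly"
  shows "((\<lambda>y. poly q y * exp (- y)) \<longlongrightarrow> 0) at_top"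
proof -
  have "((\<lambda>y. \<Sum>i\<le>degree q. coeff q i * (y ^ i / exp y)) \<longlongrightarrow> (\<Sum>i\<le>degree q. coeff q i * 0)) at_top"
    by (intro tendsto_intros tendsto_power_div_exp_0)
  then show ?thesis
    by (simp add: poly_altdef exp_minus sum_distrib_right divide_inverse mult.assoc)
qed

lemma flat_has_derivative: "(flat n has_real_derivative flat (Suc n) x) (at x)"
proof -
  consider "x > 0" | "x < 0" | "x = 0" by linarith
  then show ?thesis
  proof cases
    case 1
    have "((\<lambda>x. poly (flat_poly n) (1 / x) * exp (- (1 / x))) has_real_derivative flat (Suc n) x) (at x)"
      using 1 by (auto simp: flat_def power2_eq_square field_simps intro!: derivative_eq_intros DERIV_chain2[OF poly_DERIV])
    then show ?thesis
      by (rule has_field_derivative_transform_within_open[where S = "{0<..}"]) (use 1 in \<open>auto simp: flat_def\<close>)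
  next
    case 2
    have "((\<lambda>x. 0) has_real_derivative flat (Suc n) x) (at x)"
      using 2 by (auto simp: flat_def)
    then show ?thesis
      by (rule has_field_derivative_transform_within_open[where S = "{..<0}"]) (use 2 in \<open>auto simp: flat_def\<close>)
  next
    case 3
    \<comment> \<open>With z = inverse y the right difference quotient at 0 is z P(z) exp(-z);
      \<open>[:0, 1:]\<close> supplies the factor z.\<close>
    have "((\<lambda>y. poly (flat_poly n * [:0, 1:]) (inverse y) * exp (- inverse y)) \<longlongrightarrow> 0) (at_right 0)"
      by (rule filterlim_compose[OF poly_div_exp_tendsto_0 filterlim_inverse_at_top_right])
    then have "((\<lambda>y. (flat n y - flat n 0) / (y - 0)) \<longlongrightarrow> 0) (at_right 0)"
      by (rule Lim_transform_eventually)
         (auto simp: eventually_at_right_field flat_def field_simps intro!: exI[of _ 1])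
    moreover have "((\<lambda>y. (flat n y - flat n 0) / (y - 0)) \<longlongrightarrow> 0) (at_left 0)"
      by (rule Lim_transform_eventually[OF tendsto_const])
         (auto simp: eventually_at_left_field flat_def intro!: exI[of _ "-1"])
    ultimately have "((\<lambda>y. (flat n y - flat n 0) / (y - 0)) \<longlongrightarrow> 0) (at 0)"
      by (simp add: filterlim_split_at)
    then show ?thesis using 3 by (simp add: has_field_derivative_iff flat_def)
  qed
qed

definition smooth1 :: "(real \<Rightarrow> real) \<Rightarrow> bool" where
  "smooth1 f \<longleftrightarrow> (\<forall>n x. ((deriv ^^ n) f has_real_derivative (deriv ^^ Suc n) f x) (at x))"

text \<open>A family closed under differentiation contains all iterated derivatives of its members;
  this replaces a formula for the n-th derivative.\<close>

lemma smooth1_coinduct: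
  assumes "f \<in> S" and S: "\<And>g. g \<in> S \<Longrightarrow> \<exists>g'\<in>S. \<forall>x. (g has_real_derivative g' x) (at x)"
  shows "smooth1 f"
proof -
  have *: "deriv g \<in> S \<and> (\<forall>x. (g has_real_derivative deriv g x) (at x))" if "g \<in> S" for g
  proof -
    obtain g' where g': "g' \<in> S" "\<forall>x. (g has_real_derivative g' x) (at x)" using S \<open>g \<in> S\<close> by blast
    then have "deriv g = g'" by (auto intro: DERIV_imp_deriv)
    with g' show ?thesis by simp
  qed
  have "(deriv ^^ n) f \<in> S" for n by (induction n) (use assms(1) * in auto)
  with * show ?thesis by (simp add: smooth1_def)
qed

lemma smooth1_flat: "smooth1 (\<lambda>x. flat n (c * x + d))"
proof (rule smooth1_coinduct[where S = "range (\<lambda>(k, n) x. c ^ k * flat n (c * x + d))"])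
  show "(\<lambda>x. flat n (c * x + d)) \<in> range (\<lambda>(k, n) x. c ^ k * flat n (c * x + d))"
    by (rule range_eqI[of _ _ "(0, n)"]) simp
  fix g assume "g \<in> range (\<lambda>(k, n) x. c ^ k * flat n (c * x + d))"
  then obtain k m where g: "g = (\<lambda>x. c ^ k * flat m (c * x + d))" by auto
  have "(g has_real_derivative c ^ Suc k * flat (Suc m) (c * x + d)) (at x)" for x
    unfolding g by (auto intro!: derivative_eq_intros DERIV_chain2[OF flat_has_derivative])
  then show "\<exists>g'\<in>range (\<lambda>(k, n) x. c ^ k * flat n (c * x + d)). \<forall>x. (g has_real_derivative g' x) (at x)"
    by (intro bexI[of _ "\<lambda>x. c ^ Suc k * flat (Suc m) (c * x + d)"]) (auto intro: range_eqI[of _ _ "(Suc k, Suc m)"])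
qed

text \<open>The Leibniz rule turns a product of derivatives into a sum of two such products, so
  finite sums of them form a family closed under differentiation, and binomial coefficients never
  appear.\<close>

inductive_set prod_span :: "(real \<Rightarrow> real) \<Rightarrow> (real \<Rightarrow> real) \<Rightarrow> (real \<Rightarrow> real) set" for f g where
  prod: "(\<lambda>x. (deriv ^^ i) f x * (deriv ^^ j) g x) \<in> prod_span f g"
| add: "u \<in> prod_span f g \<Longrightarrow> v \<in> prod_span f g \<Longrightarrow> (\<lambda>x. u x + v x) \<in> prod_span f g"

lemma smooth1_mult:
  assumes "smooth1 f" "smooth1 g"
  shows "smooth1 (\<lambda>x. f x * g x)"
proof (rule smooth1_coinduct[where S = "prod_span f g"])
  show "(\<lambda>x. f x * g x) \<in> prod_span f g" using prod_span.prod[of 0 f 0 g] by simp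
  fix w assume "w \<in> prod_span f g"
  then show "\<exists>w'\<in>prod_span f g. \<forall>x. (w has_real_derivative w' x) (at x)"
  proof induction
    case (prod i j)
    have "((\<lambda>x. (deriv ^^ i) f x * (deriv ^^ j) g x) has_real_derivative
        ((deriv ^^ Suc i) f x * (deriv ^^ j) g x + (deriv ^^ i) f x * (deriv ^^ Suc j) g x)) (at x)" for x
      using DERIV_mult[of "(deriv ^^ i) f" "(deriv ^^ Suc i) f x" x UNIV "(deriv ^^ j) g" "(deriv ^^ Suc j) g x"] assms
      by (simp add: smooth1_def algebra_simps)
    moreover have "(\<lambda>x. (deriv ^^ Suc i) f x * (deriv ^^ j) g x + (deriv ^^ i) f x * (deriv ^^ Suc j) g x) \<in> prod_span f g"
      by (intro prod_span.add prod_span.prod)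
    ultimately show ?case
      by (intro bexI[of _ "\<lambda>x. (deriv ^^ Suc i) f x * (deriv ^^ j) g x + (deriv ^^ i) f x * (deriv ^^ Suc j) g x"] allI)
  next
    case (add u v)
    then obtain u' v' where "u' \<in> prod_span f g" "v' \<in> prod_span f g"
      "\<forall>x. (u has_real_derivative u' x) (at x)" "\<forall>x. (v has_real_derivative v' x) (at x)" by blast
    then show ?case
      by (intro bexI[of _ "\<lambda>x. u' x + v' x"]) (auto intro: DERIV_add prod_span.add)
  qed
qed

abbreviation "prod_deriv f k \<equiv> (\<lambda>x. \<Prod>b\<in>Basis. (deriv ^^ k b) (f b) (x \<bullet> b))"

lemma prod_deriv_has_derivative:
  fixes f :: "'a::euclidean_space \<Rightarrow> real \<Rightarrow> real"
  assumes f: "\<And>b. b \<in> Basis \<Longrightarrow> smooth1 (f b)"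
  shows "(prod_deriv f k has_derivative
    (\<lambda>y. \<Sum>i\<in>Basis. (deriv ^^ Suc (k i)) (f i) (x \<bullet> i) * (y \<bullet> i) * (\<Prod>j\<in>Basis - {i}. (deriv ^^ k j) (f j) (x \<bullet> j)))) (at x)"
proof (rule has_derivative_prod)
  fix i :: 'a assume i: "i \<in> Basis"
  have "((deriv ^^ k i) (f i) has_derivative (\<lambda>y. (deriv ^^ Suc (k i)) (f i) (x \<bullet> i) * y)) (at (x \<bullet> i))"
    using f[OF i] by (simp add: smooth1_def has_field_derivative_def)
  from has_derivative_compose[OF has_derivative_inner_left[OF has_derivative_ident] this]
  show "((\<lambda>x. (deriv ^^ k i) (f i) (x \<bullet> i)) has_derivative (\<lambda>y. (deriv ^^ Suc (k i)) (f i) (x \<bullet> i) * (y \<bullet> i))) (at x)" .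
qed

text \<open>Differentiating along a basis vector raises one entry of the multi-index
  \<open>k\<close>, since the other factors are constant in that direction.\<close>

lemma iter_partial_prod:
  fixes f :: "'a::euclidean_space \<Rightarrow> real \<Rightarrow> real"
  assumes f: "\<And>b. b \<in> Basis \<Longrightarrow> smooth1 (f b)" and bs: "set bs \<subseteq> Basis"
  shows "\<exists>k. iter_partial bs (\<lambda>x. \<Prod>b\<in>Basis. f b (x \<bullet> b)) = prod_deriv f k"
  using bs
proof (induction bs)
  case Nil
  show ?case by (rule exI[of _ "\<lambda>_. 0"]) simp
next
  case (Cons c cs)
  then obtain k where k: "iter_partial cs (\<lambda>x. \<Prod>b\<in>Basis. f b (x \<bullet> b)) = prod_deriv f k" by auto
  have c: "c \<in> Basis" using Cons.prems by simp
  have "frechet_derivative (prod_deriv f k) (at x) c = prod_deriv f (k(c := Suc (k c))) x" for x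
  proof -
    have "frechet_derivative (prod_deriv f k) (at x) c
      = (\<Sum>i\<in>Basis. (deriv ^^ Suc (k i)) (f i) (x \<bullet> i) * (c \<bullet> i) * (\<Prod>j\<in>Basis - {i}. (deriv ^^ k j) (f j) (x \<bullet> j)))"
      using fun_cong[OF frechet_derivative_at[OF prod_deriv_has_derivative[of f, OF f]], symmetric] by simp
    also have "\<dots> = (\<Sum>i\<in>Basis. if i = c then (deriv ^^ Suc (k c)) (f c) (x \<bullet> c) * (\<Prod>j\<in>Basis - {c}. (deriv ^^ k j) (f j) (x \<bullet> j)) else 0)"
      using c by (intro sum.cong) (auto simp: inner_Basis)
    also have "\<dots> = (deriv ^^ Suc (k c)) (f c) (x \<bullet> c) * (\<Prod>j\<in>Basis - {c}. (deriv ^^ k j) (f j) (x \<bullet> j))"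
      using c by simp
    also have "\<dots> = prod_deriv f (k(c := Suc (k c))) x"
      using c by (subst (2) prod.remove[of _ c]) (auto intro!: prod.cong)
    finally show ?thesis .
  qed
  then show ?case by (intro exI[of _ "k(c := Suc (k c))"]) (simp only: iter_partial.simps k)
qed

lemma test_fun_prod:
  fixes f :: "'a::euclidean_space \<Rightarrow> real \<Rightarrow> real"
  assumes f: "\<And>b. b \<in> Basis \<Longrightarrow> smooth1 (f b)" and bd: "bounded {x. (\<Prod>b\<in>Basis. f b (x \<bullet> b)) \<noteq> 0}"
  shows "test_fun (\<lambda>x. \<Prod>b\<in>Basis. f b (x \<bullet> b))"
  unfolding test_fun_def
proof (intro conjI allI impI)
  fix bs :: "'a list" assume "set bs \<subseteq> Basis"
  from iter_partial_prod[of f, OF f this]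
  obtain k where k: "iter_partial bs (\<lambda>x. \<Prod>b\<in>Basis. f b (x \<bullet> b)) = prod_deriv f k" by blast
  show "iter_partial bs (\<lambda>x. \<Prod>b\<in>Basis. f b (x \<bullet> b)) differentiable_on UNIV"
    unfolding k differentiable_on_def using differentiableI[OF prod_deriv_has_derivative[of f, OF f]] by blast
  then show "continuous_on UNIV (iter_partial bs (\<lambda>x. \<Prod>b\<in>Basis. f b (x \<bullet> b)))"
    by (rule differentiable_imp_continuous_on)
qed (rule bd)

text \<open>The factor \<open>Suc n\<close> steepens the edges while the support stays in the open
  box. As \<open>flat 0\<close> takes values in [0, 1] and tends to 1 at infinity, the bumps stay
  below the indicator of the box and converge to it pointwise.\<close>

definition box_bump :: "nat \<Rightarrow> 'a::euclidean_space \<Rightarrow> 'a \<Rightarrow> 'a \<Rightarrow> real" where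
  "box_bump n a b x = (\<Prod>i\<in>Basis. flat 0 (real (Suc n) * (x \<bullet> i - a \<bullet> i)) * flat 0 (real (Suc n) * (b \<bullet> i - x \<bullet> i)))"

lemma flat_0: "flat 0 x = (if x > 0 then exp (- (1 / x)) else 0)"
  by (simp add: flat_def)

lemma flat_0_bounds: "0 \<le> flat 0 x" "flat 0 x \<le> 1"
  by (auto simp: flat_0)

lemma box_bump_bounds: "0 \<le> box_bump n a b x" "box_bump n a b x \<le> 1"
  unfolding box_bump_def by (auto intro!: prod_nonneg prod_le_1 mult_nonneg_nonneg mult_le_one flat_0_bounds)

lemma box_bump_support: "x \<notin> box a b \<Longrightarrow> box_bump n a b x = 0"
proof -
  assume "x \<notin> box a b"
  then obtain i where i: "i \<in> Basis" "x \<bullet> i \<le> a \<bullet> i \<or> b \<bullet> i \<le> x \<bullet> i" by (auto simp: mem_box not_less)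
  have z: "flat 0 (real (Suc n) * t) = 0" if "t \<le> 0" for t
    using that by (simp add: flat_0 zero_less_mult_iff del: of_nat_Suc)
  have "flat 0 (real (Suc n) * (x \<bullet> i - a \<bullet> i)) * flat 0 (real (Suc n) * (b \<bullet> i - x \<bullet> i)) = 0"
    using i(2) z[of "x \<bullet> i - a \<bullet> i"] z[of "b \<bullet> i - x \<bullet> i"] by auto
  then show ?thesis unfolding box_bump_def using i(1) by (intro prod_zero) auto
qed

lemma test_fun_box_bump: "test_fun (box_bump n a b)"
proof -
  have "smooth1 (\<lambda>t. flat 0 (real (Suc n) * (t - a \<bullet> i)) * flat 0 (real (Suc n) * (b \<bullet> i - t)))" for i
    using smooth1_mult[OF smooth1_flat[of 0 "real (Suc n)" "- real (Suc n) * (a \<bullet> i)"]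
        smooth1_flat[of 0 "- real (Suc n)" "real (Suc n) * (b \<bullet> i)"]]
    by (simp add: algebra_simps)
  moreover have "bounded {x. (\<Prod>i\<in>Basis. flat 0 (real (Suc n) * (x \<bullet> i - a \<bullet> i)) * flat 0 (real (Suc n) * (b \<bullet> i - x \<bullet> i))) \<noteq> 0}"
    by (rule bounded_subset[OF bounded_box[of a b]]) (use box_bump_support[of _ a b n] in \<open>auto simp: box_bump_def\<close>)
  ultimately have "test_fun (\<lambda>x. \<Prod>i\<in>Basis. (\<lambda>i t. flat 0 (real (Suc n) * (t - a \<bullet> i)) * flat 0 (real (Suc n) * (b \<bullet> i - t))) i (x \<bullet> i))"
    by (intro test_fun_prod) auto
  then show ?thesis by (simp only: box_bump_def[abs_def])
qed

lemma box_bump_tendsto: "(\<lambda>n. box_bump n a b x) \<longlonglongrightarrow> indicator (box a b) x"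
proof (cases "x \<in> box a b")
  case True
  have lim: "(\<lambda>n. flat 0 (real (Suc n) * t)) \<longlonglongrightarrow> 1" if "t > 0" for t
  proof -
    have "(\<lambda>n. exp (- ((1 / t) * inverse (real (Suc n))))) \<longlonglongrightarrow> exp (- ((1 / t) * 0))"
      by (intro tendsto_intros LIMSEQ_inverse_real_of_nat)
    moreover have "flat 0 (real (Suc n) * t) = exp (- ((1 / t) * inverse (real (Suc n))))" for n
      using that by (simp add: flat_0 divide_inverse)
    ultimately show ?thesis by simp
  qed
  have "(\<lambda>n. box_bump n a b x) \<longlonglongrightarrow> (\<Prod>i\<in>(Basis::'a set). 1 * 1)"
    unfolding box_bump_def using True
    by (intro tendsto_prod tendsto_mult lim) (auto simp: mem_box)
  with True show ?thesis by simp
next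
  case False
  then show ?thesis by (simp add: box_bump_support)
qed

subsection \<open>Density of test functions\<close>

lemma sq_dominated:
  assumes F: "\<And>n. F n \<in> borel_measurable M" and f: "f \<in> borel_measurable M"
    and lim: "AE x in M. (\<lambda>n. F n x) \<longlonglongrightarrow> f x"
    and w: "sq_int M w" and le: "\<And>n. AE x in M. norm (F n x) \<le> norm (w x)"
  shows "\<And>n. sq_int M (F n)" "sq_int M f" "L2_tendsto M F f"
proof -
  show *: "sq_int M (F n)" for n
    by (rule sqnorm_mono_AE[OF w F le])
  have "AE x in M. \<forall>n. norm (F n x) \<le> norm (w x)" using le by (simp add: AE_all_countable)
  with lim have lf: "AE x in M. norm (f x) \<le> norm (w x)"
  proof eventually_elim
    case (elim x)
    then have "(\<lambda>n. norm (F n x)) \<longlonglongrightarrow> norm (f x)" "\<forall>n. norm (F n x) \<le> norm (w x)"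
      by (auto intro: tendsto_norm)
    then show ?case by (intro LIMSEQ_le_const2) auto
  qed
  then show **: "sq_int M f" by (rule sqnorm_mono_AE[OF w f])
  have "(\<lambda>n. \<integral>x. (norm (F n x - f x))\<^sup>2 \<partial>M) \<longlonglongrightarrow> (\<integral>x. 0 \<partial>M)"
  proof (rule integral_dominated_convergence)
    show "(\<lambda>x. (norm (F n x - f x))\<^sup>2) \<in> borel_measurable M" for n
      by (rule borel_measurable_integrable[OF sq_int_norm[OF sq_int_diff[OF * **]]])
    \<comment> \<open>The dominating function is (2 |w|)^2, because F n and f are both bounded by
      |w|.\<close>
    show "integrable M (\<lambda>x. 4 * (norm (w x))\<^sup>2)" using sq_int_norm[OF w] by simp
    from lim show "AE x in M. (\<lambda>n. (norm (F n x - f x))\<^sup>2) \<longlonglongrightarrow> 0"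
    proof eventually_elim
      case (elim x)
      then have "(\<lambda>n. (norm (F n x - f x))\<^sup>2) \<longlonglongrightarrow> (norm (f x - f x))\<^sup>2" by (intro tendsto_intros)
      then show ?case by simp
    qed
    fix n from le[of n] lf show "AE x in M. norm ((norm (F n x - f x))\<^sup>2) \<le> 4 * (norm (w x))\<^sup>2"
    proof eventually_elim
      case (elim x)
      then have "norm (F n x - f x) \<le> 2 * norm (w x)" using norm_triangle_ineq4[of "F n x" "f x"] by linarith
      then have "(norm (F n x - f x))\<^sup>2 \<le> (2 * norm (w x))\<^sup>2" by (intro power_mono) auto
      then show ?case by (simp add: power_mult_distrib)
    qed
  qed simp
  then show "L2_tendsto M F f" by (simp add: sqnorm_def)
qed

section \<open>Differential calculus and bounds for test functions\<close>

abbreviation "pd b \<phi> \<equiv> iter_partial [b] \<phi>"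

lemma test_fun_differentiable: "test_fun \<phi> \<Longrightarrow> set bs \<subseteq> Basis \<Longrightarrow> iter_partial bs \<phi> differentiable (at x)"
  unfolding test_fun_def differentiable_on_def by blast

lemma test_fun_continuous: "test_fun \<phi> \<Longrightarrow> set bs \<subseteq> Basis \<Longrightarrow> continuous_on UNIV (iter_partial bs \<phi>)"
  unfolding test_fun_def by auto

lemma test_fun_has_derivative:
  fixes \<phi> :: "'a::euclidean_space \<Rightarrow> real"
  assumes "test_fun \<phi>"
  shows "(\<phi> has_derivative (\<lambda>h. \<Sum>b\<in>Basis. (h \<bullet> b) * pd b \<phi> x)) (at x)"
proof -
  have d: "(\<phi> has_derivative frechet_derivative \<phi> (at x)) (at x)"
    using test_fun_differentiable[OF assms, of "[]" x] by (simp add: frechet_derivative_works)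
  then have l: "linear (frechet_derivative \<phi> (at x))" by (rule has_derivative_linear)
  have eq: "frechet_derivative \<phi> (at x) h = (\<Sum>b\<in>Basis. (h \<bullet> b) * pd b \<phi> x)" for h
    using Linear_Algebra.linear_componentwise[OF l, of h 1] by simp
  from d show ?thesis by (rule has_derivative_eq_rhs) (rule ext, rule eq)
qed

abbreviation "dir_deriv h \<phi> x \<equiv> (\<Sum>b\<in>Basis. (h \<bullet> b) * pd b \<phi> x)"

lemma test_fun_lincomb:
  assumes \<phi>: "test_fun \<phi>" and \<psi>: "test_fun \<psi>"
  shows "test_fun (\<lambda>x. s * \<phi> x + t * \<psi> x)"
proof -
  have *: "iter_partial bs (\<lambda>x. s * \<phi> x + t * \<psi> x) = (\<lambda>x. s * iter_partial bs \<phi> x + t * iter_partial bs \<psi> x)"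
    if "set bs \<subseteq> Basis" for bs
    using that
  proof (induction bs)
    case (Cons b bs)
    have "((\<lambda>x. s * iter_partial bs \<phi> x + t * iter_partial bs \<psi> x) has_derivative
        (\<lambda>h. s * frechet_derivative (iter_partial bs \<phi>) (at x) h + t * frechet_derivative (iter_partial bs \<psi>) (at x) h)) (at x)" for x
      using Cons.prems test_fun_differentiable[OF \<phi>, of bs x] test_fun_differentiable[OF \<psi>, of bs x]
      by (intro has_derivative_add has_derivative_mult_right) (auto simp: frechet_derivative_works)
    note * = fun_cong[OF frechet_derivative_at[OF this, symmetric]]
    have "iter_partial bs (\<lambda>x. s * \<phi> x + t * \<psi> x) = (\<lambda>x. s * iter_partial bs \<phi> x + t * iter_partial bs \<psi> x)"
      using Cons by simp
    then show ?case by (simp add: *)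
  qed simp
  have "bounded {x. s * \<phi> x + t * \<psi> x \<noteq> 0}"
    by (rule bounded_subset[of "{x. \<phi> x \<noteq> 0} \<union> {x. \<psi> x \<noteq> 0}"]) (use \<phi> \<psi> in \<open>auto simp: test_fun_def\<close>)
  with \<phi> \<psi> show ?thesis
    unfolding test_fun_def by (auto simp: * intro!: continuous_intros differentiable_on_add differentiable_on_mult)
qed

lemma iter_partial_translate:
  assumes \<phi>: "test_fun \<phi>" and "set bs \<subseteq> Basis"
  shows "iter_partial bs (\<lambda>x. \<phi> (x - c)) = (\<lambda>x. iter_partial bs \<phi> (x - c))"
  using assms(2)
proof (induction bs)
  case (Cons b bs)
  have "((\<lambda>x. iter_partial bs \<phi> (x - c)) has_derivative frechet_derivative (iter_partial bs \<phi>) (at (x - c))) (at x)" for x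
  proof -
    have 1: "((\<lambda>x. x - c) has_derivative (\<lambda>h. h)) (at x)" by (auto intro!: derivative_eq_intros)
    have 2: "(iter_partial bs \<phi> has_derivative frechet_derivative (iter_partial bs \<phi>) (at (x - c))) (at (x - c))"
      using Cons.prems test_fun_differentiable[OF \<phi>, of bs "x - c"] by (simp add: frechet_derivative_works)
    from has_derivative_compose[OF 1 2] show ?thesis .
  qed
  note * = fun_cong[OF frechet_derivative_at[OF this, symmetric]]
  have "iter_partial bs (\<lambda>x. \<phi> (x - c)) = (\<lambda>x. iter_partial bs \<phi> (x - c))" using Cons by simp
  then show ?case by (simp add: *)
qed simp

lemma test_fun_translate:
  assumes \<phi>: "test_fun \<phi>" shows "test_fun (\<lambda>x. \<phi> (x - c))"
proof -
  have "(\<lambda>x. iter_partial bs \<phi> (x - c)) differentiable_on UNIV" if "set bs \<subseteq> Basis" for bs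
    unfolding differentiable_on_def
  proof
    fix x
    have "(\<lambda>x. x - c) differentiable (at x)" by simp
    from differentiable_chain_at[OF this test_fun_differentiable[OF \<phi> that]]
    show "(\<lambda>x. iter_partial bs \<phi> (x - c)) differentiable (at x)" by (simp add: o_def)
  qed
  moreover have "bounded {x. \<phi> (x - c) \<noteq> 0}"
  proof -
    have "{x. \<phi> (x - c) \<noteq> 0} \<subseteq> (+) c ` {x. \<phi> x \<noteq> 0}"
    proof
      fix x assume "x \<in> {x. \<phi> (x - c) \<noteq> 0}"
      then show "x \<in> (+) c ` {x. \<phi> x \<noteq> 0}" by (intro image_eqI[of _ _ "x - c"]) auto
    qed
    moreover have "bounded ((+) c ` {x. \<phi> x \<noteq> 0})" using \<phi> by (intro bounded_translation) (simp add: test_fun_def)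
    ultimately show ?thesis by (rule bounded_subset[rotated])
  qed
  ultimately show ?thesis
    unfolding test_fun_def by (simp add: iter_partial_translate[OF \<phi>] differentiable_imp_continuous_on)
qed

lemma test_fun_bounds:
  fixes \<phi> :: "'a::euclidean_space \<Rightarrow> real"
  assumes \<phi>: "test_fun \<phi>"
  obtains R C where "R > 0" "C > 0" "\<And>x. \<bar>\<phi> x\<bar> \<le> C" "\<And>x b. b \<in> Basis \<Longrightarrow> \<bar>pd b \<phi> x\<bar> \<le> C"
    "\<And>x. R < norm x \<Longrightarrow> \<phi> x = 0" "\<And>x b. b \<in> Basis \<Longrightarrow> R < norm x \<Longrightarrow> pd b \<phi> x = 0"
proof -
  obtain R where R: "R > 0" "\<And>x. \<phi> x \<noteq> 0 \<Longrightarrow> norm x \<le> R"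
    using \<phi> by (auto simp: test_fun_def bounded_pos)
  then have R0: "\<phi> x = 0" if "R < norm x" for x using that by (meson not_le)
  have dR: "pd b \<phi> x = 0" if "b \<in> Basis" "R < norm x" for b x
  proof -
    \<comment> \<open>Off the closed ball \<open>\<phi>\<close> agrees with 0 on an open set, hence
      has the same derivative there.\<close>
    have "frechet_derivative (\<lambda>x. 0) (at x) = frechet_derivative \<phi> (at x)"
      by (rule frechet_derivative_transform_within_open[where X = "- cball 0 R"])
         (use that R0 in \<open>auto simp: dist_norm intro: open_Compl\<close>)
    from fun_cong[OF this, of b] show ?thesis by simp
  qed
  have "bounded (iter_partial bs \<phi> ` cball 0 R)" if "set bs \<subseteq> Basis" for bs
    by (intro compact_imp_bounded compact_continuous_image continuous_on_subset[OF test_fun_continuous[OF \<phi> that]]) auto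
  then have "\<exists>C>0. \<forall>x\<in>cball 0 R. \<bar>iter_partial bs \<phi> x\<bar> \<le> C" if "set bs \<subseteq> Basis" for bs
    using that unfolding bounded_pos by fastforce
  then have ex: "\<forall>bs. set bs \<subseteq> Basis \<longrightarrow> (\<exists>C>0. \<forall>x\<in>cball 0 R. \<bar>iter_partial bs \<phi> x\<bar> \<le> C)" by blast
  then obtain D where D: "\<And>bs x. set bs \<subseteq> Basis \<Longrightarrow> D bs > 0 \<and> (x \<in> cball 0 R \<longrightarrow> \<bar>iter_partial bs \<phi> x\<bar> \<le> D bs)"
    by metis
  define C where "C = D [] + (\<Sum>b\<in>Basis. D [b])"
  have D0: "D [] > 0" "\<And>b. b \<in> Basis \<Longrightarrow> D [b] > 0" using D by auto
  have "0 \<le> (\<Sum>b\<in>Basis. D [b])" using D0 by (intro sum_nonneg) (auto intro: less_imp_le)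
  then have C: "C > 0" "D [] \<le> C" using D0 by (auto simp: C_def)
  have Cb: "D [b] \<le> C" if "b \<in> Basis" for b
    using member_le_sum[OF that, of "\<lambda>b. D [b]"] D0 less_imp_le[OF D0(2)] by (auto simp: C_def)
  show ?thesis
  proof (rule that[OF R(1) C(1)])
    show "\<bar>\<phi> x\<bar> \<le> C" for x
      using D[of "[]" x] C R0[of x] by (cases "norm x \<le> R") auto
    show "\<bar>pd b \<phi> x\<bar> \<le> C" if "b \<in> Basis" for x b
      using D[of "[b]" x] Cb[OF that] C dR[OF that, of x] that by (cases "norm x \<le> R") auto
  qed (use R0 dR in auto)
qed

lemma sq_int_bounded_support:
  fixes f :: "'a::euclidean_space \<Rightarrow> 'b::euclidean_space"
  assumes "lmeas f" "\<And>x. norm (f x) \<le> C" "\<And>x. R < norm x \<Longrightarrow> f x = 0"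
  shows "L2 f"
proof -
  have "integrable lebesgue (\<lambda>x. (norm (f x))\<^sup>2)"
  proof (rule integrableI_bounded_set[where A = "cball 0 R" and B = "C\<^sup>2"])
    show "emeasure lebesgue (cball (0::'a) R) < \<infinity>" using emeasure_bounded_finite[OF bounded_cball[of "0::'a" R]] by simp
    show "AE x in lebesgue. x \<in> cball 0 R \<longrightarrow> norm ((norm (f x))\<^sup>2) \<le> C\<^sup>2"
      using assms(2) by (intro AE_I2) (auto intro: power_mono)
    show "AE x in lebesgue. x \<notin> cball 0 R \<longrightarrow> (norm (f x))\<^sup>2 = 0"
      using assms(3) by (intro AE_I2) auto
  qed (use assms(1) in auto)
  with assms(1) show ?thesis by (simp add: sq_int_def)
qed

lemma borel_measurable_lebesgueI: "f \<in> borel_measurable borel \<Longrightarrow> f \<in> borel_measurable lebesgue"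
  by (rule measurable_completion) simp

lemma test_fun_borel: "test_fun \<phi> \<Longrightarrow> set bs \<subseteq> Basis \<Longrightarrow> iter_partial bs \<phi> \<in> borel_measurable borel"
  by (intro borel_measurable_continuous_onI test_fun_continuous)

lemma test_fun_borel_0: "test_fun \<phi> \<Longrightarrow> \<phi> \<in> borel_measurable borel"
  using test_fun_borel[of \<phi> "[]"] by simp

lemma test_fun_sq_int:
  assumes "test_fun \<phi>" shows "L2 \<phi>"
proof (rule test_fun_bounds[OF assms])
  fix R C assume *: "\<And>x. \<bar>\<phi> x\<bar> \<le> C" "\<And>x. R < norm x \<Longrightarrow> \<phi> x = 0"
  show ?thesis
    by (rule sq_int_bounded_support[of _ C R])
       (use * assms test_fun_borel_0 in \<open>auto intro: borel_measurable_lebesgueI\<close>)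
qed

lemma test_fun_partial_sq_int:
  assumes "test_fun \<phi>" "b \<in> Basis" shows "L2 (pd b \<phi>)"
proof (rule test_fun_bounds[OF assms(1)])
  fix R C assume *: "\<And>x b. b \<in> Basis \<Longrightarrow> \<bar>pd b \<phi> x\<bar> \<le> C" "\<And>x b. b \<in> Basis \<Longrightarrow> R < norm x \<Longrightarrow> pd b \<phi> x = 0"
  show ?thesis
    by (rule sq_int_bounded_support[of _ C R])
       (use * assms test_fun_borel[of \<phi> "[b]"] in \<open>auto intro: borel_measurable_lebesgueI simp del: iter_partial.simps\<close>)
qed

section \<open>Every L2 function is an L2 limit of test functions\<close>

definition test_closure :: "('a::euclidean_space \<Rightarrow> real) set" where
  "test_closure = {f. L2 f \<and> (\<forall>e>0. \<exists>\<phi>. test_fun \<phi> \<and> nrm2 (\<lambda>x. f x - \<phi> x) < e)}"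

lemma test_closureD: "f \<in> test_closure \<Longrightarrow> L2 f"
  by (simp add: test_closure_def)

lemma test_fun_in_closure: "test_fun \<phi> \<Longrightarrow> \<phi> \<in> test_closure"
  by (auto simp: test_closure_def test_fun_sq_int sqnorm_def intro!: exI[of _ \<phi>])

lemma test_closure_limit:
  assumes f: "L2 f"
    and ex: "\<And>e. 0 < e \<Longrightarrow> \<exists>g\<in>test_closure. nrm2 (\<lambda>x. f x - g x) < e"
  shows "f \<in> test_closure"
  unfolding test_closure_def
proof (intro CollectI conjI allI impI f)
  fix e :: real assume e: "0 < e"
  obtain g where g: "g \<in> test_closure" "nrm2 (\<lambda>x. f x - g x) < e / 4"
    using ex[of "e/4"] e by auto
  then obtain \<phi> where \<phi>: "test_fun \<phi>" "nrm2 (\<lambda>x. g x - \<phi> x) < e / 4"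
    using e unfolding test_closure_def by (auto dest!: spec[of _ "e/4"])
  have "nrm2 (\<lambda>x. (f x - g x) + (g x - \<phi> x))
      \<le> 2 * nrm2 (\<lambda>x. f x - g x) + 2 * nrm2 (\<lambda>x. g x - \<phi> x)"
    using sq_int_diff[OF f test_closureD[OF g(1)]]
      sq_int_diff[OF test_closureD[OF g(1)] test_fun_sq_int[OF \<phi>(1)]] by (rule sqnorm_add_le)
  also have "\<dots> < e" using g \<phi> by simp
  finally have "nrm2 (\<lambda>x. f x - \<phi> x) < e" by simp
  with \<phi> show "\<exists>\<phi>. test_fun \<phi> \<and> nrm2 (\<lambda>x. f x - \<phi> x) < e" by blast
qed

lemma test_closure_tendsto:
  assumes F: "\<And>n. F n \<in> test_closure" and f: "L2 f"
    and lim: "L2_tendsto lebesgue F f"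
  shows "f \<in> test_closure"
proof (rule test_closure_limit[OF f])
  fix e :: real assume "0 < e"
  then obtain n where "nrm2 (\<lambda>x. F n x - f x) < e"
    using order_tendstoD(2)[OF lim] unfolding eventually_sequentially by blast
  then show "\<exists>g\<in>test_closure. nrm2 (\<lambda>x. f x - g x) < e"
    using F[of n] sqnorm_minus_commute[of lebesgue f "F n"] by (intro bexI[of _ "F n"]) simp_all
qed

lemma test_closure_lincomb:
  assumes f: "f \<in> test_closure" and g: "g \<in> test_closure"
  shows "(\<lambda>x. s * f x + t * g x) \<in> test_closure"
  unfolding test_closure_def
proof (intro CollectI conjI allI impI)
  have fg: "L2 f" "L2 g" using f g by (auto dest: test_closureD)
  then show "L2 (\<lambda>x. s * f x + t * g x)" using sq_int_lincomb[of lebesgue f g s t] by simp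
  fix e :: real assume e: "0 < e"
  \<comment> \<open>The summand 1 makes c positive and the final inequality strict.\<close>
  define c where "c = 2 * s\<^sup>2 + 2 * t\<^sup>2 + 1"
  have c: "0 < c" by (simp add: c_def add_nonneg_pos)
  then have ec: "0 < e / c" using e by simp
  obtain \<phi> where \<phi>: "test_fun \<phi>" "nrm2 (\<lambda>x. f x - \<phi> x) < e / c" using f ec by (auto simp: test_closure_def)
  obtain \<psi> where \<psi>: "test_fun \<psi>" "nrm2 (\<lambda>x. g x - \<psi> x) < e / c" using g ec by (auto simp: test_closure_def)
  have "nrm2 (\<lambda>x. s *\<^sub>R (f x - \<phi> x) + t *\<^sub>R (g x - \<psi> x))
      \<le> 2 * nrm2 (\<lambda>x. s *\<^sub>R (f x - \<phi> x)) + 2 * nrm2 (\<lambda>x. t *\<^sub>R (g x - \<psi> x))"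
    using sq_int_diff[OF fg(1) test_fun_sq_int[OF \<phi>(1)]] sq_int_diff[OF fg(2) test_fun_sq_int[OF \<psi>(1)]]
    by (intro sqnorm_add_le sq_int_scaleR)
  also have "\<dots> = 2 * s\<^sup>2 * nrm2 (\<lambda>x. f x - \<phi> x) + 2 * t\<^sup>2 * nrm2 (\<lambda>x. g x - \<psi> x)"
    by (simp only: sqnorm_scaleR mult.assoc)
  also have "\<dots> \<le> 2 * s\<^sup>2 * (e / c) + 2 * t\<^sup>2 * (e / c)"
    using \<phi>(2) \<psi>(2) by (intro add_mono mult_left_mono) auto
  also have "\<dots> = (c - 1) * (e / c)" by (simp only: c_def add_diff_cancel_right' distrib_right)
  also have "\<dots> < e" using e c by (simp add: pos_divide_less_eq mult.commute)
  finally have "nrm2 (\<lambda>x. s *\<^sub>R (f x - \<phi> x) + t *\<^sub>R (g x - \<psi> x)) < e" .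
  moreover have "(\<lambda>x. s *\<^sub>R (f x - \<phi> x) + t *\<^sub>R (g x - \<psi> x)) = (\<lambda>x. (s * f x + t * g x) - (s * \<phi> x + t * \<psi> x))"
    by (simp add: algebra_simps)
  ultimately show "\<exists>\<phi>. test_fun \<phi> \<and> nrm2 (\<lambda>x. (s * f x + t * g x) - \<phi> x) < e"
    using test_fun_lincomb[OF \<phi>(1) \<psi>(1), of s t] by (intro exI[of _ "\<lambda>x. s * \<phi> x + t * \<psi> x"]) simp
qed

lemma test_closure_sum:
  fixes f :: "'i \<Rightarrow> 'a::euclidean_space \<Rightarrow> real"
  assumes "finite I" "\<And>i. i \<in> I \<Longrightarrow> f i \<in> test_closure"
  shows "(\<lambda>x. \<Sum>i\<in>I. f i x) \<in> test_closure"
  using assms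
proof (induction I)
  case empty
  \<comment> \<open>The bump over an empty box is the zero function, which starts the
    induction.\<close>
  have "x \<notin> box 0 (0::'a)" for x by simp
  then have "box_bump 0 (0::'a) 0 = (\<lambda>x. 0)" using box_bump_support by blast
  then show ?case using test_fun_in_closure[OF test_fun_box_bump[of 0 "0::'a" 0]] by simp
next
  case (insert i I)
  then show ?case using test_closure_lincomb[of "f i" "\<lambda>x. \<Sum>i\<in>I. f i x" 1 1] by simp
qed

lemma test_closure_dominated:
  assumes F: "\<And>n. F n \<in> test_closure" and f: "lmeas f"
    and lim: "\<And>x. (\<lambda>n. F n x) \<longlonglongrightarrow> f x"
    and w: "L2 w" and le: "\<And>n x. norm (F n x) \<le> norm (w x)"
  shows "f \<in> test_closure"
proof -
  have m: "lmeas (F n)" for n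
    by (intro sq_int_meas test_closureD F)
  show ?thesis
    by (rule test_closure_tendsto[OF F sq_dominated(2,3)[where F = F, OF m f _ w]]) (use lim le in auto)
qed

lemma sq_int_indicator:
  fixes A :: "'a::euclidean_space set"
  assumes "A \<in> sets lebesgue" "emeasure lebesgue A < \<infinity>"
  shows "L2 (indicator A :: 'a \<Rightarrow> real)"
proof -
  have "(\<lambda>x. (norm (indicator A x :: real))\<^sup>2) = indicator A"
    by (auto simp: indicator_def)
  with assms show ?thesis by (simp add: sq_int_def)
qed

lemma box_indicator_in_closure: "indicator (box a b) \<in> test_closure"
proof (rule test_closure_dominated[OF test_fun_in_closure[OF test_fun_box_bump[of _ a b]] _ box_bump_tendsto])
  show "L2 (indicator (box a b) :: 'a \<Rightarrow> real)"
    using emeasure_bounded_finite[OF bounded_box[of a b]] by (intro sq_int_indicator) auto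
  show "norm (box_bump n a b x) \<le> norm (indicator (box a b) x :: real)" for n x
    using box_bump_bounds[of n a b x] box_bump_support[of x a b n] by (auto simp: indicator_def)
qed (intro borel_measurable_indicator sets_completionI_sets, auto)

text \<open>Dynkin's argument, with the open boxes as intersection-stable generator. The fixed box
  keeps all sets of finite measure: a complement becomes a difference of two L2 indicators, and the
  indicator of the box dominates the partial sums of a disjoint union.\<close>

lemma Int_box_indicator_in_closure:
  fixes a b :: "'a::euclidean_space"
  assumes "A \<in> sets borel"
  shows "indicator (A \<inter> box a b) \<in> test_closure"
proof -
  have "Int_stable (range (\<lambda>(a, b). box a b :: 'a set))"
    by (auto simp: Int_stable_def box_Int_box)
  moreover have "range (\<lambda>(a, b). box a b :: 'a set) \<subseteq> Pow UNIV" by simp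
  moreover have "A \<in> sigma_sets UNIV (range (\<lambda>(a, b). box a b :: 'a set))"
    using assms by (simp add: borel_eq_box)
  ultimately show ?thesis
  proof (induction A rule: sigma_sets_induct_disjoint)
    case (basic A)
    then show ?case by (auto simp: box_Int_box box_indicator_in_closure)
  next
    case empty
    show ?case using box_indicator_in_closure[of 0 "0::'a"] by (simp only: box_idem Int_empty_left)
  next
    case (compl A)
    have "indicator ((UNIV - A) \<inter> box a b) = (\<lambda>x. 1 * indicator (box a b) x + (-1) * indicator (A \<inter> box a b) x :: real)"
      by (auto simp: indicator_def)
    then show ?case using test_closure_lincomb[OF box_indicator_in_closure compl(2)] by metis
  next
    case (union A)
    have dis: "disjoint_family (\<lambda>i. A i \<inter> box a b)" using union(1) by (auto simp: disjoint_family_on_def)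
    have meas: "A i \<in> sets borel" for i using union(2) by (auto simp: borel_eq_box)
    have s: "(\<lambda>i. indicator (A i \<inter> box a b) x :: real) sums indicator (\<Union>i. A i \<inter> box a b) x" for x
      by (rule indicator_sums) (use dis in \<open>auto simp: disjoint_family_on_def\<close>)
    have "indicator (\<Union>i. A i \<inter> box a b) \<in> test_closure"
    proof (rule test_closure_dominated[where F = "\<lambda>n x. \<Sum>i<n. indicator (A i \<inter> box a b) x" and w = "indicator (box a b) :: 'a \<Rightarrow> real"])
      show "(\<lambda>x. \<Sum>i<n. indicator (A i \<inter> box a b) x :: real) \<in> test_closure" for n
        by (intro test_closure_sum union) auto
      show "(\<lambda>n. \<Sum>i<n. indicator (A i \<inter> box a b) x :: real) \<longlonglongrightarrow> indicator (\<Union>i. A i \<inter> box a b) x" for x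
        using s[of x] by (simp add: sums_def)
      show "L2 (indicator (box a b) :: 'a \<Rightarrow> real)"
        using emeasure_bounded_finite[OF bounded_box[of a b]] by (intro sq_int_indicator) auto
      show "lmeas (indicator (\<Union>i. A i \<inter> box a b))"
        using meas by (intro borel_measurable_indicator sets_completionI_sets) auto
      show "norm (\<Sum>i<n. indicator (A i \<inter> box a b) x :: real) \<le> norm (indicator (box a b) x :: real)" for n x
      proof -
        have "(\<Sum>i<n. indicator (A i \<inter> box a b) x :: real) \<le> indicator (\<Union>i. A i \<inter> box a b) x"
          using s[of x] by (metis sum_le_suminf sums_summable sums_unique finite_lessThan indicator_pos_le)
        also have "\<dots> \<le> indicator (box a b) x" by (auto simp: indicator_def)
        finally show ?thesis by (simp add: sum_nonneg)
      qed
    qed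
    moreover have "(\<Union>i. A i) \<inter> box a b = (\<Union>i. A i \<inter> box a b)" by auto
    ultimately show ?case by (simp only:)
  qed
qed

abbreviation "cube n \<equiv> box (- (real n *\<^sub>R One)) (real n *\<^sub>R One)"

lemma finite_indicator_in_closure:
  fixes A :: "'a::euclidean_space set"
  assumes A: "A \<in> sets borel" "emeasure lborel A < \<infinity>"
  shows "indicator A \<in> test_closure"
proof (rule test_closure_dominated[where F = "\<lambda>n. indicator (A \<inter> cube n)" and w = "indicator A :: 'a \<Rightarrow> real"])
  show "L2 (indicator A :: 'a \<Rightarrow> real)"
    using A by (intro sq_int_indicator) auto
  from sq_int_meas[OF this] show "lmeas (indicator A :: 'a \<Rightarrow> real)" .
  fix x :: 'a
  obtain n0 where n0: "x \<in> cube n0"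
    using UN_box_eq_UNIV[where 'a = 'a] by blast
  have "x \<in> cube n" if "n \<ge> n0" for n
    unfolding mem_box
  proof
    fix i :: 'a assume i: "i \<in> Basis"
    have "- real n0 < x \<bullet> i \<and> x \<bullet> i < real n0" using n0 i by (simp add: mem_box)
    moreover have "real n0 \<le> real n" using that by simp
    ultimately show "- (real n *\<^sub>R One) \<bullet> i < x \<bullet> i \<and> x \<bullet> i < (real n *\<^sub>R One) \<bullet> i"
      using i by simp
  qed
  then have "\<forall>\<^sub>F n in sequentially. x \<in> cube n"
    by (auto simp: eventually_sequentially)
  then have "\<forall>\<^sub>F n in sequentially. (indicator (A \<inter> cube n) x :: real) = indicator A x"
    by eventually_elim (auto simp: indicator_def)
  then show "(\<lambda>n. indicator (A \<inter> cube n) x :: real) \<longlonglongrightarrow> indicator A x"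
    by (rule tendsto_eventually)
next
  show "indicator (A \<inter> cube n) \<in> test_closure" for n
    by (rule Int_box_indicator_in_closure[OF A(1)])
  show "norm (indicator (A \<inter> cube n) x :: real) \<le> norm (indicator A x :: real)" for n x
    by (auto simp: indicator_def)
qed

text \<open>On the level set of a value c other than 0 the indicator is at most s^2 / c^2, so that
  set has finite measure; the level set of 0, possibly of infinite measure, contributes the zero
  function.\<close>

lemma simple_in_closure:
  fixes s :: "'a::euclidean_space \<Rightarrow> real"
  assumes s: "simple_function borel s" "L2 s"
  shows "s \<in> test_closure"
proof -
  have fin: "finite (range s)" using simple_functionD(1)[OF s(1)] by simp
  have rep: "s = (\<lambda>x. \<Sum>c\<in>range s. c * indicator (s -` {c}) x)"
  proof
    fix x
    have "(\<Sum>c\<in>range s. c * indicator (s -` {c}) x) = (\<Sum>c\<in>range s. if c = s x then c else 0)"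
      by (intro sum.cong) (auto simp: indicator_def)
    then show "s x = (\<Sum>c\<in>range s. c * indicator (s -` {c}) x)" using fin by simp
  qed
  have "(\<lambda>x. c * indicator (s -` {c}) x) \<in> test_closure" for c
  proof (cases "c = 0")
    case True
    then show ?thesis using test_closure_sum[of "{}"] by simp
  next
    case False
    have m: "s -` {c} \<in> sets borel" using simple_functionD(2)[OF s(1), of "{c}"] by simp
    have "integrable lebesgue (indicator (s -` {c}) :: 'a \<Rightarrow> real)"
    proof (rule Bochner_Integration.integrable_bound)
      show "integrable lebesgue (\<lambda>x. (norm (s x))\<^sup>2 / c\<^sup>2)" using sq_int_norm[OF s(2)] by simp
      show "AE x in lebesgue. norm (indicator (s -` {c}) x :: real) \<le> norm ((norm (s x))\<^sup>2 / c\<^sup>2)"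
        using False by (intro AE_I2) (auto simp: indicator_def)
    qed (use m in \<open>auto intro!: borel_measurable_indicator sets_completionI_sets\<close>)
    then have "emeasure lborel (s -` {c}) < \<infinity>"
      using m by (simp add: integrable_indicator_iff)
    from finite_indicator_in_closure[OF m this]
    show ?thesis using test_closure_lincomb[of "indicator (s -` {c})" "indicator (s -` {c})" c 0] by simp
  qed
  then have "(\<lambda>x. \<Sum>c\<in>range s. c * indicator (s -` {c}) x) \<in> test_closure"
    by (intro test_closure_sum fin)
  with rep show ?thesis by simp
qed

theorem test_fun_dense:
  fixes f :: "'a::euclidean_space \<Rightarrow> real"
  assumes f: "L2 f"
  shows "f \<in> test_closure"
proof -
  \<comment> \<open>The approximation by simple functions takes place among Borel functions, so f is
    first replaced by an a.e. equal Borel function.\<close>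
  obtain f' where f': "f' \<in> borel_measurable lborel" "AE x in lborel. f x = f' x"
    using completion_ex_borel_measurable_real[OF sq_int_meas[OF f]] by blast
  have ae: "AE x in lebesgue. f x = f' x" using f'(2) by (rule AE_completion)
  have m': "lmeas f'" using f'(1) by (rule measurable_completion)
  have si: "L2 f'"
    by (rule sqnorm_mono_AE(1)[OF f m']) (use ae in \<open>auto elim!: eventually_mono\<close>)
  have f'b: "f' \<in> borel_measurable borel" using f'(1) by simp
  from borel_measurable_implies_sequence_metric[OF f'b, of 0]
  obtain s where s: "\<And>i. simple_function borel (s i)" "\<And>x. (\<lambda>i. s i x) \<longlonglongrightarrow> f' x"
    "\<And>i x. norm (s i x) \<le> norm (2 * f' x)" by (auto simp: dist_norm abs_mult)
  have w: "L2 (\<lambda>x. 2 * f' x)" using sq_int_scaleR[OF si, of 2] by simp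
  have "s i \<in> test_closure" for i
  proof (rule simple_in_closure[OF s(1)])
    show "L2 (s i)"
      by (rule sqnorm_mono_AE(1)[OF w])
         (use s borel_measurable_simple_function[OF s(1)] in \<open>auto intro: borel_measurable_lebesgueI\<close>)
  qed
  from test_closure_dominated[OF this m' s(2) w s(3)] have "f' \<in> test_closure" .
  then have "\<exists>g\<in>test_closure. nrm2 (\<lambda>x. f x - g x) < e" if "0 < e" for e
  proof (intro bexI[of _ f'])
    have "nrm2 (\<lambda>x. f x - f' x) = 0"
      using ae by (subst sqnorm_eq_0_iff) (auto intro!: sq_int_diff f si)
    with that show "nrm2 (\<lambda>x. f x - f' x) < e" by simp
  qed auto
  then show ?thesis by (rule test_closure_limit[OF f])
qed

text \<open>Test functions approximating w itself turn the hypothesis into |w|^2 <= K |w| for the L2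
  norm. With K = 0 this gives uniqueness of weak gradients, with K = |h| |g| the translation
  estimate.\<close>

lemma test_fun_dual_bound:
  fixes w :: "'a::euclidean_space \<Rightarrow> real"
  assumes w: "L2 w" and K: "0 \<le> K"
    and le: "\<And>\<phi>. test_fun \<phi> \<Longrightarrow> (\<integral>x. w x * \<phi> x \<partial>lebesgue) \<le> K * sqrt (nrm2 \<phi>)"
  shows "nrm2 w \<le> K\<^sup>2"
proof -
  have "\<exists>\<phi>. \<forall>n. test_fun (\<phi> n) \<and> nrm2 (\<lambda>x. w x - \<phi> n x) < 1 / real (Suc n)"
  proof (rule choice, rule allI)
    show "\<exists>\<phi>. test_fun \<phi> \<and> nrm2 (\<lambda>x. w x - \<phi> x) < 1 / real (Suc n)" for n
      using test_fun_dense[OF w] unfolding test_closure_def by (auto dest!: spec[of _ "1 / real (Suc n)"])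
  qed
  then obtain \<phi> where \<phi>: "\<And>n. test_fun (\<phi> n)" "\<And>n. nrm2 (\<lambda>x. w x - \<phi> n x) < 1 / real (Suc n)" by blast
  have s: "L2 (\<phi> n)" for n by (intro test_fun_sq_int \<phi>)
  have lim: "(\<lambda>n. nrm2 (\<lambda>x. \<phi> n x - w x)) \<longlonglongrightarrow> 0"
  proof (rule tendsto_sandwich[OF _ _ tendsto_const[of 0] LIMSEQ_inverse_real_of_nat])
    show "\<forall>\<^sub>F n in sequentially. nrm2 (\<lambda>x. \<phi> n x - w x) \<le> inverse (real (Suc n))"
      using \<phi>(2) by (intro always_eventually allI) (simp add: sqnorm_minus_commute[of _ _ w] inverse_eq_divide less_imp_le)
  qed (simp add: sqnorm_nonneg)
  have "(\<lambda>n. \<integral>x. \<phi> n x * w x \<partial>lebesgue) \<longlonglongrightarrow> (\<integral>x. w x * w x \<partial>lebesgue)"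
    using inner_integral_tendsto[OF s w w lim] by (simp add: mult.commute)
  moreover have "(\<lambda>n. K * (sqrt (nrm2 w) + sqrt (nrm2 (\<lambda>x. \<phi> n x - w x)))) \<longlonglongrightarrow> K * (sqrt (nrm2 w) + sqrt 0)"
    by (intro tendsto_intros lim)
  moreover have "(\<integral>x. \<phi> n x * w x \<partial>lebesgue) \<le> K * (sqrt (nrm2 w) + sqrt (nrm2 (\<lambda>x. \<phi> n x - w x)))" for n
  proof -
    have "(\<integral>x. \<phi> n x * w x \<partial>lebesgue) \<le> K * sqrt (nrm2 (\<phi> n))"
      using le[OF \<phi>(1)[of n]] by (simp add: mult.commute)
    also have "\<dots> \<le> K * (sqrt (nrm2 w) + sqrt (nrm2 (\<lambda>x. \<phi> n x - w x)))"
      using sqnorm_triangle[OF w sq_int_diff[OF s w], of n] by (intro mult_left_mono K) simp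
    finally show ?thesis .
  qed
  ultimately have "(\<integral>x. w x * w x \<partial>lebesgue) \<le> K * sqrt (nrm2 w)"
    using LIMSEQ_le[of _ _ _ "K * (sqrt (nrm2 w) + sqrt 0)"] by auto
  then have "nrm2 w \<le> K * sqrt (nrm2 w)"
    by (simp add: sqnorm_def power2_eq_square)
  then have *: "sqrt (nrm2 w) * sqrt (nrm2 w) \<le> K * sqrt (nrm2 w)"
    by (simp add: sqnorm_nonneg)
  have "sqrt (nrm2 w) \<le> K"
  proof (cases "nrm2 w = 0")
    case False
    then have "0 < sqrt (nrm2 w)" using sqnorm_nonneg[of lebesgue w] by simp
    with * show ?thesis by (rule mult_right_le_imp_le)
  qed (simp add: K)
  then show ?thesis by (rule sqrt_le_D)
qed

subsection \<open>Weak gradients and translations\<close>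

lemma weak_grad_measurable: "weak_grad u g \<Longrightarrow> g \<in> borel_measurable lebesgue"
  by (simp add: weak_grad_def)

lemma weak_gradD:
  assumes "weak_grad u g" "test_fun \<phi>" "b \<in> Basis"
  shows "integrable lebesgue (\<lambda>x. u x * pd b \<phi> x)"
    "integrable lebesgue (\<lambda>x. (g x \<bullet> b) * \<phi> x)"
    "(\<integral>x. u x * pd b \<phi> x \<partial>lebesgue) = - (\<integral>x. (g x \<bullet> b) * \<phi> x \<partial>lebesgue)"
  using assms unfolding weak_grad_def by blast+

lemma sq_int_component:
  assumes "sq_int M g" shows "sq_int M (\<lambda>x. g x \<bullet> b)"
proof -
  have "sq_int M (\<lambda>x. norm b *\<^sub>R g x)" by (rule sq_int_scaleR[OF assms])
  moreover have "(\<lambda>x. g x \<bullet> b) \<in> borel_measurable M" using sq_int_meas[OF assms] by simp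
  ultimately show ?thesis
  proof (rule sqnorm_mono_AE(1), intro AE_I2)
    show "norm (g x \<bullet> b) \<le> norm (norm b *\<^sub>R g x)" for x
      using Cauchy_Schwarz_ineq2[of "g x" b] by (simp add: mult.commute)
  qed
qed

lemma sq_int_times:
  fixes f g :: "'a \<Rightarrow> real"
  shows "sq_int M f \<Longrightarrow> sq_int M g \<Longrightarrow> integrable M (\<lambda>x. f x * g x)"
  using sq_int_inner[of M f g] by simp

lemma weak_gradI:
  assumes u: "L2 u" and g: "L2 g"
    and eq: "\<And>\<phi> b. test_fun \<phi> \<Longrightarrow> b \<in> Basis \<Longrightarrow>
      (\<integral>x. u x * pd b \<phi> x \<partial>lebesgue) = - (\<integral>x. (g x \<bullet> b) * \<phi> x \<partial>lebesgue)"
  shows "weak_grad u g"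
  unfolding weak_grad_def
proof (intro conjI allI impI ballI)
  fix \<phi> :: "'a \<Rightarrow> real" and b :: 'a assume *: "test_fun \<phi>" "b \<in> Basis"
  show "integrable lebesgue (\<lambda>x. u x * pd b \<phi> x)"
    by (rule sq_int_times[OF u test_fun_partial_sq_int[OF *]])
  show "integrable lebesgue (\<lambda>x. (g x \<bullet> b) * \<phi> x)"
    by (rule sq_int_times[OF sq_int_component[OF g] test_fun_sq_int[OF *(1)]])
qed (use eq sq_int_meas[OF g] in auto)

lemma weak_grad_unique:
  assumes "weak_grad u g" "weak_grad u h" "L2 g" "L2 h"
  shows "AE x in lebesgue. g x = h x"
proof -
  have "AE x in lebesgue. (g x - h x) \<bullet> b = 0" if b: "b \<in> Basis" for b
  proof -
    have si: "L2 (\<lambda>x. (g x - h x) \<bullet> b)"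
      by (intro sq_int_component sq_int_diff assms)
    have "nrm2 (\<lambda>x. (g x - h x) \<bullet> b) \<le> 0\<^sup>2"
    proof (rule test_fun_dual_bound[OF si])
      fix \<phi> :: "'a \<Rightarrow> real" assume \<phi>: "test_fun \<phi>"
      note 1 = weak_gradD[OF assms(1) \<phi> b] and 2 = weak_gradD[OF assms(2) \<phi> b]
      have "(\<integral>x. ((g x - h x) \<bullet> b) * \<phi> x \<partial>lebesgue) = (\<integral>x. (g x \<bullet> b) * \<phi> x \<partial>lebesgue) - (\<integral>x. (h x \<bullet> b) * \<phi> x \<partial>lebesgue)"
        by (subst Bochner_Integration.integral_diff[symmetric]) (use 1 2 in \<open>auto simp: inner_diff_left algebra_simps\<close>)
      then show "(\<integral>x. ((g x - h x) \<bullet> b) * \<phi> x \<partial>lebesgue) \<le> 0 * sqrt (nrm2 \<phi>)"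
        using 1(3) 2(3) by linarith
    qed simp
    then have "nrm2 (\<lambda>x. (g x - h x) \<bullet> b) = 0" using sqnorm_nonneg[of lebesgue "\<lambda>x. (g x - h x) \<bullet> b"] by simp
    then show ?thesis by (simp only: sqnorm_eq_0_iff[OF si])
  qed
  then have "AE x in lebesgue. \<forall>b\<in>Basis. (g x - h x) \<bullet> b = 0"
    by (rule AE_finite_allI[OF finite_Basis])
  then show ?thesis
  proof eventually_elim
    case (elim x)
    then show ?case by (intro euclidean_eqI[of "g x"]) (simp add: inner_diff_left)
  qed
qed

lemma H1_iff: "H1 u \<longleftrightarrow> L2 u \<and> (\<exists>g. weak_grad u g \<and> L2 g)"
  by (auto simp: H1_def sq_int_def weak_grad_def)

lemma H1_sq_int: "H1 u \<Longrightarrow> L2 u"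
  by (simp add: H1_iff)

lemma H1I: "L2 u \<Longrightarrow> weak_grad u g \<Longrightarrow> L2 g \<Longrightarrow> H1 u"
  by (auto simp: H1_iff)

lemma grad_works:
  assumes "H1 u" shows "weak_grad u (grad u)" "L2 (grad u)"
proof -
  have "\<exists>g. weak_grad u g \<and> integrable lebesgue (\<lambda>x. (norm (g x))\<^sup>2)"
    using assms by (auto simp: H1_def)
  from someI_ex[OF this] have *: "weak_grad u (grad u) \<and> integrable lebesgue (\<lambda>x. (norm (grad u x))\<^sup>2)"
    by (simp add: grad_def)
  then show "weak_grad u (grad u)" by simp
  from * show "L2 (grad u)" by (simp add: sq_int_def weak_grad_def)
qed

text \<open>\<open>grad u\<close> is picked by \<open>SOME\<close>, so an explicit weak gradient is
  matched with it only almost everywhere. Linear combinations and limits of gradients are brought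
  back to \<open>grad\<close> in this way.\<close>

lemma grad_AE_eq:
  assumes "L2 u" "weak_grad u g" "L2 g"
  shows "AE x in lebesgue. grad u x = g x"
  using grad_works[OF H1I[OF assms]] assms by (intro weak_grad_unique[of u]) auto

lemma weak_grad_lincomb:
  assumes u: "weak_grad u g" and v: "weak_grad v h"
  shows "weak_grad (\<lambda>x. s * u x + t * v x) (\<lambda>x. s *\<^sub>R g x + t *\<^sub>R h x)"
  unfolding weak_grad_def
proof (intro conjI allI impI ballI)
  show "lmeas (\<lambda>x. s *\<^sub>R g x + t *\<^sub>R h x)"
    using weak_grad_measurable[OF u] weak_grad_measurable[OF v] by simp
  fix \<phi> :: "'a \<Rightarrow> real" and b :: 'a assume *: "test_fun \<phi>" "b \<in> Basis"
  note 1 = weak_gradD[OF u *] and 2 = weak_gradD[OF v *]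
  have eq: "(s * u x + t * v x) * pd b \<phi> x = s * (u x * pd b \<phi> x) + t * (v x * pd b \<phi> x)"
    "((s *\<^sub>R g x + t *\<^sub>R h x) \<bullet> b) * \<phi> x = s * ((g x \<bullet> b) * \<phi> x) + t * ((h x \<bullet> b) * \<phi> x)" for x
    by (simp_all add: algebra_simps)
  show "integrable lebesgue (\<lambda>x. (s * u x + t * v x) * pd b \<phi> x)"
    "integrable lebesgue (\<lambda>x. ((s *\<^sub>R g x + t *\<^sub>R h x) \<bullet> b) * \<phi> x)"
    unfolding eq using 1 2 by (intro Bochner_Integration.integrable_add integrable_mult_right; simp)+
  have "(\<integral>x. (s * u x + t * v x) * pd b \<phi> x \<partial>lebesgue)
      = s * (\<integral>x. u x * pd b \<phi> x \<partial>lebesgue) + t * (\<integral>x. v x * pd b \<phi> x \<partial>lebesgue)"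
    unfolding eq using 1(1) 2(1) by (simp del: iter_partial.simps)
  also have "\<dots> = - (\<integral>x. s * ((g x \<bullet> b) * \<phi> x) + t * ((h x \<bullet> b) * \<phi> x) \<partial>lebesgue)"
    unfolding 1(3) 2(3) using 1(2) 2(2) by simp
  finally show "(\<integral>x. (s * u x + t * v x) * pd b \<phi> x \<partial>lebesgue)
      = - (\<integral>x. ((s *\<^sub>R g x + t *\<^sub>R h x) \<bullet> b) * \<phi> x \<partial>lebesgue)" unfolding eq .
qed

lemma H1_lincomb: "H1 u \<Longrightarrow> H1 v \<Longrightarrow> H1 (\<lambda>x. s * u x + t * v x)"
  using sq_int_lincomb[of lebesgue u v s t]
  by (intro H1I[OF _ weak_grad_lincomb[OF grad_works(1) grad_works(1)]] sq_int_lincomb grad_works(2))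
     (auto simp: H1_sq_int)

lemma grad_lincomb:
  assumes "H1 u" "H1 v"
  shows "AE x in lebesgue. grad (\<lambda>x. s * u x + t * v x) x = s *\<^sub>R grad u x + t *\<^sub>R grad v x"
  by (rule grad_AE_eq[OF H1_sq_int[OF H1_lincomb[OF assms]]])
     (use assms in \<open>auto intro!: weak_grad_lincomb sq_int_lincomb grad_works\<close>)

lemma weak_grad_cong_AE:
  assumes "weak_grad u g" "AE x in lebesgue. u x = v x" "L2 v" "L2 g"
  shows "weak_grad v g"
proof (rule weak_gradI[OF assms(3,4)])
  fix \<phi> :: "'a \<Rightarrow> real" and b :: 'a assume *: "test_fun \<phi>" "b \<in> Basis"
  have "(\<integral>x. v x * pd b \<phi> x \<partial>lebesgue) = (\<integral>x. u x * pd b \<phi> x \<partial>lebesgue)"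
  proof (rule integral_cong_AE)
    show "lmeas (\<lambda>x. v x * pd b \<phi> x)"
      using sq_int_times[OF assms(3) test_fun_partial_sq_int[OF *]] by (rule borel_measurable_integrable)
    show "lmeas (\<lambda>x. u x * pd b \<phi> x)"
      using weak_gradD(1)[OF assms(1) *] by (rule borel_measurable_integrable)
    show "AE x in lebesgue. v x * pd b \<phi> x = u x * pd b \<phi> x"
      using assms(2) by eventually_elim (simp only:)
  qed
  then show "(\<integral>x. v x * pd b \<phi> x \<partial>lebesgue) = - (\<integral>x. (g x \<bullet> b) * \<phi> x \<partial>lebesgue)"
    using weak_gradD(3)[OF assms(1) *] by (rule trans)
qed

text \<open>The weak gradient is a closed operator: for a fixed test function both sides of its
  defining identity are continuous in L2.\<close>

lemma weak_grad_limit: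
  assumes w: "\<And>n. weak_grad (U n) (G n)"
    and U: "\<And>n. L2 (U n)" and G: "\<And>n. L2 (G n)"
    and u: "L2 u" and g: "L2 g"
    and limU: "L2_tendsto lebesgue U u"
    and limG: "L2_tendsto lebesgue G g"
  shows "weak_grad u g"
proof (rule weak_gradI[OF u g])
  fix \<phi> :: "'a \<Rightarrow> real" and b :: 'a assume *: "test_fun \<phi>" "b \<in> Basis"
  have 1: "(\<lambda>n. \<integral>x. U n x * pd b \<phi> x \<partial>lebesgue) \<longlonglongrightarrow> (\<integral>x. u x * pd b \<phi> x \<partial>lebesgue)"
    using inner_integral_tendsto[OF U u test_fun_partial_sq_int[OF *] limU] by (simp only: inner_real_def)
  have b\<phi>: "L2 (\<lambda>x. \<phi> x *\<^sub>R b)"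
    using sqnorm_mono_AE(1)[OF sq_int_scaleR[OF test_fun_sq_int[OF *(1)], of "norm b"], of "\<lambda>x. \<phi> x *\<^sub>R b"]
      sq_int_meas[OF test_fun_sq_int[OF *(1)]] by (simp add: abs_mult mult.commute)
  have 2: "(\<lambda>n. \<integral>x. (G n x \<bullet> b) * \<phi> x \<partial>lebesgue) \<longlonglongrightarrow> (\<integral>x. (g x \<bullet> b) * \<phi> x \<partial>lebesgue)"
    using inner_integral_tendsto[OF G g b\<phi> limG] by (simp add: mult.commute)
  have "(\<lambda>n. \<integral>x. U n x * pd b \<phi> x \<partial>lebesgue) \<longlonglongrightarrow> - (\<integral>x. (g x \<bullet> b) * \<phi> x \<partial>lebesgue)"
    unfolding weak_gradD(3)[OF w *] by (rule tendsto_minus[OF 2])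
  with 1 show "(\<integral>x. u x * pd b \<phi> x \<partial>lebesgue) = - (\<integral>x. (g x \<bullet> b) * \<phi> x \<partial>lebesgue)"
    by (rule LIMSEQ_unique)
qed

section \<open>Translations and their effect on weakly differentiable functions\<close>

lemma lebesgue_integral_translate:
  fixes f :: "'a::euclidean_space \<Rightarrow> real"
  assumes f: "f \<in> borel_measurable borel"
  shows "(\<integral>x. f (c + x) \<partial>lebesgue) = (\<integral>x. f x \<partial>lebesgue)"
    and "integrable lebesgue (\<lambda>x. f (c + x)) \<longleftrightarrow> integrable lebesgue f"
proof -
  have m: "(\<lambda>x. f (c + x)) \<in> borel_measurable borel" using f by simp
  have "(\<integral>x. f (c + x) \<partial>lborel) = (\<integral>x. f x \<partial>distr lborel borel ((+) c))"
    by (subst integral_distr) (use f in auto)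
  then show "(\<integral>x. f (c + x) \<partial>lebesgue) = (\<integral>x. f x \<partial>lebesgue)"
    using f m by (simp add: integral_completion lborel_distr_plus)
  have "integrable lborel (\<lambda>x. f (c + x)) \<longleftrightarrow> integrable (distr lborel borel ((+) c)) f"
    by (subst integrable_distr_eq) (use f in auto)
  then show "integrable lebesgue (\<lambda>x. f (c + x)) \<longleftrightarrow> integrable lebesgue f"
    using f m by (simp add: integrable_completion lborel_distr_plus)
qed

lemma sqnorm_translate:
  fixes f :: "'a::euclidean_space \<Rightarrow> real"
  assumes f: "f \<in> borel_measurable borel"
  shows "nrm2 (\<lambda>x. f (c + x)) = nrm2 f"
    and "L2 (\<lambda>x. f (c + x)) \<longleftrightarrow> L2 f"
  using lebesgue_integral_translate[of "\<lambda>x. (norm (f x))\<^sup>2" c] f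
  by (auto simp: sqnorm_def sq_int_def intro!: borel_measurable_lebesgueI)

lemma test_fun_Lipschitz:
  fixes \<phi> :: "'a::euclidean_space \<Rightarrow> real"
  assumes \<phi>: "test_fun \<phi>"
  shows "\<exists>L\<ge>0. \<forall>x y. \<bar>\<phi> x - \<phi> y\<bar> \<le> L * norm (x - y)"
proof (rule test_fun_bounds[OF \<phi>])
  fix R C assume C: "C > 0" "\<And>x b. b \<in> Basis \<Longrightarrow> \<bar>pd b \<phi> x\<bar> \<le> C"
  have on: "onorm (\<lambda>h. \<Sum>b\<in>Basis. (h \<bullet> b) * pd b \<phi> x) \<le> real DIM('a) * C" for x
  proof (rule onorm_bound)
    fix h :: 'a
    have "\<bar>\<Sum>b\<in>Basis. (h \<bullet> b) * pd b \<phi> x\<bar> \<le> (\<Sum>b\<in>Basis. \<bar>(h \<bullet> b) * pd b \<phi> x\<bar>)" by (rule sum_abs)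
    also have "\<dots> \<le> (\<Sum>b\<in>(Basis::'a set). norm h * C)"
      using C by (intro sum_mono) (auto simp: abs_mult Basis_le_norm simp del: iter_partial.simps intro!: mult_mono)
    finally show "norm (dir_deriv h \<phi> x) \<le> real DIM('a) * C * norm h"
      by (simp add: mult_ac del: iter_partial.simps)
  qed (use C in simp)
  have "\<bar>\<phi> x - \<phi> y\<bar> \<le> real DIM('a) * C * norm (x - y)" for x y
    using differentiable_bound[OF convex_UNIV has_derivative_at_withinI[OF test_fun_has_derivative[OF \<phi>]] on, of x y] by simp
  with C(1) show ?thesis by (intro exI[of _ "real DIM('a) * C"]) auto
qed

lemma translate_pairing_deriv_0:
  fixes u \<phi> :: "'a::euclidean_space \<Rightarrow> real"
  assumes u: "L2 u" and \<phi>: "test_fun \<phi>"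
  shows "((\<lambda>s. \<integral>x. u x * \<phi> (x - s *\<^sub>R h) \<partial>lebesgue) has_real_derivative
    - (\<integral>x. u x * (dir_deriv h \<phi> x) \<partial>lebesgue)) (at 0)"
  unfolding has_field_derivative_iff tendsto_at_iff_sequentially
proof (intro allI impI)
  fix s :: "nat \<Rightarrow> real" assume "\<forall>i. s i \<in> UNIV - {0}" and s: "s \<longlonglongrightarrow> 0"
  then have s0: "\<And>i. s i \<noteq> 0" by auto
  let ?Q = "\<lambda>n x. (\<phi> (x - s n *\<^sub>R h) - \<phi> x) / s n"
  obtain S where S: "S > 0" "\<And>n. \<bar>s n\<bar> \<le> S"
    using convergent_imp_Bseq[OF convergentI[OF s]] by (auto elim: BseqE)
  obtain L where L: "L \<ge> 0" "\<And>x y. \<bar>\<phi> x - \<phi> y\<bar> \<le> L * norm (x - y)" using test_fun_Lipschitz[OF \<phi>] by blast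
  obtain R where R: "\<And>x. R < norm x \<Longrightarrow> \<phi> x = 0" using test_fun_bounds[OF \<phi>] by metis
  have si: "L2 (\<lambda>x. \<phi> (x - s n *\<^sub>R h))" for n
    by (intro test_fun_sq_int test_fun_translate \<phi>)
  have si0: "L2 \<phi>" by (intro test_fun_sq_int \<phi>)
  \<comment> \<open>Dominating function: the quotient is at most L |h| by the Lipschitz bound, and
    it vanishes off this ball because |s n| <= S.\<close>
  define w where "w x = L * norm h * indicator (cball 0 (R + S * norm h)) x" for x :: 'a
  have w: "L2 w"
  proof (rule sq_int_bounded_support[of _ "L * norm h" "R + S * norm h"])
    show "lmeas w"
      unfolding w_def by (intro borel_measurable_times borel_measurable_const borel_measurable_indicator sets_completionI_sets) auto
  qed (use L in \<open>auto simp: w_def indicator_def\<close>)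
  have bd: "\<bar>?Q n x\<bar> \<le> w x" for n x
  proof (cases "norm x \<le> R + S * norm h")
    case True
    have "\<bar>\<phi> (x - s n *\<^sub>R h) - \<phi> x\<bar> \<le> L * (\<bar>s n\<bar> * norm h)"
      using L(2)[of "x - s n *\<^sub>R h" x] by simp
    then show ?thesis using True s0[of n] by (simp add: w_def field_simps)
  next
    case False
    have "norm (s n *\<^sub>R h) \<le> S * norm h" using S(2)[of n] by (simp add: mult_right_mono)
    then have "R < norm (x - s n *\<^sub>R h)" using False norm_triangle_ineq2[of x "s n *\<^sub>R h"] by linarith
    moreover have "R < norm x" using False S(1) mult_nonneg_nonneg[of S "norm h"] norm_ge_zero[of h] by linarith
    ultimately show ?thesis using R L by (simp add: w_def)
  qed
  have lim: "(\<lambda>n. ?Q n x) \<longlonglongrightarrow> - (dir_deriv h \<phi> x)" for x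
  proof -
    have 1: "((\<lambda>t. x - t *\<^sub>R h) has_derivative (\<lambda>t. - (t *\<^sub>R h))) (at 0)" by (auto intro!: derivative_eq_intros)
    have 2: "(\<phi> has_derivative (\<lambda>h. \<Sum>b\<in>Basis. (h \<bullet> b) * pd b \<phi> x)) (at (x - 0 *\<^sub>R h))"
      using test_fun_has_derivative[OF \<phi>, of x] by (simp del: iter_partial.simps)
    have "((\<lambda>t. \<phi> (x - t *\<^sub>R h)) has_real_derivative - (dir_deriv h \<phi> x)) (at 0)"
      using has_derivative_compose[OF 1 2] unfolding has_field_derivative_def
      by (rule has_derivative_eq_rhs) (auto simp: sum_distrib_left sum_negf mult_ac simp del: iter_partial.simps)
    then show ?thesis
      using s s0 unfolding has_field_derivative_iff tendsto_at_iff_sequentially by (auto simp: o_def simp del: iter_partial.simps)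
  qed
  have um: "lmeas u" using u by (rule sq_int_meas)
  have "(\<lambda>n. \<integral>x. u x * ?Q n x \<partial>lebesgue) \<longlonglongrightarrow> (\<integral>x. u x * - (dir_deriv h \<phi> x) \<partial>lebesgue)"
  proof (rule integral_dominated_convergence)
    show "integrable lebesgue (\<lambda>x. \<bar>u x * w x\<bar>)" by (intro integrable_abs sq_int_times u w)
    show "lmeas (\<lambda>x. u x * ?Q n x)" for n
      using um sq_int_meas[OF si, of n] sq_int_meas[OF si0] by simp
    show "lmeas (\<lambda>x. u x * - (dir_deriv h \<phi> x))"
      using um sq_int_meas[OF test_fun_partial_sq_int[OF \<phi>]]
      by (intro borel_measurable_times borel_measurable_uminus borel_measurable_sum borel_measurable_const)
    show "AE x in lebesgue. (\<lambda>n. u x * ?Q n x) \<longlonglongrightarrow> u x * - (dir_deriv h \<phi> x)"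
      by (intro AE_I2 tendsto_mult tendsto_const lim)
    show "AE x in lebesgue. norm (u x * ?Q n x) \<le> \<bar>u x * w x\<bar>" for n
    proof (rule AE_I2)
      fix x
      have "\<bar>u x\<bar> * \<bar>?Q n x\<bar> \<le> \<bar>u x\<bar> * \<bar>w x\<bar>"
        using bd[of x n] by (intro mult_left_mono) auto
      then show "norm (u x * ?Q n x) \<le> \<bar>u x * w x\<bar>" by (simp add: abs_mult)
    qed
  qed
  moreover have "((\<integral>x. u x * \<phi> (x - s n *\<^sub>R h) \<partial>lebesgue) - (\<integral>x. u x * \<phi> (x - 0 *\<^sub>R h) \<partial>lebesgue)) / (s n - 0)
      = (\<integral>x. u x * ?Q n x \<partial>lebesgue)" for n
    using sq_int_times[OF u si, of n] sq_int_times[OF u si0]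
    by (simp add: right_diff_distrib diff_divide_distrib Bochner_Integration.integral_diff)
  ultimately show "((\<lambda>y. ((\<integral>x. u x * \<phi> (x - y *\<^sub>R h) \<partial>lebesgue) - (\<integral>x. u x * \<phi> (x - 0 *\<^sub>R h) \<partial>lebesgue)) / (y - 0)) \<circ> s)
      \<longlonglongrightarrow> - (\<integral>x. u x * (dir_deriv h \<phi> x) \<partial>lebesgue)"
    unfolding o_def by (simp only: mult_minus_right integral_minus)
qed

lemma weak_grad_directional:
  assumes w: "weak_grad u g" and \<phi>: "test_fun \<phi>"
  shows "- (\<integral>x. u x * (dir_deriv h \<phi> x) \<partial>lebesgue) = (\<integral>x. g x \<bullet> (\<phi> x *\<^sub>R h) \<partial>lebesgue)"
proof -
  note D = weak_gradD[OF w \<phi>]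
  have "(\<integral>x. u x * (dir_deriv h \<phi> x) \<partial>lebesgue)
      = (\<integral>x. (\<Sum>b\<in>Basis. (h \<bullet> b) * (u x * pd b \<phi> x)) \<partial>lebesgue)"
    by (simp add: sum_distrib_left mult_ac del: iter_partial.simps)
  also have "\<dots> = (\<Sum>b\<in>Basis. (h \<bullet> b) * (\<integral>x. u x * pd b \<phi> x \<partial>lebesgue))"
    using D(1) by (subst Bochner_Integration.integral_sum) (auto simp del: iter_partial.simps)
  also have "\<dots> = (\<Sum>b\<in>Basis. (h \<bullet> b) * - (\<integral>x. (g x \<bullet> b) * \<phi> x \<partial>lebesgue))"
    by (intro sum.cong refl) (simp only: D(3))
  also have "\<dots> = - (\<integral>x. (\<Sum>b\<in>Basis. (h \<bullet> b) * ((g x \<bullet> b) * \<phi> x)) \<partial>lebesgue)"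
    using D(2) by (subst Bochner_Integration.integral_sum) (auto simp: sum_negf)
  also have "(\<lambda>x. \<Sum>b\<in>Basis. (h \<bullet> b) * ((g x \<bullet> b) * \<phi> x)) = (\<lambda>x. g x \<bullet> (\<phi> x *\<^sub>R h))"
    by (subst euclidean_inner) (simp add: sum_distrib_left mult_ac)
  finally show ?thesis by simp
qed

text \<open>By duality the shift moves to the test function. The pairing J(s) of u with
  \<open>\<phi>\<close> shifted by s h has derivative D(s), and the mean value theorem gives J(1) -
  J(0) = D(s) for some s. Shifts preserve the norm of \<open>\<phi>\<close>, so Cauchy-Schwarz
  bounds D(s) independently of s.\<close>

theorem translation_estimate:
  fixes u :: "'a::euclidean_space \<Rightarrow> real"
  assumes ub: "u \<in> borel_measurable borel" and u: "L2 u"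
    and w: "weak_grad u g" and g: "L2 g"
  shows "nrm2 (\<lambda>x. u (h + x) - u x) \<le> (norm h)\<^sup>2 * nrm2 g"
proof -
  have uh: "L2 (\<lambda>x. u (h + x))" using sqnorm_translate(2)[OF ub] u by simp
  have "nrm2 (\<lambda>x. u (h + x) - u x) \<le> (norm h * sqrt (nrm2 g))\<^sup>2"
  proof (rule test_fun_dual_bound[OF sq_int_diff[OF uh u]])
    fix \<phi> :: "'a \<Rightarrow> real" assume \<phi>: "test_fun \<phi>"
    define J where "J s = (\<integral>x. u x * \<phi> (x - s *\<^sub>R h) \<partial>lebesgue)" for s
    define D where "D s = (\<integral>x. g x \<bullet> (\<phi> (x - s *\<^sub>R h) *\<^sub>R h) \<partial>lebesgue)" for s
    have J: "(J has_real_derivative D s) (at s)" for s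
    proof -
      have \<phi>s: "test_fun (\<lambda>x. \<phi> (x - s *\<^sub>R h))" by (rule test_fun_translate[OF \<phi>])
      \<comment> \<open>Replacing \<open>\<phi>\<close> by its shift reduces the derivative at s to
        the derivative at 0.\<close>
      have "((\<lambda>r. \<integral>x. u x * \<phi> (x - r *\<^sub>R h - s *\<^sub>R h) \<partial>lebesgue) has_real_derivative D s) (at 0)"
        using translate_pairing_deriv_0[OF u \<phi>s, of h] unfolding weak_grad_directional[OF w \<phi>s] D_def .
      moreover have "(\<lambda>r. \<integral>x. u x * \<phi> (x - r *\<^sub>R h - s *\<^sub>R h) \<partial>lebesgue) = (\<lambda>r. J (r + s))"
        by (simp add: J_def scaleR_add_left diff_diff_eq)
      ultimately have "((\<lambda>r. J (r + s)) has_real_derivative D s) (at 0)" by simp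
      then show ?thesis using DERIV_shift[of J "D s" 0 s] by simp
    qed
    obtain s where s: "J 1 - J 0 = (1 - 0) * D s" using MVT2[of 0 1 J D] J by auto
    have \<phi>b: "\<phi> \<in> borel_measurable borel" by (rule test_fun_borel_0[OF \<phi>])
    have \<phi>s: "L2 (\<lambda>x. \<phi> (x - s *\<^sub>R h))" by (intro test_fun_sq_int test_fun_translate \<phi>)
    have hn: "norm (\<phi> (x - s *\<^sub>R h) *\<^sub>R h) = norm (norm h *\<^sub>R \<phi> (x - s *\<^sub>R h))" for x by (simp add: abs_mult mult.commute)
    have hsi: "L2 (\<lambda>x. \<phi> (x - s *\<^sub>R h) *\<^sub>R h)"
      by (rule sqnorm_mono_AE(1)[OF sq_int_scaleR[OF \<phi>s, of "norm h"]])
         (use sq_int_meas[OF \<phi>s] hn in auto)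
    have hsq: "nrm2 (\<lambda>x. \<phi> (x - s *\<^sub>R h) *\<^sub>R h) = (norm h)\<^sup>2 * nrm2 \<phi>"
    proof -
      have "nrm2 (\<lambda>x. \<phi> (x - s *\<^sub>R h) *\<^sub>R h) = nrm2 (\<lambda>x. norm h *\<^sub>R \<phi> (x - s *\<^sub>R h))"
        unfolding sqnorm_def hn ..
      also have "\<dots> = (norm h)\<^sup>2 * nrm2 \<phi>"
        unfolding sqnorm_scaleR using sqnorm_translate(1)[OF \<phi>b, of "- (s *\<^sub>R h)"] by simp
      finally show ?thesis .
    qed
    have i1: "integrable lebesgue (\<lambda>x. u (h + x) * \<phi> x)" "integrable lebesgue (\<lambda>x. u x * \<phi> x)"
      by (intro sq_int_times uh u test_fun_sq_int \<phi>)+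
    have "(\<integral>x. (u (h + x) - u x) * \<phi> x \<partial>lebesgue) = (\<integral>x. u (h + x) * \<phi> x \<partial>lebesgue) - (\<integral>x. u x * \<phi> x \<partial>lebesgue)"
      using i1 by (simp add: left_diff_distrib)
    also have "(\<integral>x. u (h + x) * \<phi> x \<partial>lebesgue) = (\<integral>x. u x * \<phi> (x - h) \<partial>lebesgue)"
      using lebesgue_integral_translate(1)[of "\<lambda>x. u x * \<phi> (x - h)" h] ub \<phi>b by simp
    also have "(\<integral>x. u x * \<phi> (x - h) \<partial>lebesgue) - (\<integral>x. u x * \<phi> x \<partial>lebesgue) = D s"
      using s by (simp add: J_def)
    also have "\<dots> \<le> sqrt (nrm2 g) * sqrt (nrm2 (\<lambda>x. \<phi> (x - s *\<^sub>R h) *\<^sub>R h))"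
      using sq_Cauchy_Schwarz_abs[OF g hsi] unfolding D_def by linarith
    also have "\<dots> = norm h * sqrt (nrm2 g) * sqrt (nrm2 \<phi>)"
      by (simp add: hsq real_sqrt_mult)
    finally show "(\<integral>x. (u (h + x) - u x) * \<phi> x \<partial>lebesgue) \<le> norm h * sqrt (nrm2 g) * sqrt (nrm2 \<phi>)" .
  qed (simp add: sqnorm_nonneg)
  then show ?thesis by (simp add: power_mult_distrib sqnorm_nonneg)
qed

subsection \<open>Cube averages\<close>

abbreviation cell :: "real \<Rightarrow> 'a::euclidean_space \<Rightarrow> 'a set" where
  "cell l z \<equiv> cbox z (z + l *\<^sub>R One)"

text \<open>\<open>z\<close> is the lower corner of the cell, so that moving cells (\<open>z\<close>
  equal to x) and grid cells are both described by a base point map r.\<close>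

definition avg :: "real \<Rightarrow> ('a::euclidean_space \<Rightarrow> real) \<Rightarrow> 'a \<Rightarrow> real" where
  "avg l u z = (\<integral>y. u y * indicator (cell l z) y \<partial>lebesgue) / l ^ DIM('a)"

lemma emeasure_cell:
  fixes z :: "'a::euclidean_space"
  assumes "0 \<le> l" shows "emeasure lborel (cell l z) = ennreal (l ^ DIM('a))"
  using assms by (subst emeasure_lborel_cbox_eq) (auto simp: inner_add_left)

lemma cell_indicator:
  fixes z :: "'a::euclidean_space"
  assumes "0 \<le> l"
  shows "L2 (indicator (cell l z) :: 'a \<Rightarrow> real)"
    "nrm2 (indicator (cell l z) :: 'a \<Rightarrow> real) = l ^ DIM('a)"
proof -
  show "L2 (indicator (cell l z) :: 'a \<Rightarrow> real)"
    using assms by (intro sq_int_indicator) (auto simp: emeasure_cell)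
  have "(\<lambda>x. (norm (indicator (cell l z) x :: real))\<^sup>2) = indicator (cell l z)"
    by (auto simp: indicator_def)
  then have "nrm2 (indicator (cell l z) :: 'a \<Rightarrow> real) = measure lborel (cell l z)"
    by (simp add: sqnorm_def)
  also have "\<dots> = l ^ DIM('a)" using assms by (simp add: measure_def emeasure_cell)
  finally show "nrm2 (indicator (cell l z) :: 'a \<Rightarrow> real) = l ^ DIM('a)" .
qed

lemma avg_sq_le:
  fixes u :: "'a::euclidean_space \<Rightarrow> real"
  assumes u: "L2 u" and l: "0 < l"
  shows "(avg l u z)\<^sup>2 \<le> nrm2 u / l ^ DIM('a)"
proof -
  have "(\<integral>y. u y * indicator (cell l z) y \<partial>lebesgue)\<^sup>2 \<le> nrm2 u * l ^ DIM('a)"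
    using sq_Cauchy_Schwarz[OF u cell_indicator(1)[of l z]] cell_indicator(2)[of l z] l by simp
  then show ?thesis
    using l by (simp add: avg_def power_divide divide_simps power2_eq_square)
qed

lemma sq_int_mult_indicator:
  fixes u :: "'a \<Rightarrow> real"
  assumes "sq_int M u" "A \<in> sets M"
  shows "sq_int M (\<lambda>x. u x * indicator A x)"
  by (rule sqnorm_mono_AE(1)[OF assms(1)])
     (use sq_int_meas[OF assms(1)] assms(2) in \<open>auto simp: indicator_def\<close>)

text \<open>Jensen's inequality on a cell, obtained from Cauchy-Schwarz with the indicator. It is
  stated in \<open>ennreal\<close> because the right side, with c = u x, is later integrated over x
  by Tonelli.\<close>

lemma avg_deviation:
  fixes u :: "'a::euclidean_space \<Rightarrow> real"
  assumes u: "L2 u" and l: "0 < l"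
  shows "ennreal ((c - avg l u z)\<^sup>2)
    \<le> ennreal (1 / l ^ DIM('a)) * (\<integral>\<^sup>+y. ennreal ((u y - c)\<^sup>2) * indicator (cell l z) y \<partial>lebesgue)"
proof -
  let ?I = "indicator (cell l z) :: 'a \<Rightarrow> real"
  have ind: "L2 ?I" "nrm2 ?I = l ^ DIM('a)"
    using cell_indicator[of l z] l by auto
  have ui: "L2 (\<lambda>y. u y * ?I y)" by (rule sq_int_mult_indicator[OF u]) auto
  have v: "L2 (\<lambda>y. u y * ?I y - c * ?I y)"
    using sq_int_diff[OF ui sq_int_scaleR[OF ind(1), of c]] by simp
  have i2: "?I y * ?I y = ?I y" for y by (simp add: indicator_def)
  have int: "integrable lebesgue (\<lambda>y. u y * ?I y)" "integrable lebesgue ?I"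
    using sq_int_times[OF ui ind(1)] sq_int_times[OF ind(1) ind(1)] by (simp_all add: mult.assoc i2)
  have m: "(\<integral>y. ?I y \<partial>lebesgue) = l ^ DIM('a)"
    using ind(2) unfolding sqnorm_def by (simp add: power2_eq_square i2)
  have "(avg l u z - c) * l ^ DIM('a) = (\<integral>y. u y * ?I y \<partial>lebesgue) - c * l ^ DIM('a)"
    using l by (simp add: avg_def left_diff_distrib)
  also have "\<dots> = (\<integral>y. u y * ?I y - c * ?I y \<partial>lebesgue)"
    using int m by (subst Bochner_Integration.integral_diff) auto
  also have "\<dots> = (\<integral>y. (u y * ?I y - c * ?I y) * ?I y \<partial>lebesgue)"
    by (simp add: left_diff_distrib mult.assoc i2)
  finally have "((avg l u z - c) * l ^ DIM('a))\<^sup>2 \<le> nrm2 (\<lambda>y. u y * ?I y - c * ?I y) * l ^ DIM('a)"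
    using sq_Cauchy_Schwarz[OF v ind(1)] ind(2) by simp
  then have "(avg l u z - c)\<^sup>2 \<le> (1 / l ^ DIM('a)) * nrm2 (\<lambda>y. u y * ?I y - c * ?I y)"
    using l by (simp add: power_mult_distrib divide_simps power2_eq_square mult_ac)
  then have "ennreal ((avg l u z - c)\<^sup>2) \<le> ennreal (1 / l ^ DIM('a)) * ennreal (nrm2 (\<lambda>y. u y * ?I y - c * ?I y))"
    using l by (subst ennreal_mult[symmetric]) (auto simp: sqnorm_nonneg intro: ennreal_leI)
  also have "ennreal (nrm2 (\<lambda>y. u y * ?I y - c * ?I y)) = (\<integral>\<^sup>+y. ennreal ((u y - c)\<^sup>2) * indicator (cell l z) y \<partial>lebesgue)"
    unfolding ennreal_sqnorm[OF v] by (intro nn_integral_cong) (auto simp: indicator_def)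
  finally show ?thesis by (simp add: power2_commute)
qed

lemma avg_measurable:
  fixes u :: "'a::euclidean_space \<Rightarrow> real"
  assumes [measurable]: "u \<in> borel_measurable borel" "r \<in> borel_measurable borel"
  shows "(\<lambda>x. avg l u (r x)) \<in> borel_measurable borel"
proof -
  have *: "(\<integral>y. u y * indicator (cell l z) y \<partial>lebesgue)
      = (\<integral>y. u y * (if \<forall>i\<in>Basis. z \<bullet> i \<le> y \<bullet> i \<and> y \<bullet> i \<le> z \<bullet> i + l then 1 else 0) \<partial>lborel)" for z
  proof -
    have "(\<integral>y. u y * indicator (cell l z) y \<partial>lebesgue) = (\<integral>y. u y * indicator (cell l z) y \<partial>lborel)"
      by (rule integral_completion) simp
    also have "\<dots> = (\<integral>y. u y * (if \<forall>i\<in>Basis. z \<bullet> i \<le> y \<bullet> i \<and> y \<bullet> i \<le> z \<bullet> i + l then 1 else 0) \<partial>lborel)"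
      by (intro Bochner_Integration.integral_cong refl) (auto simp: indicator_def mem_box inner_add_left)
    finally show ?thesis .
  qed
  show ?thesis unfolding avg_def * by measurable
qed

lemma nn_integral_lborel_translate:
  fixes f :: "'a::euclidean_space \<Rightarrow> ennreal"
  assumes [measurable]: "f \<in> borel_measurable borel"
  shows "(\<integral>\<^sup>+x. f (c + x) \<partial>lborel) = (\<integral>\<^sup>+x. f x \<partial>lborel)"
proof -
  have "(\<integral>\<^sup>+x. f x \<partial>lborel) = (\<integral>\<^sup>+x. f x \<partial>distr lborel borel ((+) c))" by (simp only: lborel_distr_plus)
  also have "\<dots> = (\<integral>\<^sup>+x. f (c + x) \<partial>lborel)" by (rule nn_integral_distr) auto
  finally show ?thesis ..
qed

lemma norm_le_cube:
  fixes h :: "'a::euclidean_space"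
  assumes "h \<in> cbox (- (l *\<^sub>R One)) (l *\<^sub>R One)"
  shows "norm h \<le> real DIM('a) * l"
proof -
  have "norm h \<le> (\<Sum>b\<in>Basis. \<bar>h \<bullet> b\<bar>)" by (rule norm_le_l1)
  also have "\<dots> \<le> (\<Sum>b\<in>(Basis::'a set). l)"
    using assms by (intro sum_mono) (auto simp: mem_box abs_le_iff)
  finally show ?thesis by simp
qed

text \<open>The power of 2 is the volume ratio of a cube of side 2 l to a cell of side l. The square
  comes from the translation estimate, since vectors in the cube \<open>C\<close> have norm at most
  d l.\<close>

definition poincare :: "'a::euclidean_space itself \<Rightarrow> real" where
  "poincare _ = 2 ^ DIM('a) * (real DIM('a))\<^sup>2"

text \<open>If y lies in the cell assigned to x, then y - x lies in \<open>C\<close>, which does not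
  depend on x. Enlarging the cell accordingly removes r; after substituting h = y - x and exchanging
  the integrals, each h is handled by the translation estimate.\<close>

lemma averaging_borel:
  fixes u :: "'a::euclidean_space \<Rightarrow> real"
  assumes ub: "u \<in> borel_measurable borel" and u: "L2 u"
    and w: "weak_grad u g" and g: "L2 g" and l: "0 < l"
    and rb: "r \<in> borel_measurable borel" and r: "\<And>x. x \<in> cell l (r x)"
  shows "L2 (\<lambda>x. u x - avg l u (r x))"
    and "nrm2 (\<lambda>x. u x - avg l u (r x)) \<le> poincare TYPE('a) * l\<^sup>2 * nrm2 g"
proof -
  note [measurable] = ub rb
  define C where "C = cbox (- (l *\<^sub>R One)) (l *\<^sub>R (One::'a))"
  have [measurable]: "C \<in> sets borel" by (simp add: C_def)
  let ?a = "ennreal (1 / l ^ DIM('a))" and ?G = "nrm2 g"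
  have cellC: "y - x \<in> C" if "y \<in> cell l (r x)" for x y
    unfolding C_def mem_box
  proof
    fix i :: 'a assume i: "i \<in> Basis"
    show "- (l *\<^sub>R One) \<bullet> i \<le> (y - x) \<bullet> i \<and> (y - x) \<bullet> i \<le> (l *\<^sub>R One) \<bullet> i"
      using that r[of x] i by (fastforce simp: mem_box inner_add_left inner_diff_left)
  qed
  have eC: "emeasure lborel C = ennreal ((2 * l) ^ DIM('a))"
  proof -
    have "- (l *\<^sub>R One) + (2 * l) *\<^sub>R One = l *\<^sub>R (One::'a)"
      by (simp only: mult_2 scaleR_add_left) simp
    then have "C = cell (2 * l) (- (l *\<^sub>R One))" by (simp only: C_def)
    then show ?thesis using l by (simp only: emeasure_cell)
  qed
  have "(\<integral>\<^sup>+x. ennreal ((norm (u x - avg l u (r x)))\<^sup>2) \<partial>lborel)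
      \<le> (\<integral>\<^sup>+x. ?a * (\<integral>\<^sup>+y. ennreal ((u y - u x)\<^sup>2) * indicator C (y - x) \<partial>lborel) \<partial>lborel)"
  proof (rule nn_integral_mono)
    fix x :: 'a
    have "ennreal ((norm (u x - avg l u (r x)))\<^sup>2)
        \<le> ?a * (\<integral>\<^sup>+y. ennreal ((u y - u x)\<^sup>2) * indicator (cell l (r x)) y \<partial>lborel)"
      using avg_deviation[OF u l, of "u x" "r x"] by (simp add: nn_integral_completion)
    also have "\<dots> \<le> ?a * (\<integral>\<^sup>+y. ennreal ((u y - u x)\<^sup>2) * indicator C (y - x) \<partial>lborel)"
      using cellC by (intro mult_left_mono nn_integral_mono) (auto simp: indicator_def)
    finally show "ennreal ((norm (u x - avg l u (r x)))\<^sup>2)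
        \<le> ?a * (\<integral>\<^sup>+y. ennreal ((u y - u x)\<^sup>2) * indicator C (y - x) \<partial>lborel)" .
  qed
  also have "\<dots> = (\<integral>\<^sup>+x. ?a * (\<integral>\<^sup>+h. ennreal ((u (h + x) - u x)\<^sup>2) * indicator C h \<partial>lborel) \<partial>lborel)"
  proof (rule nn_integral_cong, rule arg_cong[where f = "\<lambda>t. ?a * t"])
    fix x :: 'a
    show "(\<integral>\<^sup>+y. ennreal ((u y - u x)\<^sup>2) * indicator C (y - x) \<partial>lborel)
        = (\<integral>\<^sup>+h. ennreal ((u (h + x) - u x)\<^sup>2) * indicator C h \<partial>lborel)"
      by (subst nn_integral_lborel_translate[of _ x, symmetric]) (auto simp: add.commute)
  qed
  also have "\<dots> = ?a * (\<integral>\<^sup>+x. (\<integral>\<^sup>+h. ennreal ((u (h + x) - u x)\<^sup>2) * indicator C h \<partial>lborel) \<partial>lborel)"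
    by (rule nn_integral_cmult) measurable
  also have "(\<integral>\<^sup>+x. (\<integral>\<^sup>+h. ennreal ((u (h + x) - u x)\<^sup>2) * indicator C h \<partial>lborel) \<partial>lborel)
      = (\<integral>\<^sup>+h. (\<integral>\<^sup>+x. ennreal ((u (h + x) - u x)\<^sup>2) * indicator C h \<partial>lborel) \<partial>lborel)"
    by (rule lborel_pair.Fubini') measurable
  also have "\<dots> \<le> (\<integral>\<^sup>+h. ennreal ((real DIM('a) * l)\<^sup>2 * ?G) * indicator C h \<partial>lborel)"
  proof (rule nn_integral_mono)
    fix h :: 'a
    have si: "L2 (\<lambda>x. u (h + x) - u x)"
      using sqnorm_translate(2)[OF ub, of h] u by (intro sq_int_diff) auto
    show "(\<integral>\<^sup>+x. ennreal ((u (h + x) - u x)\<^sup>2) * indicator C h \<partial>lborel)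
        \<le> ennreal ((real DIM('a) * l)\<^sup>2 * ?G) * indicator C h"
    proof (cases "h \<in> C")
      case True
      have "(\<integral>\<^sup>+x. ennreal ((u (h + x) - u x)\<^sup>2) \<partial>lborel) = ennreal (nrm2 (\<lambda>x. u (h + x) - u x))"
        unfolding ennreal_sqnorm[OF si] by (simp add: nn_integral_completion)
      also have "\<dots> \<le> ennreal ((norm h)\<^sup>2 * ?G)"
        by (intro ennreal_leI translation_estimate[OF ub u w g])
      also have "\<dots> \<le> ennreal ((real DIM('a) * l)\<^sup>2 * ?G)"
        using norm_le_cube[of h l] True by (intro ennreal_leI mult_right_mono power_mono) (auto simp: C_def sqnorm_nonneg)
      finally show ?thesis using True by simp
    qed simp
  qed
  also have "\<dots> = ennreal ((real DIM('a) * l)\<^sup>2 * ?G) * ennreal ((2 * l) ^ DIM('a))"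
    by (simp add: nn_integral_cmult_indicator eC)
  finally have "(\<integral>\<^sup>+x. ennreal ((norm (u x - avg l u (r x)))\<^sup>2) \<partial>lborel)
      \<le> ?a * (ennreal ((real DIM('a) * l)\<^sup>2 * ?G) * ennreal ((2 * l) ^ DIM('a)))"
    by (simp add: mult_left_mono)
  also have "\<dots> = ennreal ((1 / l ^ DIM('a)) * ((real DIM('a) * l)\<^sup>2 * ?G * (2 * l) ^ DIM('a)))"
    by (subst ennreal_mult[symmetric], use l sqnorm_nonneg[of lebesgue g] in simp_all)+
  also have "(1 / l ^ DIM('a)) * ((real DIM('a) * l)\<^sup>2 * ?G * (2 * l) ^ DIM('a)) = poincare TYPE('a) * l\<^sup>2 * ?G"
    using l by (simp add: poincare_def power_mult_distrib field_simps)
  finally have le: "(\<integral>\<^sup>+x. ennreal ((norm (u x - avg l u (r x)))\<^sup>2) \<partial>lebesgue) \<le> ennreal (poincare TYPE('a) * l\<^sup>2 * ?G)"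
    by (simp add: nn_integral_completion)
  have m: "lmeas (\<lambda>x. u x - avg l u (r x))"
    using avg_measurable[OF ub rb, of l] ub by (intro borel_measurable_lebesgueI) simp
  have "(\<integral>\<^sup>+x. ennreal ((norm (u x - avg l u (r x)))\<^sup>2) \<partial>lebesgue) < \<infinity>"
    using le by (metis ennreal_less_top infinity_ennreal_def le_less_trans)
  then show s: "L2 (\<lambda>x. u x - avg l u (r x))"
    using m by (simp add: sq_int_def integrable_iff_bounded)
  have "0 \<le> poincare TYPE('a) * l\<^sup>2 * ?G"
    by (simp add: poincare_def sqnorm_nonneg)
  then show "nrm2 (\<lambda>x. u x - avg l u (r x)) \<le> poincare TYPE('a) * l\<^sup>2 * nrm2 g"
    using le unfolding ennreal_sqnorm[OF s, symmetric] by (simp only: ennreal_le_iff)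
qed

theorem averaging_estimate:
  fixes u :: "'a::euclidean_space \<Rightarrow> real"
  assumes u: "H1 u" and l: "0 < l"
    and rb: "r \<in> borel_measurable borel" and r: "\<And>x. x \<in> cell l (r x)"
  shows "L2 (\<lambda>x. u x - avg l u (r x))"
    and "nrm2 (\<lambda>x. u x - avg l u (r x)) \<le> poincare TYPE('a) * l\<^sup>2 * nrm2 (grad u)"
proof -
  have usi: "L2 u" by (rule H1_sq_int[OF u])
  \<comment> \<open>Translations and the exchange of integrals are available for Borel functions.
    The representative has the same averages, and \<open>grad u\<close> is a weak gradient of
    it.\<close>
  obtain v where v: "v \<in> borel_measurable lborel" "AE x in lborel. u x = v x"
    using completion_ex_borel_measurable_real[OF sq_int_meas[OF usi]] by blast
  have ae: "AE x in lebesgue. u x = v x" using v(2) by (rule AE_completion)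
  have vm: "lmeas v" using v(1) by (rule measurable_completion)
  have vsi: "L2 v"
    by (rule sqnorm_mono_AE(1)[OF usi vm]) (use ae in \<open>auto elim!: eventually_mono\<close>)
  have vw: "weak_grad v (grad u)"
    by (rule weak_grad_cong_AE[OF grad_works(1)[OF u] ae vsi grad_works(2)[OF u]])
  have vb: "v \<in> borel_measurable borel" using v(1) by simp
  note * = averaging_borel[OF vb vsi vw grad_works(2)[OF u] l rb r]
  have avg_eq: "avg l u z = avg l v z" for z
    unfolding avg_def
    by (intro arg_cong2[where f = "(/)"] refl integral_cong_AE borel_measurable_times sq_int_meas[OF usi] vm
        sq_int_meas[OF cell_indicator(1)]) (use l ae in \<open>auto elim!: eventually_mono\<close>)
  have ae2: "AE x in lebesgue. u x - avg l u (r x) = v x - avg l v (r x)"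
    using ae by eventually_elim (simp add: avg_eq)
  have m: "lmeas (\<lambda>x. u x - avg l u (r x))"
    unfolding avg_eq using avg_measurable[OF vb rb, of l]
    by (intro borel_measurable_diff sq_int_meas[OF usi] borel_measurable_lebesgueI)
  have "AE x in lebesgue. norm (u x - avg l u (r x)) \<le> norm (v x - avg l v (r x))"
    using ae2 by eventually_elim simp
  from sqnorm_mono_AE[OF *(1) m this] *(2)
  show "L2 (\<lambda>x. u x - avg l u (r x))"
    "nrm2 (\<lambda>x. u x - avg l u (r x)) \<le> poincare TYPE('a) * l\<^sup>2 * nrm2 (grad u)"
    by auto
qed

definition grid :: "real \<Rightarrow> 'a::euclidean_space \<Rightarrow> 'a" where
  "grid l x = (\<Sum>b\<in>Basis. (l * of_int \<lfloor>(x \<bullet> b) / l\<rfloor>) *\<^sub>R b)"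

lemma grid_measurable: "grid l \<in> borel_measurable borel"
  unfolding grid_def[abs_def] by measurable

lemma grid_cell:
  assumes l: "0 < l" shows "x \<in> cell l (grid l x)"
  unfolding mem_box
proof
  fix i :: 'a assume i: "i \<in> Basis"
  have "l * of_int \<lfloor>(x \<bullet> i) / l\<rfloor> \<le> l * ((x \<bullet> i) / l)" using l by (intro mult_left_mono) auto
  moreover have "l * ((x \<bullet> i) / l) \<le> l * (of_int \<lfloor>(x \<bullet> i) / l\<rfloor> + 1)"
    using l by (intro mult_left_mono) linarith+
  ultimately show "grid l x \<bullet> i \<le> x \<bullet> i \<and> x \<bullet> i \<le> (grid l x + l *\<^sub>R One) \<bullet> i"
    using l i by (simp add: grid_def inner_add_left algebra_simps)
qed

lemma countable_range_grid: "countable (range (grid l :: 'a::euclidean_space \<Rightarrow> 'a))"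
proof (rule countable_subset)
  show "range (grid l :: 'a \<Rightarrow> 'a) \<subseteq> (\<lambda>f. \<Sum>b\<in>Basis. (l * of_int (f b)) *\<^sub>R b) ` (Pi\<^sub>E Basis (\<lambda>_. UNIV :: int set))"
  proof (rule image_subsetI)
    fix x :: 'a
    show "grid l x \<in> (\<lambda>f. \<Sum>b\<in>Basis. (l * of_int (f b)) *\<^sub>R b) ` (Pi\<^sub>E Basis (\<lambda>_. UNIV :: int set))"
      by (rule image_eqI[of _ _ "restrict (\<lambda>b. \<lfloor>(x \<bullet> b) / l\<rfloor>) Basis"]) (auto simp: grid_def intro!: sum.cong)
  qed
  show "countable ((\<lambda>f. \<Sum>b\<in>(Basis::'a set). (l * of_int (f b)) *\<^sub>R b) ` (Pi\<^sub>E Basis (\<lambda>_. UNIV :: int set)))"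
    by (intro countable_image countable_PiE) auto
qed

subsection \<open>The Gagliardo--Nirenberg inequality\<close>

lemma poincare_pos: "0 < poincare TYPE('a::euclidean_space)"
  by (simp add: poincare_def)

abbreviation "high_part c u \<equiv> (\<lambda>x. u x * indicator {x. c < \<bar>u x\<bar>} x)"

lemma high_part_estimate:
  fixes u :: "'a::euclidean_space \<Rightarrow> real"
  assumes u: "H1 u" and M: "0 < M" "nrm2 u \<le> M" and lam: "0 < lam"
  shows "nrm2 (high_part lam u)
    \<le> 4 * poincare TYPE('a) * (4 * M / lam\<^sup>2) powr (2 / real DIM('a)) * nrm2 (grad u)"
proof -
  let ?d = "real DIM('a)"
  have usi: "L2 u" by (rule H1_sq_int[OF u])
  have um: "lmeas u" by (rule sq_int_meas[OF usi])
  \<comment> \<open>Chosen so that l^d = 4 M / lam^2: averages are then at most lam / 2, and |u| >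
    lam forces |u| <= 2 |u - avg|.\<close>
  define l where "l = (4 * M / lam\<^sup>2) powr (1 / ?d)"
  have l: "0 < l" using M lam by (simp add: l_def)
  have ld: "l ^ DIM('a) = 4 * M / lam\<^sup>2"
  proof -
    have "l ^ DIM('a) = l powr ?d" by (rule powr_realpow[OF l, symmetric])
    also have "\<dots> = 4 * M / lam\<^sup>2" using M lam by (simp add: l_def powr_powr)
    finally show ?thesis .
  qed
  have l2: "l\<^sup>2 = (4 * M / lam\<^sup>2) powr (2 / ?d)"
  proof -
    have "l\<^sup>2 = l powr 2" using l by simp
    then show ?thesis by (simp add: l_def powr_powr)
  qed
  have cell: "x \<in> cell l (id x)" for x :: 'a using l by (auto simp: mem_box inner_add_left)
  have idb: "(id :: 'a \<Rightarrow> 'a) \<in> borel_measurable borel" by simp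
  note A = averaging_estimate[OF u l idb cell]
  have av: "\<bar>avg l u z\<bar> \<le> lam / 2" for z
  proof -
    have "(avg l u z)\<^sup>2 \<le> nrm2 u / l ^ DIM('a)" by (rule avg_sq_le[OF usi l])
    also have "\<dots> \<le> M / l ^ DIM('a)" using M l by (intro divide_right_mono) auto
    also have "\<dots> = (lam / 2)\<^sup>2" unfolding ld using M lam by (simp add: power_divide)
    finally show ?thesis using lam by (simp add: abs_le_square_iff[symmetric])
  qed
  have "nrm2 (high_part lam u) \<le> nrm2 (\<lambda>x. 2 *\<^sub>R (u x - avg l u (id x)))"
  proof (rule sqnorm_mono_AE(2)[OF sq_int_scaleR[OF A(1)]])
    have "{x. lam < \<bar>u x\<bar>} = {x \<in> space lebesgue. lam < \<bar>u x\<bar>}" by simp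
    also have "\<dots> \<in> sets lebesgue" using um by measurable
    finally show "lmeas (high_part lam u)"
      using um by (intro borel_measurable_times borel_measurable_indicator)
    have "\<bar>u x\<bar> \<le> 2 * \<bar>u x - avg l u x\<bar>" if "lam < \<bar>u x\<bar>" for x
    proof -
      have "U \<le> 2 * w" if "a \<le> lam / 2" "lam < U" "U - a \<le> w" for a U w :: real using that by linarith
      from this[OF av that abs_triangle_ineq2] show ?thesis .
    qed
    then show "AE x in lebesgue. norm (u x * indicator {x. lam < \<bar>u x\<bar>} x) \<le> norm (2 *\<^sub>R (u x - avg l u (id x)))"
      by (intro AE_I2) (simp add: indicator_def abs_mult del: right_diff_distrib_numeral)
  qed
  also have "\<dots> \<le> 4 * (poincare TYPE('a) * l\<^sup>2 * nrm2 (grad u))"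
    using A(2) unfolding sqnorm_scaleR by simp
  finally show ?thesis by (simp add: l2 mult_ac)
qed

text \<open>If a > lam, the term with 2^j lam < a <= 2^(j+1) lam alone dominates. The terms of
  smaller index are counted as well, an excess that the geometric decay later absorbs.\<close>

lemma dyadic_powr_bound:
  assumes s: "0 < s" and lam: "0 < lam" and a: "0 \<le> (a::real)"
  shows "ennreal (a powr s) \<le> ennreal (lam powr s) + (\<Sum>j. ennreal ((2 ^ Suc j * lam) powr s) * indicator {2 ^ j * lam<..} a)"
proof (cases "a \<le> lam")
  case True
  then have "ennreal (a powr s) \<le> ennreal (lam powr s)" using s a by (intro ennreal_leI powr_mono2) auto
  then show ?thesis by (rule order_trans) (simp add: add_increasing2)
next
  case False
  define n where "n = (LEAST n. a \<le> 2 ^ n * lam)"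
  obtain k where "a / lam < 2 ^ k" using real_arch_pow[of 2 "a / lam"] by auto
  then have "a \<le> 2 ^ k * lam" using lam by (simp add: field_simps)
  then have n: "a \<le> 2 ^ n * lam" unfolding n_def by (rule LeastI)
  then have "n \<noteq> 0" using False by (intro notI) simp
  then obtain j where j: "n = Suc j" by (cases n) auto
  then have "2 ^ j * lam < a" using not_less_Least[of j "\<lambda>n. a \<le> 2 ^ n * lam"] by (simp add: n_def)
  then have "ennreal (a powr s) \<le> ennreal ((2 ^ Suc j * lam) powr s) * indicator {2 ^ j * lam<..} a"
    using n j s a by (simp add: ennreal_leI powr_mono2)
  also have "\<dots> = (\<Sum>j\<in>{j}. ennreal ((2 ^ Suc j * lam) powr s) * indicator {2 ^ j * lam<..} a)"
    by (simp only: sum.insert finite.emptyI empty_iff not_False_eq_True sum.empty add_0_right)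
  also have "\<dots> \<le> (\<Sum>j. ennreal ((2 ^ Suc j * lam) powr s) * indicator {2 ^ j * lam<..} a)"
    by (rule sum_le_suminf) auto
  finally show ?thesis by (rule order_trans) (simp add: add_increasing)
qed

text \<open>Write |u|^q = |u|^s u^2 with s = q - 2. The part below lam gives C = lam^s; level j
  above it contributes at most D lam^t b^j times the Dirichlet energy, where t = s - 4/d < 0 and b =
  2^t < 1. The additive form, for bounded mass and with arbitrarily small e, is the one that can be
  absorbed into the energy.\<close>

theorem gagliardo_nirenberg:
  fixes q M e :: real
  assumes q: "2 < q" "q < 2 + 4 / real DIM('a::euclidean_space)" and M: "0 < M" and e: "0 < e"
  shows "\<exists>C\<ge>0. \<forall>u :: 'a \<Rightarrow> real. H1 u \<and> nrm2 u \<le> M \<longrightarrow>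
    integrable lebesgue (\<lambda>x. \<bar>u x\<bar> powr q) \<and>
    (\<integral>x. \<bar>u x\<bar> powr q \<partial>lebesgue) \<le> e * nrm2 (grad u) + C * nrm2 u"
proof -
  let ?d = "real DIM('a)"
  define s where "s = q - 2"
  define t where "t = s - 4 / ?d"
  have s: "0 < s" and t: "t < 0" using q by (auto simp: s_def t_def)
  define b where "b = 2 powr t"
  have b: "0 < b" "b < 1" using t by (auto simp: b_def powr_less_one)
  define D where "D = 2 powr s * (4 * poincare TYPE('a) * (4 * M) powr (2 / ?d))"
  have D: "0 < D" using M poincare_pos[where 'a = 'a] by (simp add: D_def)
  \<comment> \<open>Solves D lam^t / (1 - b) = e, so that the geometric series sums exactly to
    e.\<close>
  define lam where "lam = (e * (1 - b) / D) powr (1 / t)"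
  have lam: "0 < lam" using e b D by (simp add: lam_def)
  have lamt: "lam powr t = e * (1 - b) / D" using t e b D by (simp add: lam_def powr_powr)
  have geom: "(2 ^ Suc j * lam) powr s * (4 * poincare TYPE('a) * (4 * M / (2 ^ j * lam)\<^sup>2) powr (2 / ?d))
      = D * lam powr t * b ^ j" for j
  proof -
    have p: "0 < 2 ^ j * lam" using lam by simp
    have e1: "(4 * M / (2 ^ j * lam)\<^sup>2) powr (2 / ?d) = (4 * M) powr (2 / ?d) / (2 ^ j * lam) powr (4 / ?d)"
    proof -
      have "(2 ^ j * lam)\<^sup>2 = (2 ^ j * lam) powr 2" using p by simp
      then show ?thesis using M p by (simp only: powr_divide powr_powr) simp
    qed
    have e2: "(2 ^ Suc j * lam) powr s = 2 powr s * (2 ^ j * lam) powr s"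
      using lam by (simp add: powr_mult mult.assoc)
    have e3: "(2 ^ j * lam) powr s / (2 ^ j * lam) powr (4 / ?d) = (2 ^ j * lam) powr t"
      by (simp add: t_def powr_diff)
    have e4: "(2 ^ j * lam) powr t = lam powr t * b ^ j"
    proof -
      have "(2 ^ j) powr t = (2 powr real j) powr t" by (simp add: powr_realpow)
      also have "\<dots> = (2 powr t) powr real j" by (simp add: powr_powr mult.commute)
      also have "\<dots> = b ^ j" using b by (simp add: powr_realpow b_def[symmetric])
      finally show ?thesis using lam by (simp add: powr_mult mult.commute)
    qed
    have "(2 ^ Suc j * lam) powr s * (4 * poincare TYPE('a) * (4 * M / (2 ^ j * lam)\<^sup>2) powr (2 / ?d))
        = D * ((2 ^ j * lam) powr s / (2 ^ j * lam) powr (4 / ?d))"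
      unfolding e1 e2 D_def by (simp only: times_divide_eq_right mult_ac)
    then show ?thesis by (simp only: e3 e4 mult.assoc)
  qed
  have sumb: "(\<Sum>j. ennreal (D * lam powr t * b ^ j)) = ennreal e"
  proof -
    have "(\<lambda>j. D * lam powr t * b ^ j) sums (D * lam powr t * (1 / (1 - b)))"
      using b by (intro sums_mult geometric_sums) auto
    moreover have "D * lam powr t * (1 / (1 - b)) = e" using lamt D b by simp
    ultimately have "(\<lambda>j. D * lam powr t * b ^ j) sums e" by simp
    then show ?thesis
      using D b e by (subst suminf_ennreal_eq[of _ e]) auto
  qed
  show ?thesis
  proof (intro exI[of _ "lam powr s"] conjI allI impI)
    fix u :: "'a \<Rightarrow> real" assume "H1 u \<and> nrm2 u \<le> M"
    then have u: "H1 u" and uM: "nrm2 u \<le> M" by auto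
    have usi: "L2 u" by (rule H1_sq_int[OF u])
    have um[measurable]: "lmeas u" by (rule sq_int_meas[OF usi])
    let ?G = "nrm2 (grad u)"
    have pw: "\<bar>u x\<bar> powr q = \<bar>u x\<bar> powr s * (u x)\<^sup>2" for x
    proof (cases "u x = 0")
      case False
      then have "\<bar>u x\<bar> powr q = \<bar>u x\<bar> powr s * \<bar>u x\<bar> powr 2" unfolding powr_add[symmetric] by (simp add: s_def)
      then show ?thesis by simp
    qed simp
    have ind: "L2 (high_part c u)" for c
    proof (rule sq_int_mult_indicator[OF usi])
      have "{x. c < \<bar>u x\<bar>} = {x \<in> space lebesgue. c < \<bar>u x\<bar>}" by simp
      also have "\<dots> \<in> sets lebesgue" by measurable
      finally show "{x. c < \<bar>u x\<bar>} \<in> sets lebesgue" .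
    qed
    have "(\<integral>\<^sup>+x. ennreal (\<bar>u x\<bar> powr q) \<partial>lebesgue)
        \<le> (\<integral>\<^sup>+x. ennreal (lam powr s) * ennreal ((norm (u x))\<^sup>2)
            + (\<Sum>j. ennreal ((2 ^ Suc j * lam) powr s) * ennreal ((norm (high_part (2 ^ j * lam) u x))\<^sup>2)) \<partial>lebesgue)"
    proof (rule nn_integral_mono)
      fix x
      have "ennreal (\<bar>u x\<bar> powr q) = ennreal (\<bar>u x\<bar> powr s) * ennreal ((u x)\<^sup>2)"
        unfolding pw by (rule ennreal_mult) auto
      also have "\<dots> \<le> (ennreal (lam powr s) + (\<Sum>j. ennreal ((2 ^ Suc j * lam) powr s) * indicator {2 ^ j * lam<..} \<bar>u x\<bar>)) * ennreal ((u x)\<^sup>2)"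
        by (intro mult_right_mono dyadic_powr_bound s lam) auto
      also have "\<dots> = ennreal (lam powr s) * ennreal ((norm (u x))\<^sup>2)
            + (\<Sum>j. ennreal ((2 ^ Suc j * lam) powr s) * ennreal ((norm (high_part (2 ^ j * lam) u x))\<^sup>2))"
        unfolding distrib_right ennreal_suminf_multc[symmetric]
        by (intro arg_cong2[where f = "(+)"] suminf_cong) (auto simp: indicator_def)
      finally show "ennreal (\<bar>u x\<bar> powr q) \<le> \<dots>" .
    qed
    also have "\<dots> = ennreal (lam powr s) * (\<integral>\<^sup>+x. ennreal ((norm (u x))\<^sup>2) \<partial>lebesgue)
        + (\<Sum>j. ennreal ((2 ^ Suc j * lam) powr s) * (\<integral>\<^sup>+x. ennreal ((norm (high_part (2 ^ j * lam) u x))\<^sup>2) \<partial>lebesgue))"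
      using sq_int_meas[OF ind]
      by (subst nn_integral_add) (auto simp: nn_integral_cmult nn_integral_suminf)
    also have "\<dots> = ennreal (lam powr s) * ennreal (nrm2 u)
        + (\<Sum>j. ennreal ((2 ^ Suc j * lam) powr s) * ennreal (nrm2 (high_part (2 ^ j * lam) u)))"
      by (simp only: ennreal_sqnorm[OF usi] ennreal_sqnorm[OF ind])
    also have "\<dots> \<le> ennreal (lam powr s) * ennreal (nrm2 u) + (\<Sum>j. ennreal (D * lam powr t * b ^ j) * ennreal ?G)"
    proof (intro add_left_mono suminf_le)
      fix j
      have "ennreal ((2 ^ Suc j * lam) powr s) * ennreal (nrm2 (high_part (2 ^ j * lam) u))
          \<le> ennreal ((2 ^ Suc j * lam) powr s) * ennreal (4 * poincare TYPE('a) * (4 * M / (2 ^ j * lam)\<^sup>2) powr (2 / ?d) * ?G)"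
        using lam by (intro mult_left_mono ennreal_leI high_part_estimate u M uM) auto
      also have "\<dots> = ennreal ((2 ^ Suc j * lam) powr s * (4 * poincare TYPE('a) * (4 * M / (2 ^ j * lam)\<^sup>2) powr (2 / ?d)) * ?G)"
        using poincare_pos[where 'a = 'a] by (subst ennreal_mult[symmetric]) (auto simp: sqnorm_nonneg mult.assoc)
      also have "\<dots> = ennreal (D * lam powr t * b ^ j) * ennreal ?G"
        unfolding geom using D b by (intro ennreal_mult) (auto simp: sqnorm_nonneg)
      finally show "ennreal ((2 ^ Suc j * lam) powr s) * ennreal (nrm2 (high_part (2 ^ j * lam) u)) \<le> \<dots>" .
    qed auto
    also have "\<dots> = ennreal (lam powr s) * ennreal (nrm2 u) + ennreal e * ennreal ?G"
      by (simp only: ennreal_suminf_multc sumb)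
    also have "\<dots> = ennreal (e * ?G + lam powr s * nrm2 u)"
      using e by (simp add: ennreal_mult ennreal_plus sqnorm_nonneg add.commute)
    finally have le: "(\<integral>\<^sup>+x. ennreal (\<bar>u x\<bar> powr q) \<partial>lebesgue) \<le> ennreal (e * ?G + lam powr s * nrm2 u)" .
    then have "(\<integral>\<^sup>+x. ennreal (norm (\<bar>u x\<bar> powr q)) \<partial>lebesgue) < \<infinity>"
      using le_less_trans[OF le ennreal_less_top] by simp
    then show int: "integrable lebesgue (\<lambda>x. \<bar>u x\<bar> powr q)"
      by (intro integrableI_bounded) auto
    have "ennreal (\<integral>x. \<bar>u x\<bar> powr q \<partial>lebesgue) = (\<integral>\<^sup>+x. ennreal (\<bar>u x\<bar> powr q) \<partial>lebesgue)"
      using int by (subst nn_integral_eq_integral) auto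
    with le have "ennreal (\<integral>x. \<bar>u x\<bar> powr q \<partial>lebesgue) \<le> ennreal (e * ?G + lam powr s * nrm2 u)" by simp
    then show "(\<integral>x. \<bar>u x\<bar> powr q \<partial>lebesgue) \<le> e * ?G + lam powr s * nrm2 u"
      using e by (subst (asm) ennreal_le_iff) (auto simp: sqnorm_nonneg)
  qed simp
qed

subsection \<open>Compactness and lower semicontinuity\<close>

text \<open>A diagonal subsequence makes the grid averages of every mesh l j converge. For a fine
  mesh they approximate all U n uniformly, by the gradient bound. Inside a ball their convergence is
  dominated, as they are bounded; outside it the tail hypothesis applies. Hence the subsequence is
  Cauchy.\<close>

theorem rellich:
  fixes U :: "nat \<Rightarrow> 'a::euclidean_space \<Rightarrow> real"
  assumes U: "\<And>n. H1 (U n)" and M: "\<And>n. nrm2 (U n) \<le> M"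
    and K: "\<And>n. nrm2 (grad (U n)) \<le> K"
    and tail: "\<And>e. 0 < e \<Longrightarrow> \<exists>R. \<forall>n. nrm2 (\<lambda>x. U n x * indicator (- cball 0 R) x) \<le> e"
  shows "\<exists>k u. strict_mono k \<and> L2 u \<and> (\<lambda>n. nrm2 (\<lambda>x. U (k n) x - u x)) \<longlonglongrightarrow> 0"
proof -
  have Us: "L2 (U n)" for n by (rule H1_sq_int[OF U])
  have M0: "0 \<le> M" using M[of 0] sqnorm_nonneg[of lebesgue "U 0"] by linarith
  define l where "l j = inverse (real (Suc j))" for j
  have l: "0 < l j" for j by (simp add: l_def)
  define S where "S = (SIGMA j:UNIV. range (grid (l j) :: 'a \<Rightarrow> 'a))"
  have cS: "countable S" unfolding S_def by (intro countable_SIGMA countable_range_grid) auto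
  \<comment> \<open>The factor sqrt (l^d) brings the averages of all meshes under the common bound
    sqrt M that the diagonal argument requires.\<close>
  define f where "f n p = (case p of (j, z) \<Rightarrow> avg (l j) (U n) z * sqrt (l j ^ DIM('a)))" for n p
  have "norm (f n p) \<le> sqrt M" if "p \<in> S" for n p
  proof -
    obtain j z where p: "p = (j, z)" by (cases p)
    have "(avg (l j) (U n) z * sqrt (l j ^ DIM('a)))\<^sup>2 \<le> M"
    proof -
      have "(avg (l j) (U n) z)\<^sup>2 * (l j ^ DIM('a)) \<le> (nrm2 (U n) / l j ^ DIM('a)) * (l j ^ DIM('a))"
        using l[of j] by (intro mult_right_mono avg_sq_le Us) auto
      then show ?thesis using l[of j] M[of n] by (simp add: power_mult_distrib)
    qed
    then have "sqrt ((avg (l j) (U n) z * sqrt (l j ^ DIM('a)))\<^sup>2) \<le> sqrt M" by (rule real_sqrt_le_mono)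
    then show ?thesis by (simp only: p f_def prod.case real_norm_def real_sqrt_abs)
  qed
  then obtain k where k: "strict_mono (k::nat\<Rightarrow>nat)" and conv: "\<And>p. p \<in> S \<Longrightarrow> \<exists>L. (\<lambda>n. f (k n) p) \<longlonglongrightarrow> L"
    using function_convergent_subsequence[OF cS, of f "sqrt M"] by metis
  define P where "P j n x = avg (l j) (U (k n)) (grid (l j) x)" for j n x
  have Pconv: "convergent (\<lambda>n. P j n x)" for j x
  proof -
    have "(j, grid (l j) x) \<in> S" by (auto simp: S_def)
    from conv[OF this] obtain L where L: "(\<lambda>n. P j n x * sqrt (l j ^ DIM('a))) \<longlonglongrightarrow> L" by (auto simp: f_def P_def)
    have "(\<lambda>n. P j n x * sqrt (l j ^ DIM('a)) / sqrt (l j ^ DIM('a))) \<longlonglongrightarrow> L / sqrt (l j ^ DIM('a))"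
      using l[of j] by (intro tendsto_divide L tendsto_const) auto
    then show ?thesis using l[of j] by (auto simp: convergent_def)
  qed
  note avg_est = averaging_estimate[OF U l grid_measurable grid_cell[OF l]]
  have "\<exists>N. \<forall>m\<ge>N. \<forall>n\<ge>N. nrm2 (\<lambda>x. U (k m) x - U (k n) x) < e" if e: "0 < e" for e
  proof -
    \<comment> \<open>Three errors of e/100 enter with factors 4, 4 and 2, giving 10 e/100; the
      difference of two such approximations then costs 40 e/100 < e.\<close>
    obtain R where R: "\<And>n. nrm2 (\<lambda>x. U n x * indicator (- cball 0 R) x) \<le> e / 100"
      using tail[of "e / 100"] e by auto
    let ?I = "indicator (cball 0 R) :: 'a \<Rightarrow> real"
    have K0: "0 \<le> K" using K[of 0] sqnorm_nonneg[of lebesgue "grad (U 0)"] by linarith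
    have "(\<lambda>j. poincare TYPE('a) * (l j)\<^sup>2 * K) \<longlonglongrightarrow> poincare TYPE('a) * 0\<^sup>2 * K"
      unfolding l_def by (intro tendsto_intros LIMSEQ_inverse_real_of_nat)
    then have "\<forall>\<^sub>F j in sequentially. poincare TYPE('a) * (l j)\<^sup>2 * K < e / 100"
      using e by (intro order_tendstoD(2)) auto
    then obtain j where j: "poincare TYPE('a) * (l j)\<^sup>2 * K < e / 100" by (auto simp: eventually_sequentially)
    have dev: "nrm2 (\<lambda>x. U (k n) x - P j n x) \<le> e / 100" for n
    proof -
      have "nrm2 (\<lambda>x. U (k n) x - P j n x) \<le> poincare TYPE('a) * (l j)\<^sup>2 * nrm2 (grad (U (k n)))"
        unfolding P_def by (rule avg_est(2))
      also have "\<dots> \<le> poincare TYPE('a) * (l j)\<^sup>2 * K"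
        using poincare_pos[where 'a = 'a] by (intro mult_left_mono K) auto
      finally show ?thesis using j by simp
    qed
    have devs: "L2 (\<lambda>x. U (k n) x - P j n x)" for n
      unfolding P_def by (rule avg_est(1))
    have Ps: "L2 (P j n)" for n
      using sq_int_diff[OF Us[of "k n"] devs[of n]] by simp
    define L where "L x = lim (\<lambda>n. P j n x)" for x
    have PL: "(\<lambda>n. P j n x) \<longlonglongrightarrow> L x" for x using Pconv[of j x] by (simp add: L_def convergent_LIMSEQ_iff)
    have Pm: "lmeas (P j n)" for n by (rule sq_int_meas[OF Ps])
    have Lm: "lmeas L" unfolding L_def[abs_def] by (rule borel_measurable_lim_metric[OF Pm])
    have Im: "lmeas ?I" by (intro borel_measurable_indicator sets_completionI_sets) auto
    have Pb: "\<bar>P j n x\<bar> \<le> sqrt (M / l j ^ DIM('a))" for n x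
    proof -
      have "(P j n x)\<^sup>2 \<le> nrm2 (U (k n)) / l j ^ DIM('a)" unfolding P_def by (rule avg_sq_le[OF Us l])
      also have "\<dots> \<le> M / l j ^ DIM('a)" using M l[of j] by (intro divide_right_mono) auto
      finally have "sqrt ((P j n x)\<^sup>2) \<le> sqrt (M / l j ^ DIM('a))" by (rule real_sqrt_le_mono)
      then show ?thesis by (simp only: real_sqrt_abs)
    qed
    have Isi: "L2 (\<lambda>x. sqrt (M / l j ^ DIM('a)) *\<^sub>R ?I x)"
      by (intro sq_int_scaleR sq_int_indicator)
         (use emeasure_bounded_finite[OF bounded_cball[of "0::'a" R]] in auto)
    have dom: "AE x in lebesgue. norm (P j n x * ?I x) \<le> norm (sqrt (M / l j ^ DIM('a)) *\<^sub>R ?I x)" for n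
      using Pb[of n] M0 l[of j] by (intro AE_I2) (auto simp: indicator_def)
    have ptw: "AE x in lebesgue. (\<lambda>n. P j n x * ?I x) \<longlonglongrightarrow> L x * ?I x"
      by (intro AE_I2 tendsto_mult PL tendsto_const)
    have LI: "L2 (\<lambda>x. L x * ?I x)" and
      PI: "(\<lambda>n. nrm2 (\<lambda>x. P j n x * ?I x - L x * ?I x)) \<longlonglongrightarrow> 0"
      using sq_dominated(2,3)[where F = "\<lambda>n x. P j n x * ?I x" and f = "\<lambda>x. L x * ?I x" and M = lebesgue,
          OF borel_measurable_times[OF Pm Im] borel_measurable_times[OF Lm Im] ptw Isi dom] by auto
    have PIs: "L2 (\<lambda>x. P j n x * ?I x)" for n
      by (rule sq_int_mult_indicator[OF Ps]) auto
    from order_tendstoD(2)[OF PI, of "e / 100"] e obtain N where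
      N: "\<And>n. n \<ge> N \<Longrightarrow> nrm2 (\<lambda>x. P j n x * ?I x - L x * ?I x) < e / 100"
      by (auto simp: eventually_sequentially)
    have near: "L2 (\<lambda>x. U (k n) x - L x * ?I x) \<and> nrm2 (\<lambda>x. U (k n) x - L x * ?I x) \<le> 10 * (e / 100)"
      if n: "n \<ge> N" for n
    proof
      define A where "A x = (U (k n) x - P j n x) * ?I x" for x
      define B where "B x = P j n x * ?I x - L x * ?I x" for x
      define T where "T x = U (k n) x * indicator (- cball 0 R) x" for x
      have A: "L2 A" unfolding A_def by (rule sq_int_mult_indicator[OF devs]) auto
      have B: "L2 B" unfolding B_def by (rule sq_int_diff[OF PIs LI])
      have T: "L2 T" unfolding T_def
        by (rule sq_int_mult_indicator[OF Us]) (auto intro!: sets_completionI_sets)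
      have eq: "(\<lambda>x. U (k n) x - L x * ?I x) = (\<lambda>x. (A x + B x) + T x)"
        by (auto simp: A_def B_def T_def indicator_def)
      show "L2 (\<lambda>x. U (k n) x - L x * ?I x)"
        unfolding eq by (intro sq_int_add A B T)
      have "nrm2 A \<le> nrm2 (\<lambda>x. U (k n) x - P j n x)"
        by (rule sqnorm_mono_AE(2)[OF devs sq_int_meas[OF A]]) (auto simp: A_def indicator_def)
      then have "nrm2 A \<le> e / 100" using dev[of n] by linarith
      moreover have "nrm2 B \<le> e / 100" using N[OF n] unfolding B_def by simp
      moreover have "nrm2 T \<le> e / 100" using R[of "k n"] unfolding T_def .
      moreover have "nrm2 (\<lambda>x. (A x + B x) + T x) \<le> 2 * nrm2 (\<lambda>x. A x + B x) + 2 * nrm2 T"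
        by (intro sqnorm_add_le sq_int_add A B T)
      moreover have "nrm2 (\<lambda>x. A x + B x) \<le> 2 * nrm2 A + 2 * nrm2 B"
        by (intro sqnorm_add_le A B)
      ultimately show "nrm2 (\<lambda>x. U (k n) x - L x * ?I x) \<le> 10 * (e / 100)" unfolding eq by linarith
    qed
    show ?thesis
    proof (intro exI[of _ N] allI impI)
      fix m n assume mn: "N \<le> m" "N \<le> n"
      have "nrm2 (\<lambda>x. (U (k m) x - L x * ?I x) - (U (k n) x - L x * ?I x))
          \<le> 2 * nrm2 (\<lambda>x. U (k m) x - L x * ?I x) + 2 * nrm2 (\<lambda>x. U (k n) x - L x * ?I x)"
        by (intro sqnorm_diff_le) (use near mn in auto)
      also have "\<dots> \<le> 2 * (10 * (e / 100)) + 2 * (10 * (e / 100))"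
        using near[OF mn(1)] near[OF mn(2)] by (intro add_mono mult_left_mono) auto
      also have "\<dots> < e" using e by simp
      finally show "nrm2 (\<lambda>x. U (k m) x - U (k n) x) < e" by simp
    qed
  qed
  from sq_complete[of lebesgue "\<lambda>n. U (k n)", OF Us this] k show ?thesis by auto
qed

text \<open>Near-minimizers of the Dirichlet energy in shrinking convex \<open>L\<^sup>2\<close>-balls around \<open>u\<close> have Cauchy
  gradients by the parallelogram identity; this replaces weak compactness in \<open>L\<^sup>2\<close>.\<close>

theorem gradient_lsc:
  fixes U :: "nat \<Rightarrow> 'a::euclidean_space \<Rightarrow> real"
  assumes U: "\<And>n. H1 (U n)" and u: "L2 u"
    and lim: "L2_tendsto lebesgue U u"
    and K: "\<forall>\<^sub>F n in sequentially. nrm2 (grad (U n)) \<le> K"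
  shows "H1 u" "nrm2 (grad u) \<le> K"
proof -
  define r where "r n = inverse (real (Suc n))" for n
  have r0: "0 < r n" for n by (simp add: r_def)
  have rlim: "r \<longlonglongrightarrow> 0" unfolding r_def[abs_def] by (rule LIMSEQ_inverse_real_of_nat)
  have rmono: "r m \<le> r n" if "n \<le> m" for n m using that by (simp add: r_def)
  \<comment> \<open>\<open>r n\<close> bounds the squared distance to u. As these sets shrink, the
    infima d n of the Dirichlet energy increase, and they stay below K.\<close>
  define C where "C n = {v. H1 v \<and> nrm2 (\<lambda>x. v x - u x) \<le> r n}" for n
  define d where "d n = Inf ((\<lambda>v. nrm2 (grad v)) ` C n)" for n
  have bdd: "bdd_below ((\<lambda>v. nrm2 (grad v)) ` C n)" for n
    by (rule bdd_belowI2[of _ 0]) (rule sqnorm_nonneg)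
  have "\<exists>v\<in>C n. nrm2 (grad v) \<le> K" for n
  proof -
    have "\<forall>\<^sub>F i in sequentially. nrm2 (\<lambda>x. U i x - u x) < r n"
      by (rule order_tendstoD(2)[OF lim r0])
    with K have "\<forall>\<^sub>F i in sequentially. nrm2 (grad (U i)) \<le> K \<and> nrm2 (\<lambda>x. U i x - u x) < r n"
      by (rule eventually_conj)
    then obtain i where "nrm2 (grad (U i)) \<le> K" "nrm2 (\<lambda>x. U i x - u x) < r n"
      by (auto simp: eventually_sequentially)
    then show ?thesis by (intro bexI[of _ "U i"]) (auto simp: C_def U)
  qed
  then have dK: "d n \<le> K" and ne: "C n \<noteq> {}" for n
    unfolding d_def using cINF_lower2[OF bdd] by blast+
  have dle: "d n \<le> nrm2 (grad v)" if "v \<in> C n" for n v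
    unfolding d_def by (rule cINF_lower[OF bdd that])
  have Cmono: "C m \<subseteq> C n" if "n \<le> m" for n m using rmono[OF that] by (auto simp: C_def)
  have dmono: "d n \<le> d m" if "n \<le> m" for n m
    unfolding d_def by (rule cINF_superset_mono[OF ne bdd Cmono[OF that]]) auto
  have "\<exists>v\<in>C n. nrm2 (grad v) < d n + r n" for n
    using cInf_lessD[of "(\<lambda>v. nrm2 (grad v)) ` C n" "d n + r n"] ne[of n] r0[of n] unfolding d_def by auto
  then obtain v where v: "\<And>n. v n \<in> C n" "\<And>n. nrm2 (grad (v n)) < d n + r n" by metis
  have vH: "H1 (v n)" for n using v(1) by (auto simp: C_def)
  have vg: "L2 (grad (v n))" for n by (rule grad_works(2)[OF vH])
  have vs: "L2 (v n)" for n by (rule H1_sq_int[OF vH])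
  have "incseq d" using dmono by (simp add: incseq_def)
  then obtain D where D: "d \<longlonglongrightarrow> D" "\<And>n. d n \<le> D"
    using incseq_convergent[of d K] dK by blast
  have DK: "D \<le> K" using LIMSEQ_le_const2[OF D(1)] dK by blast
  \<comment> \<open>The midpoint stays in \<open>C N\<close> by convexity, so its energy is at least
    d N, while both endpoints have energy at most D + r N. The parallelogram identity leaves at most
    4 (D + r N) - 4 d N.\<close>
  have mid: "nrm2 (\<lambda>x. grad (v m) x - grad (v n) x) \<le> 4 * (D - d N + r N)" if mn: "N \<le> m" "N \<le> n" for N m n
  proof -
    have vC: "v m \<in> C N" "v n \<in> C N" using v(1) Cmono mn by blast+
    define w where "w x = (1/2) * v m x + (1/2) * v n x" for x
    have wH: "H1 w" unfolding w_def by (rule H1_lincomb[OF vH vH])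
    have "nrm2 (\<lambda>x. w x - u x) \<le> r N"
    proof -
      have "nrm2 (\<lambda>x. (v m x - u x) + (v n x - u x)) \<le> 2 * nrm2 (\<lambda>x. v m x - u x) + 2 * nrm2 (\<lambda>x. v n x - u x)"
        by (intro sqnorm_add_le sq_int_diff vs u)
      also have "\<dots> \<le> 4 * r N" using vC by (simp add: C_def)
      finally have "(1/2)\<^sup>2 * nrm2 (\<lambda>x. (v m x - u x) + (v n x - u x)) \<le> r N" by (simp add: power2_eq_square)
      moreover have "(\<lambda>x. (1/2) *\<^sub>R ((v m x - u x) + (v n x - u x))) = (\<lambda>x. w x - u x)"
        by (simp add: w_def fun_eq_iff field_simps)
      ultimately show ?thesis using sqnorm_scaleR[of lebesgue "1/2" "\<lambda>x. (v m x - u x) + (v n x - u x)"] by simp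
    qed
    then have "w \<in> C N" using wH by (simp add: C_def)
    then have dw: "d N \<le> nrm2 (grad w)" by (rule dle)
    have "AE x in lebesgue. grad w x = (1/2) *\<^sub>R grad (v m) x + (1/2) *\<^sub>R grad (v n) x"
      unfolding w_def by (rule grad_lincomb[OF vH vH])
    then have "nrm2 (grad w) \<le> nrm2 (\<lambda>x. (1/2) *\<^sub>R grad (v m) x + (1/2) *\<^sub>R grad (v n) x)"
      by (intro sqnorm_mono_AE(2) sq_int_lincomb vg sq_int_meas[OF grad_works(2)[OF wH]])
         (auto elim!: eventually_mono)
    with dw have "d N \<le> nrm2 (\<lambda>x. (1/2) *\<^sub>R grad (v m) x + (1/2) *\<^sub>R grad (v n) x)" by linarith
    moreover have "nrm2 (grad (v m)) \<le> D + r N" "nrm2 (grad (v n)) \<le> D + r N"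
      using v(2)[of m] v(2)[of n] D(2)[of m] D(2)[of n] rmono[OF mn(1)] rmono[OF mn(2)] by linarith+
    ultimately show ?thesis
      using sqnorm_lincomb[OF vg[of m] vg[of n], of "1/2" "1/2"] sqnorm_lincomb[OF vg[of m] vg[of n], of 1 "-1"]
      by (simp add: power2_eq_square)
  qed
  have "\<exists>N. \<forall>m\<ge>N. \<forall>n\<ge>N. nrm2 (\<lambda>x. grad (v m) x - grad (v n) x) < e" if e: "0 < e" for e
  proof -
    have "(\<lambda>N. 4 * (D - d N + r N)) \<longlonglongrightarrow> 4 * (D - D + 0)"
      by (intro tendsto_intros D(1) rlim)
    then have "\<forall>\<^sub>F N in sequentially. 4 * (D - d N + r N) < e"
      using e by (intro order_tendstoD(2)) auto
    then obtain N where "4 * (D - d N + r N) < e" by (auto simp: eventually_sequentially)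
    then show ?thesis using mid[of N] by (intro exI[of _ N]) (auto intro: le_less_trans)
  qed
  from sq_complete[OF vg this] obtain g where g: "L2 g"
    "(\<lambda>n. nrm2 (\<lambda>x. grad (v n) x - g x)) \<longlonglongrightarrow> 0" by blast
  have vlim: "(\<lambda>n. nrm2 (\<lambda>x. v n x - u x)) \<longlonglongrightarrow> 0"
  proof (rule tendsto_sandwich[OF _ _ tendsto_const[of 0] rlim])
    show "\<forall>\<^sub>F n in sequentially. nrm2 (\<lambda>x. v n x - u x) \<le> r n"
      using v(1) by (auto simp: C_def)
  qed (simp add: sqnorm_nonneg)
  have w: "weak_grad u g"
    by (rule weak_grad_limit[OF grad_works(1)[OF vH] vs vg u g(1) vlim g(2)])
  show H: "H1 u" by (rule H1I[OF u w g(1)])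
  have gK: "nrm2 g \<le> K"
  proof (rule field_le_epsilon)
    fix e :: real assume e: "0 < e"
    obtain N where N: "\<And>n. n \<ge> N \<Longrightarrow> r n < e" using order_tendstoD(2)[OF rlim e] by (auto simp: eventually_sequentially)
    show "nrm2 g \<le> K + e"
    proof (rule sqnorm_limit_le[of lebesgue "\<lambda>n. grad (v (n + N))"])
      show "(\<lambda>n. nrm2 (\<lambda>x. grad (v (n + N)) x - g x)) \<longlonglongrightarrow> 0"
        using g(2) by (rule LIMSEQ_ignore_initial_segment)
      show "nrm2 (grad (v (n + N))) \<le> K + e" for n
        using v(2)[of "n + N"] dK[of "n + N"] N[of "n + N"] by simp
    qed (use vg g in auto)
  qed
  have "AE x in lebesgue. grad u x = g x" by (rule grad_AE_eq[OF u w g(1)])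
  then have "nrm2 (grad u) \<le> nrm2 g"
    by (intro sqnorm_mono_AE(2)[OF g(1)] sq_int_meas[OF grad_works(2)[OF H]]) (auto elim!: eventually_mono)
  with gK show "nrm2 (grad u) \<le> K" by linarith
qed

subsection \<open>The energy functional\<close>

lemma powr_above_tangent:
  fixes a x q :: real
  assumes q: "1 < q" and a: "0 < a" and x: "0 \<le> x"
  shows "a powr q + q * a powr (q - 1) * (x - a) \<le> x powr q"
proof (cases "x = 0")
  case True
  have "a powr (q - 1) * a = a powr q" using a by (simp add: powr_mult_base mult.commute)
  then have "a powr q + q * a powr (q - 1) * (x - a) = (1 - q) * a powr q"
    using True by (simp add: algebra_simps)
  also have "\<dots> \<le> 0" using q by (intro mult_nonpos_nonneg) auto
  finally show ?thesis using True by simp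
next
  case False
  have "((\<lambda>x. x powr q) has_real_derivative q * a powr (q - 1)) (at a within {0<..})"
    by (rule has_field_derivative_at_within[OF has_real_derivative_powr[OF a]])
  moreover have "a \<in> interior {0<..}" using a by (simp add: interior_open)
  moreover have "convex_on {0<..} (\<lambda>x. x powr q)" using q by (intro powr_convex) simp
  ultimately have "x powr q - a powr q \<ge> q * a powr (q - 1) * (x - a)"
    using x False by (intro convex_on_imp_above_tangent[of "{0<..}" "\<lambda>x. x powr q"]) auto
  then show ?thesis by simp
qed

text \<open>The tangent inequality of the convex function |x|^q, whose derivative at a is q
  |a|^(q-2) a. Its integral bounds the power term from below by an affine function, which replaces
  differentiating the power term.\<close>

lemma abs_powr_above_tangent:
  fixes a h q :: real
  assumes q: "1 < q"
  shows "\<bar>a\<bar> powr q + q * (\<bar>a\<bar> powr (q - 2) * a * h) \<le> \<bar>a + h\<bar> powr q"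
proof (cases "a = 0")
  case False
  have e: "\<bar>a\<bar> powr (q - 2) * a = sgn a * \<bar>a\<bar> powr (q - 1)"
  proof -
    have "\<bar>a\<bar> powr (q - 1) = \<bar>a\<bar> powr (q - 2) * \<bar>a\<bar> powr 1" unfolding powr_add[symmetric] by simp
    also have "\<dots> = \<bar>a\<bar> powr (q - 2) * \<bar>a\<bar>" using False by simp
    finally show ?thesis by (simp add: sgn_if)
  qed
  have "sgn a * h \<le> \<bar>a + h\<bar> - \<bar>a\<bar>" using False by (auto simp: sgn_if abs_if)
  then have "q * \<bar>a\<bar> powr (q - 1) * (sgn a * h) \<le> q * \<bar>a\<bar> powr (q - 1) * (\<bar>a + h\<bar> - \<bar>a\<bar>)"
    using q by (intro mult_left_mono) auto
  then show ?thesis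
    using powr_above_tangent[OF q, of "\<bar>a\<bar>" "\<bar>a + h\<bar>"] False unfolding e by (simp add: mult_ac)
qed simp

text \<open>Convexity applied to b + c = (1 - r) (b / (1 - r)) + r (c / r). The coefficient of |b|^q
  tends to 1 as r tends to 0, while the other blows up; so c is sent to 0 at fixed r, and only then
  r to 0.\<close>

lemma abs_powr_add_le:
  fixes b c q r :: real
  assumes q: "1 < q" and r: "0 < r" "r < 1"
  shows "\<bar>b + c\<bar> powr q \<le> (1 - r) powr (1 - q) * \<bar>b\<bar> powr q + r powr (1 - q) * \<bar>c\<bar> powr q"
proof (cases "b + c = 0")
  case False
  define a where "a = \<bar>b\<bar> + \<bar>c\<bar>"
  define x where "x = \<bar>b\<bar> / (1 - r)"
  define y where "y = \<bar>c\<bar> / r"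
  have a: "0 < a" "\<bar>b + c\<bar> \<le> a" using False by (auto simp: a_def)
  have axy: "(1 - r) * (x - a) + r * (y - a) = 0"
    using r by (simp add: a_def x_def y_def field_simps)
  have x: "(1 - r) * x powr q = (1 - r) powr (1 - q) * \<bar>b\<bar> powr q"
    using r by (simp add: x_def powr_divide powr_diff)
  have y: "r * y powr q = r powr (1 - q) * \<bar>c\<bar> powr q"
    using r by (simp add: y_def powr_divide powr_diff)
  have "(1 - r) * (a powr q + q * a powr (q - 1) * (x - a)) + r * (a powr q + q * a powr (q - 1) * (y - a))
      \<le> (1 - r) * x powr q + r * y powr q"
    using r by (intro add_mono mult_left_mono powr_above_tangent q a) (auto simp: x_def y_def)
  moreover have "(1 - r) * (a powr q + q * a powr (q - 1) * (x - a)) + r * (a powr q + q * a powr (q - 1) * (y - a))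
      = a powr q + q * a powr (q - 1) * ((1 - r) * (x - a) + r * (y - a))"
    by (simp add: algebra_simps)
  ultimately have "a powr q \<le> (1 - r) * x powr q + r * y powr q" by (simp add: axy)
  moreover have "\<bar>b + c\<bar> powr q \<le> a powr q" using a q by (intro powr_mono2) auto
  ultimately show ?thesis by (simp add: x y)
qed (use r in simp)

text \<open>With the square root of V the potential energy is a squared L2 norm, so the lemmas on
  \<open>sqnorm\<close> apply to it as they do to the gradient.\<close>

definition vroot :: "('a \<Rightarrow> real) \<Rightarrow> ('a \<Rightarrow> real) \<Rightarrow> 'a \<Rightarrow> real" where
  "vroot V u x = sqrt (V x) * u x"

definition powint :: "real \<Rightarrow> ('a::euclidean_space \<Rightarrow> real) \<Rightarrow> real" where
  "powint q u = (\<integral>x. \<bar>u x\<bar> powr q \<partial>lebesgue)"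

text \<open>The bilinear form of the operator -Laplace + V.\<close>

definition form :: "('a::euclidean_space \<Rightarrow> real) \<Rightarrow> ('a \<Rightarrow> real) \<Rightarrow> ('a \<Rightarrow> real) \<Rightarrow> real" where
  "form V u v = (\<integral>x. grad u x \<bullet> grad v x \<partial>lebesgue) + (\<integral>x. vroot V u x * vroot V v x \<partial>lebesgue)"

lemma sqnorm_eq_inner: "sqnorm M f = (\<integral>x. f x \<bullet> f x \<partial>M)"
  by (simp add: sqnorm_def power2_norm_eq_inner)

lemma form_self: "form V u u = nrm2 (grad u) + nrm2 (vroot V u)"
  by (simp add: form_def sqnorm_eq_inner)

lemma L2sq_eq: "L2sq u = nrm2 u"
  by (simp add: L2sq_def sqnorm_def)

text \<open>\<open>q\<close> stands for p + 1, the exponent in the energy; the admissible range of p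
  becomes that of the Gagliardo-Nirenberg bound.\<close>

locale schroedinger =
  fixes V :: "'a::euclidean_space \<Rightarrow> real" and q :: real
  assumes V_nonneg: "\<And>x. 0 \<le> V x" and V_meas: "lmeas V"
    and q_gt: "2 < q" and q_lt: "q < 2 + 4 / real DIM('a)"
begin

lemma root_sq: "vroot V u x * vroot V v x = V x * u x * v x"
  using V_nonneg[of x] by (simp add: vroot_def mult_ac)

lemma calH_iff: "calH V u \<longleftrightarrow> H1 u \<and> L2 (vroot V u)"
proof -
  have "(norm (vroot V u x))\<^sup>2 = V x * (u x)\<^sup>2" for x
    using root_sq[of u x u] by (simp add: power2_eq_square mult.assoc)
  moreover have "H1 u \<Longrightarrow> vroot V u \<in> borel_measurable lebesgue"
    unfolding vroot_def[abs_def] using V_meas sq_int_meas[OF H1_sq_int[of u]] by simp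
  ultimately show ?thesis by (auto simp: calH_def sq_int_def)
qed

lemma calHD:
  assumes "calH V u"
  shows "H1 u" "L2 (vroot V u)" "L2 u" "L2 (grad u)"
    "lmeas u"
  using assms by (auto simp: calH_iff H1_sq_int grad_works(2) sq_int_meas)

lemma root_lincomb: "vroot V (\<lambda>x. s * u x + t * v x) = (\<lambda>x. s *\<^sub>R vroot V u x + t *\<^sub>R vroot V v x)"
  by (simp add: vroot_def fun_eq_iff algebra_simps)

lemma calH_lincomb:
  assumes "calH V u" "calH V v" shows "calH V (\<lambda>x. s * u x + t * v x)"
  unfolding calH_iff root_lincomb
  by (intro conjI H1_lincomb sq_int_lincomb calHD[OF assms(1)] calHD[OF assms(2)])

lemma calH_scale: "calH V u \<Longrightarrow> calH V (\<lambda>x. s * u x)"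
  using calH_lincomb[of u u s 0] by simp

lemma sqnorm_u_lincomb:
  fixes u v :: "'a \<Rightarrow> real"
  assumes "calH V u" "calH V v"
  shows "nrm2 (\<lambda>x. s * u x + t * v x)
    = s\<^sup>2 * nrm2 u + 2 * s * t * (\<integral>x. u x * v x \<partial>lebesgue) + t\<^sup>2 * nrm2 v"
  using sqnorm_lincomb[OF calHD(3)[OF assms(1)] calHD(3)[OF assms(2)], of s t] by simp

lemma form_lincomb:
  assumes "calH V u" "calH V v"
  shows "form V (\<lambda>x. s * u x + t * v x) (\<lambda>x. s * u x + t * v x)
    = s\<^sup>2 * form V u u + 2 * s * t * form V u v + t\<^sup>2 * form V v v"
proof -
  note u = calHD[OF assms(1)] and v = calHD[OF assms(2)]
  have "nrm2 (grad (\<lambda>x. s * u x + t * v x)) = nrm2 (\<lambda>x. s *\<^sub>R grad u x + t *\<^sub>R grad v x)"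
    unfolding sqnorm_def
  proof (rule integral_cong_AE)
    show "lmeas (\<lambda>x. (norm (grad (\<lambda>x. s * u x + t * v x) x))\<^sup>2)"
      using sq_int_norm[OF calHD(4)[OF calH_lincomb[OF assms, of s t]]] by (rule borel_measurable_integrable)
    show "lmeas (\<lambda>x. (norm (s *\<^sub>R grad u x + t *\<^sub>R grad v x))\<^sup>2)"
      using sq_int_norm[OF sq_int_lincomb[OF u(4) v(4), of s t]] by (rule borel_measurable_integrable)
    show "AE x in lebesgue. (norm (grad (\<lambda>x. s * u x + t * v x) x))\<^sup>2 = (norm (s *\<^sub>R grad u x + t *\<^sub>R grad v x))\<^sup>2"
      using grad_lincomb[OF u(1) v(1), of s t] by eventually_elim (simp only:)
  qed
  then show ?thesis
    unfolding form_self root_lincomb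
    using sqnorm_lincomb[OF u(4) v(4), of s t] sqnorm_lincomb[OF u(2) v(2), of s t]
    by (simp add: form_self form_def algebra_simps)
qed

lemma form_scale: "calH V u \<Longrightarrow> form V (\<lambda>x. s * u x) (\<lambda>x. s * u x) = s\<^sup>2 * form V u u"
  using form_lincomb[of u u s 0] by simp

lemma sqnorm_scale: "nrm2 (\<lambda>x. s * u x) = s\<^sup>2 * nrm2 (u :: 'a \<Rightarrow> real)"
  using sqnorm_scaleR[of lebesgue s u] by simp

lemma power_integrable:
  fixes u :: "'a \<Rightarrow> real"
  assumes "H1 u" shows "integrable lebesgue (\<lambda>x. \<bar>u x\<bar> powr q)"
proof -
  have "0 < nrm2 u + 1" using sqnorm_nonneg[of lebesgue u] by linarith
  from gagliardo_nirenberg[OF q_gt q_lt this, of 1] assms show ?thesis by auto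
qed

lemma powint_nonneg: "0 \<le> powint q u"
  by (simp add: powint_def)

lemma powint_scale: "powint q (\<lambda>x. s * u x) = \<bar>s\<bar> powr q * powint q u"
  by (simp add: powint_def abs_mult powr_mult)

lemma powint_pos:
  fixes u :: "'a \<Rightarrow> real"
  assumes "H1 u" "\<not> (AE x in lebesgue. u x = 0)" shows "0 < powint q u"
proof -
  have "powint q u \<noteq> 0"
  proof
    assume "powint q u = 0"
    then have "AE x in lebesgue. \<bar>u x\<bar> powr q = 0"
      unfolding powint_def by (subst (asm) integral_nonneg_eq_0_iff_AE[OF power_integrable[OF assms(1)]]) auto
    then have "AE x in lebesgue. u x = 0" by eventually_elim simp
    with assms(2) show False ..
  qed
  with powint_nonneg[of u] show ?thesis by linarith
qed

lemma powint_add_le: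
  fixes u v :: "'a \<Rightarrow> real"
  assumes u: "H1 u" and v: "H1 v" and r: "0 < r" "r < 1"
  shows "powint q (\<lambda>x. u x + v x) \<le> (1 - r) powr (1 - q) * powint q u + r powr (1 - q) * powint q v"
proof -
  have uv: "H1 (\<lambda>x. u x + v x)" using H1_lincomb[OF u v, of 1 1] by simp
  have "powint q (\<lambda>x. u x + v x) \<le> (\<integral>x. (1 - r) powr (1 - q) * \<bar>u x\<bar> powr q + r powr (1 - q) * \<bar>v x\<bar> powr q \<partial>lebesgue)"
    unfolding powint_def using q_gt
    by (intro integral_mono abs_powr_add_le r Bochner_Integration.integrable_add integrable_mult_right power_integrable u v uv) auto
  also have "\<dots> = (1 - r) powr (1 - q) * powint q u + r powr (1 - q) * powint q v"
    unfolding powint_def using power_integrable[OF u] power_integrable[OF v] by simp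
  finally show ?thesis .
qed

lemma nonlinear_integrable:
  fixes u v :: "'a \<Rightarrow> real"
  assumes u: "H1 u" and v: "H1 v"
  shows "integrable lebesgue (\<lambda>x. \<bar>u x\<bar> powr (q - 2) * u x * v x)"
proof (rule Bochner_Integration.integrable_bound)
  show "integrable lebesgue (\<lambda>x. \<bar>u x\<bar> powr q + \<bar>v x\<bar> powr q)"
    by (intro Bochner_Integration.integrable_add power_integrable u v)
  have [measurable]: "lmeas u" "lmeas v"
    using u v by (auto intro: sq_int_meas H1_sq_int)
  show "lmeas (\<lambda>x. \<bar>u x\<bar> powr (q - 2) * u x * v x)" by measurable
  have "\<bar>a\<bar> powr (q - 2) * \<bar>a\<bar> * \<bar>b\<bar> \<le> \<bar>a\<bar> powr q + \<bar>b\<bar> powr q" for a b :: real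
  proof -
    \<comment> \<open>Bounding both arguments by their maximum takes the place of Young's
      inequality.\<close>
    define m where "m = max \<bar>a\<bar> \<bar>b\<bar>"
    have m: "\<bar>a\<bar> \<le> m" "\<bar>b\<bar> \<le> m" "0 \<le> m" by (auto simp: m_def)
    have "\<bar>a\<bar> powr (q - 2) * \<bar>a\<bar> * \<bar>b\<bar> \<le> m powr (q - 2) * m * m"
      using m q_gt by (intro mult_mono powr_mono2) auto
    also have "\<dots> = m powr q"
    proof (cases "m = 0")
      case False
      have "m powr q = m powr (q - 2) * m powr 2" unfolding powr_add[symmetric] by simp
      then show ?thesis using m by (simp add: power2_eq_square)
    qed simp
    also have "\<dots> \<le> \<bar>a\<bar> powr q + \<bar>b\<bar> powr q" by (auto simp: m_def max_def)
    finally show ?thesis .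
  qed
  then show "AE x in lebesgue. norm (\<bar>u x\<bar> powr (q - 2) * u x * v x) \<le> norm (\<bar>u x\<bar> powr q + \<bar>v x\<bar> powr q)"
    by (intro AE_I2) (simp add: abs_mult)
qed

lemma powint_above_tangent:
  fixes u v :: "'a \<Rightarrow> real"
  assumes u: "H1 u" and v: "H1 v"
  shows "powint q u + q * s * (\<integral>x. \<bar>u x\<bar> powr (q - 2) * u x * v x \<partial>lebesgue) \<le> powint q (\<lambda>x. u x + s * v x)"
proof -
  have uv: "H1 (\<lambda>x. u x + s * v x)" using H1_lincomb[OF u v, of 1 s] by simp
  have "(\<integral>x. \<bar>u x\<bar> powr q + (q * s) * (\<bar>u x\<bar> powr (q - 2) * u x * v x) \<partial>lebesgue) \<le> (\<integral>x. \<bar>u x + s * v x\<bar> powr q \<partial>lebesgue)"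
  proof (intro integral_mono Bochner_Integration.integrable_add integrable_mult_right nonlinear_integrable power_integrable u v uv)
    show "\<bar>u x\<bar> powr q + (q * s) * (\<bar>u x\<bar> powr (q - 2) * u x * v x) \<le> \<bar>u x + s * v x\<bar> powr q" for x
      using abs_powr_above_tangent[of q "u x" "s * v x"] q_gt by (simp add: mult_ac)
  qed
  then show ?thesis
    using power_integrable[OF u] nonlinear_integrable[OF u v] by (simp add: powint_def)
qed

end

subsection \<open>Existence of minimizers\<close>

context schroedinger begin

definition energy :: "real \<Rightarrow> ('a \<Rightarrow> real) \<Rightarrow> real" where
  "energy t u = form V u u / 2 - t / q * powint q u"

lemma root_sqnorm: "nrm2 (vroot V u) = (\<integral>x. V x * (u x)\<^sup>2 \<partial>lebesgue)"
  unfolding sqnorm_eq_inner by (simp add: root_sq power2_eq_square mult.assoc)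

lemma E_fun_eq: "E_fun V (q - 1) \<rho> u = energy (\<rho> powr (q - 2)) u"
  by (simp add: E_fun_def energy_def form_self root_sqnorm[symmetric] sqnorm_def[of lebesgue "grad u"] powint_def)

lemma F_fun_eq:
  assumes "calH V u"
  shows "F_fun V (q - 1) \<mu> \<rho> u = energy (\<rho> powr (q - 2)) u - \<mu> / 2 * nrm2 u"
proof -
  have "integrable lebesgue (\<lambda>x. V x * (u x)\<^sup>2)" using assms by (simp add: calH_def)
  moreover have "integrable lebesgue (\<lambda>x. (u x)\<^sup>2)" using sq_int_norm[OF calHD(3)[OF assms]] by simp
  ultimately have "(\<integral>x. (V x - \<mu>) * (u x)\<^sup>2 \<partial>lebesgue) = nrm2 (vroot V u) - \<mu> * nrm2 u"
    unfolding root_sqnorm sqnorm_def[of lebesgue u] by (simp add: left_diff_distrib)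
  then show ?thesis
    by (simp add: F_fun_def energy_def form_self sqnorm_def[of lebesgue "grad u"] powint_def algebra_simps)
qed

lemma dF_eq:
  assumes u: "calH V u" and v: "calH V v"
  shows "dF V (q - 1) \<mu> \<rho> u v = form V u v - \<mu> * (\<integral>x. u x * v x \<partial>lebesgue)
    - \<rho> powr (q - 2) * (\<integral>x. \<bar>u x\<bar> powr (q - 2) * u x * v x \<partial>lebesgue)"
proof -
  have "integrable lebesgue (\<lambda>x. vroot V u x * vroot V v x)"
    by (rule sq_int_times[OF calHD(2)[OF u] calHD(2)[OF v]])
  moreover have "integrable lebesgue (\<lambda>x. u x * v x)" by (rule sq_int_times[OF calHD(3)[OF u] calHD(3)[OF v]])
  ultimately have "(\<integral>x. (V x - \<mu>) * u x * v x \<partial>lebesgue)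
      = (\<integral>x. vroot V u x * vroot V v x \<partial>lebesgue) - \<mu> * (\<integral>x. u x * v x \<partial>lebesgue)"
    by (simp add: root_sq left_diff_distrib mult.assoc)
  then show ?thesis by (simp add: dF_def form_def)
qed

lemma powint_eq_nonlinear: "(\<integral>x. \<bar>u x\<bar> powr (q - 2) * u x * u x \<partial>lebesgue) = powint q u"
  unfolding powint_def
proof (intro Bochner_Integration.integral_cong refl)
  fix x
  show "\<bar>u x\<bar> powr (q - 2) * u x * u x = \<bar>u x\<bar> powr q"
  proof (cases "u x = 0")
    case False
    have "\<bar>u x\<bar> powr q = \<bar>u x\<bar> powr (q - 2) * \<bar>u x\<bar> powr 2" unfolding powr_add[symmetric] by simp
    then show ?thesis by (simp add: power2_eq_square mult.assoc)
  qed simp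
qed

abbreviation "Mq \<equiv> M_set V (q - 1)"
abbreviation "Sq \<equiv> S_set V (q - 1)"

lemma M_set_eq:
  "Mq \<rho> = {u. calH V u \<and> nrm2 u = 1 \<and>
    (\<forall>v. calH V v \<and> nrm2 v = 1 \<longrightarrow> energy (\<rho> powr (q - 2)) u \<le> energy (\<rho> powr (q - 2)) v)}"
  by (simp add: M_set_def E_fun_eq L2sq_eq)

text \<open>Where V >= L one has u^2 <= V u^2 / L, so the mass there is at most K / L. The radius
  depends on K and e alone, which gives the uniform tails that compactness requires.\<close>

lemma potential_tail:
  assumes coercive: "filterlim V at_top at_infinity" and K: "0 \<le> K" and e: "0 < e"
  shows "\<exists>R. \<forall>u. calH V u \<and> nrm2 (vroot V u) \<le> K \<longrightarrow>
    nrm2 (\<lambda>x. u x * indicator (- cball 0 R) x) \<le> e"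
proof -
  \<comment> \<open>The summand 1 keeps L positive when K = 0.\<close>
  define L where "L = K / e + 1"
  have L: "0 < L" "K / L \<le> e" using K e by (auto simp: L_def field_simps add_pos_nonneg)
  have "\<forall>\<^sub>F x in at_infinity. L \<le> V x" using coercive by (simp add: filterlim_at_top)
  then obtain R where R: "\<And>x. R \<le> norm x \<Longrightarrow> L \<le> V x" by (auto simp: eventually_at_infinity)
  show ?thesis
  proof (intro exI[of _ R] allI impI)
    fix u assume u: "calH V u \<and> nrm2 (vroot V u) \<le> K"
    then have usi: "L2 (\<lambda>x. (1 / sqrt L) *\<^sub>R vroot V u x)"
      by (intro sq_int_scaleR calHD) auto
    have m: "lmeas (\<lambda>x. u x * indicator (- cball 0 R) x)"
      using u calHD(5)[of u] by (intro borel_measurable_times borel_measurable_indicator sets_completionI_sets) auto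
    have "nrm2 (\<lambda>x. u x * indicator (- cball 0 R) x) \<le> nrm2 (\<lambda>x. (1 / sqrt L) *\<^sub>R vroot V u x)"
    proof (rule sqnorm_mono_AE(2)[OF usi m], intro AE_I2)
      fix x
      show "norm (u x * indicator (- cball 0 R) x) \<le> norm ((1 / sqrt L) *\<^sub>R vroot V u x)"
      proof (cases "x \<in> cball 0 R")
        case False
        then have "sqrt L \<le> sqrt (V x)" using R[of x] by simp
        then have "sqrt L * \<bar>u x\<bar> \<le> sqrt (V x) * \<bar>u x\<bar>" by (rule mult_right_mono) simp
        then show ?thesis using False L V_nonneg[of x] by (simp add: vroot_def abs_mult field_simps)
      qed simp
    qed
    also have "\<dots> = (1 / sqrt L)\<^sup>2 * nrm2 (vroot V u)" by (rule sqnorm_scaleR)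
    also have "\<dots> = nrm2 (vroot V u) / L" using L by (simp add: power_divide)
    also have "\<dots> \<le> K / L" using u L by (intro divide_right_mono) auto
    finally show "nrm2 (\<lambda>x. u x * indicator (- cball 0 R) x) \<le> e" using L by linarith
  qed
qed

lemma energy_lower_bound:
  assumes t: "0 < t"
  shows "\<exists>C\<ge>0. \<forall>u. calH V u \<and> nrm2 u = 1 \<longrightarrow> form V u u / 4 - C \<le> energy t u"
proof -
  define c where "c = t / q"
  have c: "0 < c" using t q_gt by (simp add: c_def)
  \<comment> \<open>With coefficient 1 / (4 c) the power term uses up at most half of the quadratic
    part, up to a constant: form/2 - form/4 remains.\<close>
  obtain C where C: "C \<ge> 0" "\<And>u :: 'a \<Rightarrow> real. H1 u \<Longrightarrow> nrm2 u \<le> 1 \<Longrightarrow>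
      powint q u \<le> 1 / (4 * c) * nrm2 (grad u) + C * nrm2 u"
    using gagliardo_nirenberg[OF q_gt q_lt, of 1 "1 / (4 * c)"] c unfolding powint_def by auto
  show ?thesis
  proof (intro exI[of _ "c * C"] conjI allI impI)
    fix u assume u: "calH V u \<and> nrm2 u = 1"
    then have "c * powint q u \<le> c * (1 / (4 * c) * nrm2 (grad u) + C * 1)"
      using C(2)[of u] c by (intro mult_left_mono) (auto simp: calH_iff)
    also have "\<dots> = nrm2 (grad u) / 4 + c * C" using c by (simp add: field_simps)
    also have "\<dots> \<le> form V u u / 4 + c * C" by (simp add: form_self sqnorm_nonneg)
    finally show "form V u u / 4 - c * C \<le> energy t u" by (simp add: energy_def c_def)
  qed (use c C in auto)
qed

text \<open>A minimizing sequence has bounded form, and the growth of V confines its mass, so a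
  subsequence converges in L2. The quadratic parts are lower semicontinuous, by
  \<open>gradient_lsc\<close> and by Fatou; the power term passes to the limit because the
  differences tend to 0 in L2 with bounded gradients.\<close>

theorem minimizer_exists:
  assumes coercive: "filterlim V at_top at_infinity" and t: "0 < t"
    and ne: "calH V v0" "nrm2 v0 = 1"
  shows "\<exists>u. calH V u \<and> nrm2 u = 1 \<and> (\<forall>v. calH V v \<and> nrm2 v = 1 \<longrightarrow> energy t u \<le> energy t v)"
proof -
  define c where "c = t / q"
  have c: "0 < c" using t q_gt by (simp add: c_def)
  obtain C where C: "C \<ge> 0" "\<And>u. calH V u \<Longrightarrow> nrm2 u = 1 \<Longrightarrow> form V u u / 4 - C \<le> energy t u"
    using energy_lower_bound[OF t] by blast
  have form0: "0 \<le> form V u u" for u by (simp add: form_self sqnorm_nonneg)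
  define S where "S = {u. calH V u \<and> nrm2 u = 1}"
  define m where "m = Inf (energy t ` S)"
  have "- C \<le> energy t u" if "u \<in> S" for u
    using C(2)[of u] form0[of u] that by (simp add: S_def)
  then have bdd: "bdd_below (energy t ` S)" by (rule bdd_belowI2)
  have Sne: "S \<noteq> {}" using ne by (auto simp: S_def)
  have mle: "m \<le> energy t u" if "u \<in> S" for u unfolding m_def by (rule cINF_lower[OF bdd that])
  have "\<exists>u\<in>S. energy t u < m + inverse (real (Suc n))" for n
    using cInf_lessD[of "energy t ` S" "m + inverse (real (Suc n))"] Sne unfolding m_def by auto
  then obtain U where U: "\<And>n. U n \<in> S" "\<And>n. energy t (U n) < m + inverse (real (Suc n))" by metis
  have UH: "calH V (U n)" and U1: "nrm2 (U n) = 1" for n using U(1) by (auto simp: S_def)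
  define K where "K = 4 * (m + 1 + C)"
  have Kf: "form V (U n) (U n) \<le> K" for n
  proof -
    have i: "inverse (real (Suc n)) \<le> 1" by (simp add: inverse_eq_divide)
    have "y \<le> 4 * (m + 1 + C)" if "i \<le> 1" "y / 4 - C \<le> z" "z < m + i" for i y z :: real
      using that by (simp add: field_simps)
    from this[OF i C(2)[OF UH U1] U(2)] show ?thesis unfolding K_def .
  qed
  have Kg: "nrm2 (grad (U n)) \<le> K" and Kv: "nrm2 (vroot V (U n)) \<le> K" for n
    using Kf[of n] sqnorm_nonneg[of lebesgue "grad (U n)"] sqnorm_nonneg[of lebesgue "vroot V (U n)"]
    unfolding form_self by linarith+
  have K0: "0 \<le> K" using Kg[of 0] sqnorm_nonneg[of lebesgue "grad (U 0)"] by linarith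
  have tail: "\<exists>R. \<forall>n. nrm2 (\<lambda>x. U n x * indicator (- cball 0 R) x) \<le> e" if "0 < e" for e
    using potential_tail[OF coercive K0 that] UH Kv by blast
  have le1: "nrm2 (U n) \<le> 1" for n by (simp add: U1)
  obtain k1 u where k1: "strict_mono k1" and us: "L2 u"
    and lim1: "(\<lambda>n. nrm2 (\<lambda>x. U (k1 n) x - u x)) \<longlonglongrightarrow> 0"
    using rellich[OF calHD(1)[OF UH] le1 Kg tail] by blast
  \<comment> \<open>Both quadratic parts are made to converge: their limits bound the parts at u,
    and together with the energy they fix the limit of the power term.\<close>
  have "bounded (range (\<lambda>n. (nrm2 (grad (U (k1 n))), nrm2 (vroot V (U (k1 n))))))"
    by (rule bounded_subset[of "{0..K} \<times> {0..K}"])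
       (use Kg Kv in \<open>auto simp: sqnorm_nonneg intro!: bounded_Times\<close>)
  from bounded_imp_convergent_subsequence[OF this] obtain ab k2 where k2: "strict_mono (k2 :: nat \<Rightarrow> nat)"
    and lim2: "((\<lambda>n. (nrm2 (grad (U (k1 n))), nrm2 (vroot V (U (k1 n))))) \<circ> k2) \<longlonglongrightarrow> ab" by blast
  have lim1': "(\<lambda>n. nrm2 (\<lambda>x. U (k1 (k2 n)) x - u x)) \<longlonglongrightarrow> 0"
    using LIMSEQ_subseq_LIMSEQ[OF lim1 k2] by (simp add: o_def)
  obtain k3 where k3: "strict_mono (k3 :: nat \<Rightarrow> nat)" and ae: "AE x in lebesgue. (\<lambda>n. U (k1 (k2 (k3 n))) x) \<longlonglongrightarrow> u x"
    using sq_limit_AE_subseq[OF calHD(3)[OF UH] us lim1'] by blast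
  define W where "W n = U (k1 (k2 (k3 n)))" for n
  define a where "a = fst ab"
  define b where "b = snd ab"
  have kmono: "strict_mono (\<lambda>n. k1 (k2 (k3 n)))"
    using strict_mono_o[OF k1 strict_mono_o[OF k2 k3]] by (simp add: o_def)
  have WH: "calH V (W n)" and W1: "nrm2 (W n) = 1" for n by (simp_all add: W_def UH U1)
  have Wlim: "L2_tendsto lebesgue W u"
    using LIMSEQ_subseq_LIMSEQ[OF lim1' k3] by (simp add: o_def W_def)
  have pair: "(\<lambda>n. (nrm2 (grad (W n)), nrm2 (vroot V (W n)))) \<longlonglongrightarrow> ab"
    using LIMSEQ_subseq_LIMSEQ[OF lim2 k3] by (simp add: o_def W_def)
  have Wa: "(\<lambda>n. nrm2 (grad (W n))) \<longlonglongrightarrow> a"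
    using tendsto_fst[OF pair] by (simp add: a_def)
  have Wb: "(\<lambda>n. nrm2 (vroot V (W n))) \<longlonglongrightarrow> b"
    using tendsto_snd[OF pair] by (simp add: b_def)
  have Wae: "AE x in lebesgue. (\<lambda>n. W n x) \<longlonglongrightarrow> u x" using ae by (simp add: W_def)
  have WE: "(\<lambda>n. energy t (W n)) \<longlonglongrightarrow> m"
  proof (rule tendsto_sandwich[of "\<lambda>_. m" _ _ "\<lambda>n. m + inverse (real (Suc (k1 (k2 (k3 n)))))"])
    show "\<forall>\<^sub>F n in sequentially. m \<le> energy t (W n)" using mle U(1) by (simp add: W_def)
    show "\<forall>\<^sub>F n in sequentially. energy t (W n) \<le> m + inverse (real (Suc (k1 (k2 (k3 n)))))"
      unfolding W_def by (intro always_eventually allI less_imp_le U(2))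
    have "(\<lambda>n. m + inverse (real (Suc n))) \<longlonglongrightarrow> m + 0" by (intro tendsto_intros LIMSEQ_inverse_real_of_nat)
    from LIMSEQ_subseq_LIMSEQ[OF this kmono] show "(\<lambda>n. m + inverse (real (Suc (k1 (k2 (k3 n)))))) \<longlonglongrightarrow> m"
      by (simp add: o_def)
  qed simp
  have ev: "\<forall>\<^sub>F n in sequentially. f n \<le> L + e" if "f \<longlonglongrightarrow> L" "0 < e" for f :: "nat \<Rightarrow> real" and L e
    using order_tendstoD(2)[OF that(1), of "L + e"] that(2) by (auto elim!: eventually_mono)
  have uH1: "H1 u" using gradient_lsc(1)[OF calHD(1)[OF WH] us Wlim ev[OF Wa, of 1]] by simp
  have ua: "nrm2 (grad u) \<le> a"
    by (rule field_le_epsilon) (rule gradient_lsc(2)[OF calHD(1)[OF WH] us Wlim ev[OF Wa]])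
  have rm: "lmeas (vroot V u)"
    unfolding vroot_def[abs_def] using V_meas sq_int_meas[OF us] by simp
  have rae: "AE x in lebesgue. (\<lambda>n. vroot V (W n) x) \<longlonglongrightarrow> vroot V u x"
    using Wae unfolding vroot_def by eventually_elim (intro tendsto_intros)
  note fatou = sq_Fatou[OF calHD(2)[OF WH] rm rae ev[OF Wb]]
  have uV: "L2 (vroot V u)" using fatou(1)[of 1] by simp
  have ub: "nrm2 (vroot V u) \<le> b"
    by (rule field_le_epsilon) (rule fatou(2))
  have uH: "calH V u" using uH1 uV by (simp add: calH_iff)
  have u1: "nrm2 u = 1"
  proof (rule antisym)
    show "nrm2 u \<le> 1"
      by (rule sqnorm_limit_le[OF calHD(3)[OF WH] us Wlim]) (simp add: W1)
    have "1 \<le> sqrt (nrm2 u) + sqrt (nrm2 (\<lambda>x. W n x - u x))" for n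
      using sqnorm_triangle[OF us sq_int_diff[OF calHD(3)[OF WH[of n]] us]] W1[of n] by simp
    moreover have "(\<lambda>n. sqrt (nrm2 u) + sqrt (nrm2 (\<lambda>x. W n x - u x))) \<longlonglongrightarrow> sqrt (nrm2 u) + sqrt 0"
      by (intro tendsto_intros Wlim)
    ultimately have "1 \<le> sqrt (nrm2 u) + sqrt 0" by (intro LIMSEQ_le_const) auto
    then show "1 \<le> nrm2 u" by simp
  qed
  define D where "D n = (\<lambda>x. 1 * W n x + (-1) * u x)" for n
  have DH: "calH V (D n)" for n unfolding D_def by (rule calH_lincomb[OF WH uH])
  have Dsq: "nrm2 (D n) = nrm2 (\<lambda>x. W n x - u x)" for n by (simp add: D_def)
  \<comment> \<open>The parallelogram identity for the form, whose value at the sum is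
    nonnegative.\<close>
  have Dgrad: "nrm2 (grad (D n)) \<le> 4 * K + 4 * form V u u" for n
  proof -
    have "form V (D n) (D n) + form V (\<lambda>x. 1 * W n x + 1 * u x) (\<lambda>x. 1 * W n x + 1 * u x) = 2 * form V (W n) (W n) + 2 * form V u u"
      unfolding D_def form_lincomb[OF WH uH] by simp
    moreover have "form V (W n) (W n) \<le> K" unfolding W_def by (rule Kf)
    moreover have "nrm2 (grad (D n)) \<le> form V (D n) (D n)" by (simp add: form_self sqnorm_nonneg)
    ultimately show ?thesis using form0[of "\<lambda>x. 1 * W n x + 1 * u x"] form0[of u] K0 by linarith
  qed
  have PD: "(\<lambda>n. powint q (D n)) \<longlonglongrightarrow> 0"
  proof (rule LIMSEQ_I)
    fix e :: real assume e: "0 < e"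
    define K2 where "K2 = 4 * K + 4 * form V u u + 1"
    have K2: "0 < K2" using K0 form0[of u] by (simp add: K2_def)
    \<comment> \<open>4 bounds the squared norm of a difference of two functions of unit mass, and
      the coefficient e / (2 K2) makes the gradient share at most e / 2.\<close>
    obtain C' where C': "C' \<ge> 0" "\<And>v :: 'a \<Rightarrow> real. H1 v \<Longrightarrow> nrm2 v \<le> 4 \<Longrightarrow>
        powint q v \<le> e / (2 * K2) * nrm2 (grad v) + C' * nrm2 v"
      using gagliardo_nirenberg[OF q_gt q_lt, of 4 "e / (2 * K2)"] e K2 unfolding powint_def by auto
    have D4: "nrm2 (D n) \<le> 4" for n
      using sqnorm_diff_le[OF calHD(3)[OF WH[of n]] us] W1[of n] u1 by (simp add: Dsq)
    have bound: "powint q (D n) \<le> e / 2 + C' * nrm2 (D n)" for n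
    proof -
      have "e / (2 * K2) * nrm2 (grad (D n)) \<le> e / (2 * K2) * K2"
        using Dgrad[of n] e K2 by (intro mult_left_mono) (auto simp: K2_def)
      also have "\<dots> = e / 2" using K2 by simp
      finally show ?thesis using C'(2)[OF calHD(1)[OF DH] D4, of n] by linarith
    qed
    have "(\<lambda>n. C' * nrm2 (D n)) \<longlonglongrightarrow> C' * 0"
      unfolding Dsq by (intro tendsto_intros Wlim)
    then have "\<forall>\<^sub>F n in sequentially. C' * nrm2 (D n) < e / 2"
      using e by (intro order_tendstoD(2)) auto
    then obtain N where N: "\<And>n. n \<ge> N \<Longrightarrow> C' * nrm2 (D n) < e / 2" by (auto simp: eventually_sequentially)
    have "norm (powint q (D n) - 0) < e" if "n \<ge> N" for n
      using bound[of n] N[OF that] powint_nonneg[of "D n"] by simp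
    then show "\<exists>no. \<forall>n\<ge>no. norm (powint q (D n) - 0) < e" by blast
  qed
  define B where "B = ((a + b) / 2 - m) / c"
  have PW: "(\<lambda>n. powint q (W n)) \<longlonglongrightarrow> B"
  proof -
    have "(\<lambda>n. ((nrm2 (grad (W n)) + nrm2 (vroot V (W n))) / 2 - energy t (W n)) / c) \<longlonglongrightarrow> B"
      unfolding B_def using c by (intro tendsto_intros Wa Wb WE) auto
    moreover have "((nrm2 (grad (W n)) + nrm2 (vroot V (W n))) / 2 - energy t (W n)) / c = powint q (W n)" for n
      using t q_gt by (simp add: energy_def form_self c_def)
    ultimately show ?thesis by simp
  qed
  \<comment> \<open>An upper bound on the limit B suffices, as the power term enters the energy with
    a negative sign.\<close>
  have Br: "B \<le> (1 - r) powr (1 - q) * powint q u" if r: "0 < r" "r < 1" for r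
  proof -
    have "powint q (W n) \<le> (1 - r) powr (1 - q) * powint q u + r powr (1 - q) * powint q (D n)" for n
      using powint_add_le[OF uH1 calHD(1)[OF DH[of n]] r] by (simp add: D_def)
    moreover have "(\<lambda>n. (1 - r) powr (1 - q) * powint q u + r powr (1 - q) * powint q (D n))
        \<longlonglongrightarrow> (1 - r) powr (1 - q) * powint q u + r powr (1 - q) * 0"
      by (intro tendsto_intros PD)
    ultimately have "B \<le> (1 - r) powr (1 - q) * powint q u + r powr (1 - q) * 0"
      by (intro LIMSEQ_le[OF PW]) auto
    then show ?thesis by simp
  qed
  have Ble: "B \<le> powint q u"
  proof -
    \<comment> \<open>Here r = 1 / (2 (n + 1)); the factor 1/2 keeps r below 1 for n = 0 as
      well.\<close>
    have "(\<lambda>n. (1 - inverse (real (Suc n)) / 2) powr (1 - q) * powint q u) \<longlonglongrightarrow> (1 - 0 / 2) powr (1 - q) * powint q u"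
      by (intro tendsto_intros LIMSEQ_inverse_real_of_nat) auto
    moreover have "B \<le> (1 - inverse (real (Suc n)) / 2) powr (1 - q) * powint q u" for n
    proof (rule Br)
      have "inverse (real (Suc n)) \<le> 1" by (simp add: inverse_eq_divide)
      then show "inverse (real (Suc n)) / 2 < 1" by linarith
    qed simp
    ultimately have "B \<le> (1 - 0 / 2) powr (1 - q) * powint q u" by (intro LIMSEQ_le_const) auto
    then show ?thesis by simp
  qed
  have "energy t u \<le> (a + b) / 2 - c * B"
  proof -
    have "c * B \<le> c * powint q u" using Ble c by (intro mult_left_mono) auto
    then show ?thesis using ua ub unfolding energy_def form_self c_def[symmetric] by argo
  qed
  also have "\<dots> = m" using c by (simp add: B_def)
  finally have "energy t u \<le> m" .
  then have "\<forall>v. calH V v \<and> nrm2 v = 1 \<longrightarrow> energy t u \<le> energy t v"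
    using mle by (auto simp: S_def intro: order_trans)
  with uH u1 show ?thesis by blast
qed

end

subsection \<open>Lagrange multipliers and ground states\<close>

text \<open>The tangents at 1 and at the midpoint y of 1 and x are chained: the slopes at 1 and y
  differ, so following the second one from y to x gains strictly.\<close>

lemma powr_above_tangent_strict:
  fixes x r :: real
  assumes r: "1 < r" and x: "0 < x" "x \<noteq> 1"
  shows "1 + r * (x - 1) < x powr r"
proof -
  define y where "y = (1 + x) / 2"
  have y: "0 < y" using x by (simp add: y_def)
  have 1: "1 + r * (y - 1) \<le> y powr r" using powr_above_tangent[OF r, of 1 y] y by simp
  have 2: "y powr r + r * y powr (r - 1) * (x - y) \<le> x powr r" using powr_above_tangent[OF r y, of x] x by simp
  have "r * 1 * (x - y) < r * y powr (r - 1) * (x - y)"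
  proof (cases "1 < x")
    case True
    then have "1 < y powr (r - 1)" using r by (intro gr_one_powr) (auto simp: y_def)
    then show ?thesis using r True by (intro mult_strict_right_mono mult_strict_left_mono) (auto simp: y_def)
  next
    case False
    then have "y powr (r - 1) < 1 powr (r - 1)" using x y r by (intro powr_less_mono2) (auto simp: y_def)
    then show ?thesis using r False x by (intro mult_strict_right_mono_neg mult_strict_left_mono) (auto simp: y_def)
  qed
  with 1 2 have "1 + r * (y - 1) + r * (x - y) < x powr r" by simp
  then show ?thesis by (simp add: algebra_simps)
qed

context schroedinger begin

text \<open>Since \<open>nrm2\<close> is the squared norm, the factor
  \<open>1 / sqrt (nrm2 w)\<close> scales the power term by the exponent
  \<open>- q / 2\<close>.\<close>

lemma energy_normalized:
  assumes w: "calH V w" and n: "0 < nrm2 w"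
  defines "v \<equiv> (\<lambda>x. (1 / sqrt (nrm2 w)) * w x)"
  shows "calH V v" "nrm2 v = 1"
    "energy t v = form V w w / (2 * nrm2 w) - t / q * (nrm2 w powr (- q / 2) * powint q w)"
proof -
  let ?n = "nrm2 w"
  show "calH V v" unfolding v_def by (rule calH_scale[OF w])
  have s2: "(1 / sqrt ?n)\<^sup>2 = 1 / ?n" using n by (simp add: power_divide)
  show "nrm2 v = 1" unfolding v_def sqnorm_scale s2 using n by simp
  have "\<bar>1 / sqrt ?n\<bar> powr q = ?n powr (- q / 2)"
  proof -
    have "\<bar>1 / sqrt ?n\<bar> = ?n powr (- 1 / 2)"
      using n by (simp add: powr_half_sqrt[symmetric] powr_minus_divide)
    then show ?thesis by (simp add: powr_powr)
  qed
  then show "energy t v = form V w w / (2 * ?n) - t / q * (?n powr (- q / 2) * powint q w)"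
    unfolding energy_def v_def form_scale[OF w] powint_scale s2 by simp
qed

text \<open>Along the normalized curve through u in direction f, the power term is replaced by its
  tangent lower bound. The resulting explicit g lies above the energy of the curve and agrees with
  it at 0, so 0 is a local minimum of g, and g'(0) = 0 is the equation. The multiplier comes from
  differentiating the normalization.\<close>

lemma Euler_Lagrange:
  assumes u: "calH V u" "nrm2 u = 1"
    and min: "\<And>v. calH V v \<Longrightarrow> nrm2 v = 1 \<Longrightarrow> energy t u \<le> energy t v"
    and t: "0 < t" and f: "calH V f"
  shows "form V u f - (form V u u - t * powint q u) * (\<integral>x. u x * f x \<partial>lebesgue)
    - t * (\<integral>x. \<bar>u x\<bar> powr (q - 2) * u x * f x \<partial>lebesgue) = 0"
proof -
  define m where "m = (\<integral>x. u x * f x \<partial>lebesgue)"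
  define N where "N = (\<integral>x. \<bar>u x\<bar> powr (q - 2) * u x * f x \<partial>lebesgue)"
  define B where "B = powint q u"
  define A where "A = form V u u"
  define n where "n s = 1 + 2 * s * m + s\<^sup>2 * nrm2 f" for s
  define g where "g s = (A + 2 * s * form V u f + s\<^sup>2 * form V f f) / (2 * n s)
      - t / q * (n s powr (- q / 2) * (B + q * s * N))" for s
  \<comment> \<open>For |s| < d one has |2 s m| < 1 and hence n s > 0; the summand 1 covers m =
    0.\<close>
  define d where "d = 1 / (2 * \<bar>m\<bar> + 1)"
  have d: "0 < d" by (simp add: d_def)
  have npos: "0 < n s" if "\<bar>s\<bar> < d" for s
  proof -
    have "\<bar>s\<bar> * (2 * \<bar>m\<bar>) \<le> d * (2 * \<bar>m\<bar>)" using that by (intro mult_right_mono) auto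
    also have "\<dots> < 1" by (simp add: d_def field_simps)
    finally have "\<bar>2 * s * m\<bar> < 1" by (simp add: abs_mult)
    moreover have "0 \<le> s\<^sup>2 * nrm2 f" by (simp add: sqnorm_nonneg)
    ultimately show ?thesis unfolding n_def by linarith
  qed
  have g0: "g 0 = energy t u" by (simp add: g_def n_def energy_def A_def B_def)
  have le: "g 0 \<le> g s" if "\<bar>s\<bar> < d" for s
  proof -
    define w where "w = (\<lambda>x. 1 * u x + s * f x)"
    have w: "calH V w" unfolding w_def by (rule calH_lincomb[OF u(1) f])
    have wn: "nrm2 w = n s"
      unfolding w_def sqnorm_u_lincomb[OF u(1) f] by (simp add: u(2) n_def m_def)
    have wf: "form V w w = A + 2 * s * form V u f + s\<^sup>2 * form V f f"
      unfolding w_def form_lincomb[OF u(1) f] by (simp add: A_def)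
    have wB: "B + q * s * N \<le> powint q w"
      using powint_above_tangent[OF calHD(1)[OF u(1)] calHD(1)[OF f], of s]
      by (simp add: w_def B_def N_def)
    have n0: "0 < nrm2 w" using npos[OF that] by (simp add: wn)
    have "energy t u \<le> form V w w / (2 * nrm2 w) - t / q * (nrm2 w powr (- q / 2) * powint q w)"
      using min energy_normalized[OF w n0] by metis
    also have "\<dots> \<le> form V w w / (2 * nrm2 w) - t / q * (nrm2 w powr (- q / 2) * (B + q * s * N))"
      using wB t q_gt by (intro diff_left_mono mult_left_mono) auto
    also have "\<dots> = g s" by (simp add: g_def wn wf)
    finally show ?thesis by (simp add: g0)
  qed
  have dn: "(n has_real_derivative 2 * m) (at 0)"
    unfolding n_def[abs_def] by (auto intro!: derivative_eq_intros)
  have n00: "n 0 = 1" by (simp add: n_def)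
  have dp: "((\<lambda>s. n s powr (- q / 2)) has_real_derivative (- q / 2) * (2 * m)) (at 0)"
    using DERIV_chain2[OF has_real_derivative_powr[of "n 0" "- q / 2"] dn] by (simp add: n00)
  have "(g has_real_derivative (form V u f - A * m) - t / q * ((- q / 2) * (2 * m) * B + q * N)) (at 0)"
    unfolding g_def[abs_def]
  proof (rule DERIV_diff)
    show "((\<lambda>s. (A + 2 * s * form V u f + s\<^sup>2 * form V f f) / (2 * n s)) has_real_derivative form V u f - A * m) (at 0)"
      by (auto intro!: derivative_eq_intros dn simp: n00)
    have "((\<lambda>s. n s powr (- q / 2) * (B + q * s * N)) has_real_derivative (- q / 2) * (2 * m) * B + q * N) (at 0)"
    proof -
      have "((\<lambda>s. B + q * s * N) has_real_derivative q * N) (at 0)" by (auto intro!: derivative_eq_intros)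
      from DERIV_mult[OF dp this] show ?thesis by (simp add: n00)
    qed
    then show "((\<lambda>s. t / q * (n s powr (- q / 2) * (B + q * s * N))) has_real_derivative
        t / q * ((- q / 2) * (2 * m) * B + q * N)) (at 0)"
      by (rule DERIV_cmult)
  qed
  from DERIV_local_min[OF this d] le have e1: "(form V u f - A * m) - t / q * ((- q / 2) * (2 * m) * B + q * N) = 0" by auto
  have e2: "t / q * ((- q / 2) * (2 * m) * B + q * N) = t * N - t * B * m" using q_gt by (simp add: field_simps)
  have "form V u f - A * m = t * N - t * B * m" using e1 unfolding e2 by simp
  then show ?thesis
    unfolding A_def[symmetric] B_def[symmetric] m_def[symmetric] N_def[symmetric] by (simp add: algebra_simps)
qed

lemma not_AE_zero_iff:
  assumes "calH V u" shows "\<not> (AE x in lebesgue. u x = 0) \<longleftrightarrow> 0 < nrm2 u"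
proof -
  have "(AE x in lebesgue. u x = 0) \<longleftrightarrow> nrm2 u = 0"
    by (rule sqnorm_eq_0_iff[OF calHD(3)[OF assms], symmetric])
  moreover have "0 < nrm2 u \<longleftrightarrow> nrm2 u \<noteq> 0"
    using sqnorm_nonneg[of lebesgue u] by (auto simp: less_le)
  ultimately show ?thesis by (simp only:)
qed

lemma S_set_eq:
  "Sq \<mu> \<rho> = {u. calH V u \<and> 0 < nrm2 u \<and> (\<forall>f. calH V f \<longrightarrow>
    form V u f - \<mu> * (\<integral>x. u x * f x \<partial>lebesgue) - \<rho> powr (q - 2) * (\<integral>x. \<bar>u x\<bar> powr (q - 2) * u x * f x \<partial>lebesgue) = 0)}"
  unfolding S_set_def
proof (intro Collect_cong conj_cong refl)
  fix u assume u: "calH V u"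
  show "\<not> (AE x in lebesgue. u x = 0) \<longleftrightarrow> 0 < nrm2 u" by (rule not_AE_zero_iff[OF u])
  show "(\<forall>f. calH V f \<longrightarrow> dF V (q - 1) \<mu> \<rho> u f = 0) \<longleftrightarrow> (\<forall>f. calH V f \<longrightarrow>
    form V u f - \<mu> * (\<integral>x. u x * f x \<partial>lebesgue) - \<rho> powr (q - 2) * (\<integral>x. \<bar>u x\<bar> powr (q - 2) * u x * f x \<partial>lebesgue) = 0)"
    by (intro arg_cong[where f = All] ext imp_cong refl) (simp only: dF_eq[OF u])
qed

section \<open>A single value of the power term for all but countably many parameters\<close>

lemma powint_mono:
  assumes \<rho>: "0 < \<rho>" "\<rho> < \<sigma>" and u: "u \<in> Mq \<rho>" and v: "v \<in> Mq \<sigma>"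
  shows "powint q u \<le> powint q v"
proof -
  let ?t = "\<rho> powr (q - 2)" and ?s = "\<sigma> powr (q - 2)"
  have ts: "?t < ?s" using \<rho> q_gt by (intro powr_less_mono2) auto
  have "energy ?t u \<le> energy ?t v" "energy ?s v \<le> energy ?s u" using u v by (auto simp: M_set_eq)
  \<comment> \<open>Adding the two minimality inequalities cancels the quadratic forms.\<close>
  then have "(?s - ?t) / q * powint q u \<le> (?s - ?t) / q * powint q v"
    by (simp add: energy_def diff_divide_distrib left_diff_distrib)
  moreover have "0 < (?s - ?t) / q" using ts q_gt by simp
  ultimately show ?thesis by (simp only: mult_le_cancel_left_pos)
qed

text \<open>Each exceptional parameter has a rational strictly between two of its values of the
  power term. By monotonicity the gaps at different parameters are ordered, so the chosen rational
  increases strictly with the parameter, and the choice is injective.\<close>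

lemma countable_nonunique:
  "countable {\<rho>. 0 < \<rho> \<and> (\<exists>u\<in>Mq \<rho>. \<exists>v\<in>Mq \<rho>. powint q u < powint q v)}"
  (is "countable ?T")
proof -
  have "\<forall>\<rho>\<in>?T. \<exists>r\<in>\<rat>. \<exists>u\<in>Mq \<rho>. \<exists>v\<in>Mq \<rho>. powint q u < r \<and> r < powint q v"
    using Rats_dense_in_real by blast
  then have "\<forall>\<rho>\<in>?T. \<exists>r. r \<in> \<rat> \<and>
      (\<exists>u\<in>Mq \<rho>. \<exists>v\<in>Mq \<rho>. powint q u < r \<and> r < powint q v)"
    unfolding Bex_def[of "\<rat>"] .
  from bchoice[OF this] obtain r where r: "\<And>\<rho>. \<rho> \<in> ?T \<Longrightarrow> r \<rho> \<in> \<rat> \<and>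
      (\<exists>u\<in>Mq \<rho>. \<exists>v\<in>Mq \<rho>. powint q u < r \<rho> \<and> r \<rho> < powint q v)"
    by blast
  have lt: "r \<rho> < r \<sigma>" if \<rho>\<sigma>: "\<rho> \<in> ?T" "\<sigma> \<in> ?T" "\<rho> < \<sigma>" for \<rho> \<sigma>
  proof -
    obtain v where v: "v \<in> Mq \<rho>" "r \<rho> < powint q v" using r[OF \<rho>\<sigma>(1)] by blast
    obtain u where u: "u \<in> Mq \<sigma>" "powint q u < r \<sigma>" using r[OF \<rho>\<sigma>(2)] by blast
    have "powint q v \<le> powint q u"
      using powint_mono[OF _ \<rho>\<sigma>(3) v(1) u(1)] \<rho>\<sigma>(1) by simp
    with u v show ?thesis by linarith
  qed
  have "inj_on r ?T"
  proof (rule inj_onI)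
    fix \<rho> \<sigma> assume *: "\<rho> \<in> ?T" "\<sigma> \<in> ?T" "r \<rho> = r \<sigma>"
    show "\<rho> = \<sigma>" using lt[OF *(1,2)] lt[OF *(2,1)] *(3) by (cases \<rho> \<sigma> rule: linorder_cases) auto
  qed
  moreover have "countable (r ` ?T)"
    by (rule countable_subset[OF _ countable_rat]) (use r in blast)
  ultimately show ?thesis by (rule countable_image_inj_on[rotated])
qed

text \<open>A weak solution \<open>v\<close> is the unique maximum point of \<open>F\<close> along its ray, whence
  \<open>F v \<ge> F (v / \<parallel>v\<parallel>) \<ge> e \<rho> - \<mu> / 2\<close>.\<close>

lemma weak_solution_energy:
  assumes v: "v \<in> Sq \<mu> \<rho>" and \<rho>: "0 < \<rho>"
    and e: "\<And>w. calH V w \<Longrightarrow> nrm2 w = 1 \<Longrightarrow> e \<le> energy (\<rho> powr (q - 2)) w"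
  shows "e - \<mu> / 2 \<le> F_fun V (q - 1) \<mu> \<rho> v"
    and "F_fun V (q - 1) \<mu> \<rho> v \<le> e - \<mu> / 2 \<Longrightarrow> nrm2 v = 1"
proof -
  define t where "t = \<rho> powr (q - 2)"
  define n where "n = nrm2 v"
  define B where "B = powint q v"
  have t: "0 < t" using \<rho> by (simp add: t_def)
  have vH: "calH V v" and n: "0 < n" using v by (auto simp: S_set_eq n_def)
  have B: "0 < B" unfolding B_def using not_AE_zero_iff[OF vH] n by (intro powint_pos calHD(1)[OF vH]) (auto simp: n_def)
  have vn: "(\<integral>x. v x * v x \<partial>lebesgue) = n" unfolding n_def sqnorm_eq_inner by simp
  \<comment> \<open>The weak equation tested with v itself (the Nehari identity) eliminates the
    quadratic form.\<close>
  have "form V v v - \<mu> * (\<integral>x. v x * v x \<partial>lebesgue) - t * (\<integral>x. \<bar>v x\<bar> powr (q - 2) * v x * v x \<partial>lebesgue) = 0"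
    using v vH unfolding S_set_eq t_def by blast
  then have A: "form V v v = \<mu> * n + t * B"
    unfolding vn powint_eq_nonlinear B_def by simp
  \<comment> \<open>On the ray, F at sqrt x times v equals t B (x/2 - x^(q/2)/q). The value x = 1 is
    v itself, and x = 1/n is its normalization.\<close>
  define x where "x = 1 / n"
  have x: "0 < x" using n by (simp add: x_def)
  have np: "n powr (- q / 2) = x powr (q / 2)"
    using n by (simp add: x_def powr_minus_divide powr_divide)
  have "e \<le> form V v v / (2 * n) - t / q * (n powr (- q / 2) * B)"
    using e[OF energy_normalized(1,2)[OF vH]] energy_normalized(3)[OF vH, of t] n unfolding n_def B_def t_def by metis
  also have "\<dots> = \<mu> / 2 + t * B * (x / 2 - x powr (q / 2) / q)"
    unfolding A np using n by (simp add: x_def field_simps)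
  finally have le: "e - \<mu> / 2 \<le> t * B * (x / 2 - x powr (q / 2) / q)" by simp
  have F: "F_fun V (q - 1) \<mu> \<rho> v = t * B * (1 / 2 - 1 / q)"
    unfolding F_fun_eq[OF vH] energy_def t_def[symmetric] A n_def[symmetric] B_def[symmetric] by (simp add: field_simps)
  have q2: "1 < q / 2" using q_gt by simp
  have ray: "x / 2 - x powr (q / 2) / q \<le> 1 / 2 - 1 / q"
  proof -
    have "1 + q / 2 * (x - 1) \<le> x powr (q / 2)" using powr_above_tangent[OF q2, of 1 x] x by simp
    then have "(1 + q / 2 * (x - 1)) / q \<le> x powr (q / 2) / q" using q_gt by (intro divide_right_mono) auto
    moreover have "(1 + q / 2 * (x - 1)) / q = 1 / q + (x - 1) / 2" using q_gt by (simp add: field_simps)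
    ultimately show ?thesis by argo
  qed
  have ray_strict: "x / 2 - x powr (q / 2) / q < 1 / 2 - 1 / q" if "x \<noteq> 1"
  proof -
    have "(1 + q / 2 * (x - 1)) / q < x powr (q / 2) / q"
      using powr_above_tangent_strict[OF q2 x that] q_gt by (intro divide_strict_right_mono) auto
    moreover have "(1 + q / 2 * (x - 1)) / q = 1 / q + (x - 1) / 2" using q_gt by (simp add: field_simps)
    ultimately show ?thesis by argo
  qed
  have tB: "0 < t * B" using t B by simp
  show "e - \<mu> / 2 \<le> F_fun V (q - 1) \<mu> \<rho> v"
    unfolding F using le mult_left_mono[OF ray, of "t * B"] tB by linarith
  assume "F_fun V (q - 1) \<mu> \<rho> v \<le> e - \<mu> / 2"
  then have "\<not> x / 2 - x powr (q / 2) / q < 1 / 2 - 1 / q"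
    using le mult_strict_left_mono[OF _ tB, of "x / 2 - x powr (q / 2) / q" "1 / 2 - 1 / q"] unfolding F by linarith
  then have "x = 1" using ray_strict by blast
  then show "nrm2 v = 1" using n by (simp add: x_def n_def)
qed

lemma ground_states_eq_minimizers:
  assumes coercive: "filterlim V at_top at_infinity" and \<rho>: "0 < \<rho>"
    and uniq: "\<And>u v. u \<in> Mq \<rho> \<Longrightarrow> v \<in> Mq \<rho> \<Longrightarrow> powint q u = powint q v"
  shows "\<exists>\<mu>. (\<forall>u\<in>Mq \<rho>. u \<in> Sq \<mu> \<rho>) \<and> G_set V (q - 1) \<mu> \<rho> = Mq \<rho>"
proof (cases "Mq \<rho> = {}")
  case True
  have t: "0 < \<rho> powr (q - 2)" using \<rho> by simp
  \<comment> \<open>A weak solution normalizes to an admissible function, for which the existence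
    theorem would produce a minimizer.\<close>
  have "Sq \<mu> \<rho> = {}" for \<mu>
  proof (rule equals0I)
    fix v assume "v \<in> Sq \<mu> \<rho>"
    then have "calH V v" "0 < nrm2 v" by (auto simp: S_set_eq)
    from minimizer_exists[OF coercive t energy_normalized(1,2)[OF this]] True
    show False by (auto simp: M_set_eq)
  qed
  with True show ?thesis by (auto simp: G_set_def)
next
  case False
  then obtain u0 where u0: "u0 \<in> Mq \<rho>" by blast
  define t where "t = \<rho> powr (q - 2)"
  have t: "0 < t" using \<rho> by (simp add: t_def)
  \<comment> \<open>The value forced by testing the Euler-Lagrange equation of u0 with u0.\<close>
  define \<mu> where "\<mu> = form V u0 u0 - t * powint q u0"
  define e where "e = energy t u0"
  have M: "calH V u \<and> nrm2 u = 1 \<and> (\<forall>v. calH V v \<and> nrm2 v = 1 \<longrightarrow> energy t u \<le> energy t v)"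
    if "u \<in> Mq \<rho>" for u using that by (simp add: M_set_eq t_def)
  have Me: "energy t u = e" if "u \<in> Mq \<rho>" for u
    unfolding e_def using M[OF that] M[OF u0] by (intro antisym) auto
  have S: "u \<in> Sq \<mu> \<rho>" if u: "u \<in> Mq \<rho>" for u
  proof -
    \<comment> \<open>Equal minimal energies and equal power terms leave no freedom for the
      quadratic form, hence none for the multiplier.\<close>
    have "form V u u = form V u0 u0"
      using Me[OF u] uniq[OF u u0] unfolding e_def energy_def by simp
    then have "\<mu> = form V u u - t * powint q u" by (simp add: \<mu>_def uniq[OF u u0])
    then show ?thesis
      using Euler_Lagrange[of u t] M[OF u] t unfolding S_set_eq t_def[symmetric] by simp
  qed
  have emin: "e \<le> energy (\<rho> powr (q - 2)) w" if "calH V w" "nrm2 w = 1" for w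
    using M[OF u0] that unfolding e_def t_def[symmetric] by blast
  have F: "F_fun V (q - 1) \<mu> \<rho> u = e - \<mu> / 2" if "u \<in> Mq \<rho>" for u
    using M[OF that] Me[OF that] F_fun_eq[of u \<mu> \<rho>] by (simp add: t_def)
  have "G_set V (q - 1) \<mu> \<rho> = Mq \<rho>"
  proof (intro equalityI subsetI)
    fix u assume u: "u \<in> Mq \<rho>"
    then show "u \<in> G_set V (q - 1) \<mu> \<rho>"
      unfolding G_set_def using S[OF u] F[OF u] weak_solution_energy(1)[OF _ \<rho> emin] by auto
  next
    fix v assume "v \<in> G_set V (q - 1) \<mu> \<rho>"
    then have vS: "v \<in> Sq \<mu> \<rho>" and "F_fun V (q - 1) \<mu> \<rho> v \<le> F_fun V (q - 1) \<mu> \<rho> u0"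
      using S[OF u0] by (auto simp: G_set_def)
    then have Fv: "F_fun V (q - 1) \<mu> \<rho> v \<le> e - \<mu> / 2" using F[OF u0] by simp
    have vH: "calH V v" using vS by (simp add: S_set_eq)
    have v1: "nrm2 v = 1" by (rule weak_solution_energy(2)[OF vS \<rho> emin Fv])
    \<comment> \<open>At unit mass F and the energy differ by the constant \<mu> / 2.\<close>
    have "energy t v \<le> e" using Fv F_fun_eq[OF vH, of \<mu> \<rho>] v1 by (simp add: t_def)
    then have "energy t v \<le> energy t w" if "calH V w" "nrm2 w = 1" for w
      using emin[OF that] by (simp add: t_def)
    then show "v \<in> Mq \<rho>" using vH v1 by (simp add: M_set_eq t_def)
  qed
  with S show ?thesis by blast
qed

lemma AE_ground_states_eq_minimizers:
  assumes coercive: "filterlim V at_top at_infinity"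
  shows "AE \<rho> in lborel. 0 < \<rho> \<longrightarrow>
    (\<exists>\<mu>. (\<forall>u\<in>Mq \<rho>. u \<in> Sq \<mu> \<rho>) \<and> G_set V (q - 1) \<mu> \<rho> = Mq \<rho>)"
proof -
  have "AE \<rho> in lborel. \<rho> \<notin> {\<rho>. 0 < \<rho> \<and> (\<exists>u\<in>Mq \<rho>. \<exists>v\<in>Mq \<rho>. powint q u < powint q v)}"
    by (intro AE_not_in countable_imp_null_set_lborel countable_nonunique)
  then show ?thesis
  proof eventually_elim
    case (elim \<rho>)
    show ?case
    proof
      assume \<rho>: "0 < \<rho>"
      have "powint q u = powint q v" if "u \<in> Mq \<rho>" "v \<in> Mq \<rho>" for u v
        using elim \<rho> that by (metis (mono_tags, lifting) linorder_less_linear mem_Collect_eq)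
      then show "\<exists>\<mu>. (\<forall>u\<in>Mq \<rho>. u \<in> Sq \<mu> \<rho>) \<and> G_set V (q - 1) \<mu> \<rho> = Mq \<rho>"
        by (rule ground_states_eq_minimizers[OF coercive \<rho>])
    qed
  qed
qed

end

text \<open>Supplies the measurability of V. On the unit ball around x the Hoelder bound forces V y
  - V x to tend to 0.\<close>

lemma locally_Holder_imp_continuous:
  fixes V :: "'a::euclidean_space \<Rightarrow> real"
  assumes \<alpha>: "0 < \<alpha>" and H: "\<And>K. compact K \<Longrightarrow> \<exists>C. \<forall>x\<in>K. \<forall>y\<in>K. \<bar>V x - V y\<bar> \<le> C * dist x y powr \<alpha>"
  shows "continuous_on UNIV V"
proof (rule continuous_at_imp_continuous_on, intro ballI)
  fix x :: 'a
  obtain C where C: "\<And>y z. y \<in> cball x 1 \<Longrightarrow> z \<in> cball x 1 \<Longrightarrow> \<bar>V y - V z\<bar> \<le> C * dist y z powr \<alpha>"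
    using H[OF compact_cball, of x 1] by blast
  have "((\<lambda>y. V y - V x) \<longlongrightarrow> 0) (at x)"
  proof (rule Lim_null_comparison)
    have "\<forall>\<^sub>F y in at x. dist y x < 1" by (auto simp: eventually_at intro!: exI[of _ 1])
    then show "\<forall>\<^sub>F y in at x. norm (V y - V x) \<le> C * dist y x powr \<alpha>"
      by eventually_elim (use C[of _ x] in \<open>auto simp: dist_commute\<close>)
    have "((\<lambda>y. dist y x) \<longlongrightarrow> dist x x) (at x)" by (intro tendsto_intros)
    then have "((\<lambda>y. dist y x powr \<alpha>) \<longlongrightarrow> 0) (at x)"
      using \<alpha> by (intro tendsto_zero_powrI[of _ _ _ \<alpha>]) auto
    then have "((\<lambda>y. C * dist y x powr \<alpha>) \<longlongrightarrow> C * 0) (at x)" by (intro tendsto_intros)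
    then show "((\<lambda>y. C * dist y x powr \<alpha>) \<longlongrightarrow> 0) (at x)" by simp
  qed
  then show "isCont V x" by (simp add: isCont_def LIM_zero_iff)
qed

theorem theorem1p1:
  fixes V :: "'a::euclidean_space \<Rightarrow> real" and p :: real
  assumes p_gt: "1 < p" and p_lt: "p < 1 + 4 / real DIM('a)"
    and V_nonneg: "\<And>x. V x \<ge> 0"
    and V_Linf_loc: "\<And>K. compact K \<Longrightarrow> bounded (V ` K)"
    and V_Holder: "\<exists>\<alpha>. 0 < \<alpha> \<and> \<alpha> < 1 \<and>
        (\<forall>K. compact K \<longrightarrow> (\<exists>C. \<forall>x\<in>K. \<forall>y\<in>K. \<bar>V x - V y\<bar> \<le> C * dist x y powr \<alpha>))"
    and V_inf: "(INF x. V x) = 0"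
    and V_coercive: "filterlim V at_top at_infinity"
  shows "(AE \<rho> in lborel. 0 < \<rho> \<longrightarrow>
            (\<exists>\<mu>. \<forall>u\<in>M_set V p \<rho>. u \<in> S_set V p \<mu> \<rho>))
       \<and> (AE \<rho> in lborel. 0 < \<rho> \<longrightarrow>
            (\<exists>\<mu>. (\<forall>u\<in>M_set V p \<rho>. u \<in> S_set V p \<mu> \<rho>) \<and> G_set V p \<mu> \<rho> = M_set V p \<rho>))"
proof -
  obtain \<alpha> where "0 < \<alpha>" "\<And>K. compact K \<Longrightarrow> \<exists>C. \<forall>x\<in>K. \<forall>y\<in>K. \<bar>V x - V y\<bar> \<le> C * dist x y powr \<alpha>"
    using V_Holder by blast
  then have "continuous_on UNIV V" by (rule locally_Holder_imp_continuous)
  then have V_meas: "lmeas V"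
    by (intro borel_measurable_lebesgueI borel_measurable_continuous_onI)
  interpret schroedinger V "p + 1"
  proof
    show "0 \<le> V x" for x by (rule V_nonneg)
    show "lmeas V" by (rule V_meas)
    show "2 < p + 1" "p + 1 < 2 + 4 / real DIM('a)" using p_gt p_lt by simp_all
  qed
  have "AE \<rho> in lborel. 0 < \<rho> \<longrightarrow>
      (\<exists>\<mu>. (\<forall>u\<in>M_set V p \<rho>. u \<in> S_set V p \<mu> \<rho>) \<and> G_set V p \<mu> \<rho> = M_set V p \<rho>)"
    using AE_ground_states_eq_minimizers[OF V_coercive] by simp
  \<comment> \<open>The first claim is the second one with the set equality dropped.\<close>
  moreover from this have "AE \<rho> in lborel. 0 < \<rho> \<longrightarrow> (\<exists>\<mu>. \<forall>u\<in>M_set V p \<rho>. u \<in> S_set V p \<mu> \<rho>)"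
    by eventually_elim blast
  ultimately show ?thesis by blast
qed

end
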